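(* Let $\omega\in\mathbb{C}$ be an $m$th root of unity. There is a function $\epsilon(\delta)$, depending on $m$, with $\lim_{\delta\to0^+}\epsilon(\delta)=0$ such that for all $n$ and all unitaries $U,V\in M_n(\mathbb{C})$, there exist unitary operators $\mathcal U',\mathcal V'$ on $\mathbb{C}^n\otimes\mathcal H$ such that \[\mathcal U'\mathcal V'=\omega\,\mathcal V'\mathcal U',\] \[\|\mathcal U'-U\otimes I_\infty\|,\ \|\mathcal V'-V\otimes I_\infty\|\le\epsilon(\|UV-\omega VU\|),\] where $I_\infty$ is the identity operator on a Hilbert space $\mathcal H$ of countably infinite dimension.
   Context: $\|\cdot\|$ is the operator norm. *)

theory Defs
  imports Complex_Main "Jordan_Normal_Form.Schur_Decomposition"
begin

class complex_hilbert_space = banach +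
  fixes scaleC :: "complex \<Rightarrow> 'a \<Rightarrow> 'a" (infixr \<open>*\<^sub>C\<close> 75)
    and cinner :: "'a \<Rightarrow> 'a \<Rightarrow> complex"
  assumes scaleC_add_right: "c *\<^sub>C (x + y) = c *\<^sub>C x + c *\<^sub>C y"
    and scaleC_add_left: "(c + d) *\<^sub>C x = c *\<^sub>C x + d *\<^sub>C x"
    and scaleC_scaleC: "c *\<^sub>C (d *\<^sub>C x) = (c * d) *\<^sub>C x"
    and scaleR_eq_scaleC: "scaleR r x = complex_of_real r *\<^sub>C x"
    and cinner_commute: "cinner x y = cnj (cinner y x)"
    and cinner_add_left: "cinner (x + y) z = cinner x z + cinner y z"
    and cinner_scaleC_left: "cinner (c *\<^sub>C x) y = c * cinner x y"
    and cinner_self: "cinner x x = complex_of_real ((norm x)\<^sup>2)"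

definition orthonormal_basis :: "('i \<Rightarrow> 'h::complex_hilbert_space) \<Rightarrow> bool" where
  "orthonormal_basis e \<longleftrightarrow>
     (\<forall>i j. cinner (e i) (e j) = (if i = j then 1 else 0)) \<and>
     (\<forall>x. (\<forall>i. cinner x (e i) = 0) \<longrightarrow> x = 0)"

definition unitary_mat :: "nat \<Rightarrow> complex mat \<Rightarrow> bool" where
  "unitary_mat n U \<longleftrightarrow> U \<in> carrier_mat n n \<and>
     mat_adjoint U * U = 1\<^sub>m n \<and> U * mat_adjoint U = 1\<^sub>m n"

text \<open>
  For a Hilbert space \<open>H\<close>, the tensor product of \<open>\<complex>\<^sup>n\<close> with \<open>H\<close> is realised as the direct sum of
  \<open>n\<close> copies of \<open>H\<close>, i.e. as \<open>carrier_vec n\<close> over \<open>H\<close>; the elementary tensor of \<open>v\<close> and \<open>h\<close> is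
  the vector with entries \<open>v $ i *\<^sub>C h\<close>. An operator on it is a HOL function of which only the
  restriction to \<open>carrier_vec n\<close> matters. The norm below covers both \<open>\<complex>\<^sup>n\<close> (entries in \<open>\<complex>\<close>) and
  the tensor product (entries in \<open>H\<close>).
\<close>

definition l2norm_vec :: "'a::real_normed_vector vec \<Rightarrow> real" where
  "l2norm_vec x = sqrt (\<Sum>i<dim_vec x. (norm (x $ i))\<^sup>2)"

definition cinner_vec :: "'h::complex_hilbert_space vec \<Rightarrow> 'h vec \<Rightarrow> complex" where
  "cinner_vec x y = (\<Sum>i<dim_vec x. cinner (x $ i) (y $ i))"

text \<open>The analogue of \<open>onorm\<close> on \<open>carrier_vec n\<close>, with the same convention \<open>0 / 0 = 0\<close>.\<close>

definition op_norm :: "nat \<Rightarrow> ('a::real_normed_vector vec \<Rightarrow> 'a vec) \<Rightarrow> real" where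
  "op_norm n T = (SUP x\<in>carrier_vec n. l2norm_vec (T x) / l2norm_vec x)"

definition mat_norm :: "complex mat \<Rightarrow> real" where
  "mat_norm A = op_norm (dim_col A) (\<lambda>v. A *\<^sub>v v)"

definition bounded_op :: "nat \<Rightarrow> ('h::complex_hilbert_space vec \<Rightarrow> 'h vec) \<Rightarrow> bool" where
  "bounded_op n T \<longleftrightarrow>
     (\<forall>x\<in>carrier_vec n. T x \<in> carrier_vec n) \<and>
     (\<forall>x\<in>carrier_vec n. \<forall>y\<in>carrier_vec n. T (x + y) = T x + T y) \<and>
     (\<forall>c. \<forall>x\<in>carrier_vec n. T (map_vec (scaleC c) x) = map_vec (scaleC c) (T x)) \<and>
     (\<exists>K. \<forall>x\<in>carrier_vec n. l2norm_vec (T x) \<le> K * l2norm_vec x)"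

definition is_adjoint :: "nat \<Rightarrow> ('h::complex_hilbert_space vec \<Rightarrow> 'h vec) \<Rightarrow> ('h vec \<Rightarrow> 'h vec) \<Rightarrow> bool"
  where
  "is_adjoint n T S \<longleftrightarrow>
     (\<forall>x\<in>carrier_vec n. \<forall>y\<in>carrier_vec n. cinner_vec (T x) y = cinner_vec x (S y))"

definition unitary_op :: "nat \<Rightarrow> ('h::complex_hilbert_space vec \<Rightarrow> 'h vec) \<Rightarrow> bool" where
  "unitary_op n T \<longleftrightarrow> bounded_op n T \<and>
     (\<exists>S. bounded_op n S \<and> is_adjoint n T S \<and>
          (\<forall>x\<in>carrier_vec n. S (T x) = x \<and> T (S x) = x))"

definition tensor_op ::
    "complex mat \<Rightarrow> ('h::complex_hilbert_space \<Rightarrow> 'h) \<Rightarrow> 'h vec \<Rightarrow> 'h vec" where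
  "tensor_op A B x = vec (dim_row A) (\<lambda>i. \<Sum>j<dim_col A. A $$ (i, j) *\<^sub>C B (x $ j))"

end

theory Submission
  imports Defs "HOL-Analysis.Euclidean_Space" "HOL-Library.Poly_Mapping" "HOL-Library.Countable_Set"
begin

text \<open>
  Write \<open>[T]\<close> for the infinite ampliation of \<open>T\<close>. Suppose first that \<open>U\<close> and \<open>V\<close> almost commute, and
  let \<open>z\<close> be a primitive \<open>N\<close>-th root of unity. The operators
  \<open>A p q = (1/N\<^sup>2) \<Sum>k,l<N. z^(pk+ql) U^k V^l\<close> satisfy \<open>\<Sum>p,q. A\<^sup>* A = 1\<close> and split every vector into
  approximate joint eigenvectors, so \<open>(U, V)\<close> almost embeds into a pair \<open>D\<close> of commuting diagonal
  operators. The points of the spectrum of \<open>D\<close> which are no approximate joint eigenvalues carry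
  little weight and can be moved to ones that are; then \<open>[D]\<close> almost embeds into \<open>[U, V]\<close> as well,
  because the multiplicity space leaves room for orthogonal copies of the approximate eigenvectors.
  An Eilenberg swindle combines both embeddings to \<open>[U, V] \<approx> [D] \<oplus> [U, V] \<approx> [D]\<close>.

  If \<open>\<omega>\<close> has order \<open>d\<close>, then tensoring \<open>(U, V)\<close> with the \<open>d \<times> d\<close> clock and shift matrices for \<open>cnj \<omega>\<close>
  yields an almost commuting pair. Its commuting approximant is tensored with the clock and shift
  matrices for \<open>\<omega>\<close>. The product of the two clock-shift pairs commutes, with joint eigenvalues
  \<open>(\<omega>^c, \<omega>^-e)\<close>, and \<open>(\<omega>^c U, \<omega>^-e V)\<close> is almost conjugate to \<open>(U, V)\<close> by \<open>U^e V^c\<close>.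

  All constructions take place on spaces of finitely supported families, where they are purely
  algebraic, and are extended by continuity at the very end.
\<close>

section \<open>Finitely supported families\<close>

text \<open>Without ampliation the claim fails already for \<omega> = 1: there are unitary matrices
  of growing size whose commutators tend to 0 while their distance from commuting pairs does not,
  because of a winding number. Infinite multiplicity removes this obstruction: the swindle asks only
  that each pair embeds approximately into the ampliation of the other, and no index has to match.
  The Fourier sums run over a finite window of exponents. Cutting the window off costs
  \<open>2 / sqrt N\<close>, and reordering powers of \<open>U\<close> and \<open>V\<close> inside
  it costs \<open>N * \<delta>\<close>. So \<open>N\<close> is fixed first, by the accuracy wanted,
  and only then the bound on \<open>\<delta>\<close>. With \<open>\<kappa>\<close> the sum of both
  costs, a Chebyshev estimate trades the mean defect for a defect of order
  \<open>sqrt \<kappa>\<close> at each retained point. The number m enters only through the order of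
  \<omega>, which is at most m and bounds the exponents of the words \<open>U^e V^c\<close>. In
  spaces of finitely supported families an isometry may have no adjoint, since they are not
  complete; the embeddings are therefore built together with explicit adjoints.\<close>

text \<open>These spaces are not complete, hence no instances of \<open>complex_hilbert_space\<close>.\<close>

class cinner_space = real_inner +
  fixes cscale :: "complex \<Rightarrow> 'a \<Rightarrow> 'a" (infixr \<open>\<star>\<close> 75)
  assumes cscale_add_right: "c \<star> (x + y) = c \<star> x + c \<star> y"
    and cscale_add_left: "(c + d) \<star> x = c \<star> x + d \<star> x"
    and cscale_cscale: "c \<star> d \<star> x = (c * d) \<star> x"
    and scaleR_cscale: "r *\<^sub>R x = of_real r \<star> x"
    and inner_cscale_left: "inner (c \<star> x) y = inner x (cnj c \<star> y)"

alias lookup = Poly_Mapping.lookup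
alias keys = Poly_Mapping.keys
alias single = Poly_Mapping.single

lemma cscale_one [simp]: "1 \<star> (x::'a::cinner_space) = x"
  using scaleR_cscale[of 1 x] by simp

lemma cscale_zero_left [simp]: "0 \<star> (x::'a::cinner_space) = 0"
  using scaleR_cscale[of 0 x] by simp

lemma cscale_zero_right [simp]: "c \<star> (0::'a::cinner_space) = 0"
  using cscale_add_right[of c "0::'a" 0] by simp

lemma cscale_minus_right: "c \<star> (- x) = - (c \<star> x)"
  using cscale_add_right[of c x "- x"] by (simp add: eq_neg_iff_add_eq_0 add.commute)

lemma cscale_diff_right: "c \<star> (x - y) = c \<star> x - c \<star> y"
  using cscale_add_right[of c x "- y"] by (simp add: cscale_minus_right)

lemma cscale_minus_left: "(- c) \<star> x = - (c \<star> x)"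
  using cscale_add_left[of c "- c" x] by (simp add: eq_neg_iff_add_eq_0 add.commute)

lemma cscale_diff_left: "(c - d) \<star> x = c \<star> x - d \<star> x"
  using cscale_add_left[of c "- d" x] by (simp add: cscale_minus_left)

lemma cscale_sum_right: "c \<star> sum f A = (\<Sum>a\<in>A. c \<star> f a)"
  by (induction A rule: infinite_finite_induct) (auto simp: cscale_add_right)

lemma cscale_sum_left: "sum f A \<star> x = (\<Sum>a\<in>A. f a \<star> x)"
  by (induction A rule: infinite_finite_induct) (auto simp: cscale_add_left)

lemma inner_cscale_right: "inner x (c \<star> y) = inner (cnj c \<star> x) y"
  by (simp add: inner_cscale_left)

lemma inner_cscale_cscale: "inner (c \<star> x) (c \<star> y) = (cmod c)\<^sup>2 * inner x y"
proof -
  have "inner (c \<star> x) (c \<star> y) = inner x ((cnj c * c) \<star> y)"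
    by (simp add: inner_cscale_left cscale_cscale)
  also have "cnj c * c = of_real ((cmod c)\<^sup>2)"
    unfolding complex_norm_square by (simp add: mult.commute)
  also have "inner x (of_real ((cmod c)\<^sup>2) \<star> y) = (cmod c)\<^sup>2 * inner x y"
    unfolding scaleR_cscale[symmetric] by simp
  finally show ?thesis .
qed

lemma norm_cscale [simp]: "norm (c \<star> x) = cmod c * norm x"
  by (simp add: norm_eq_sqrt_inner inner_cscale_cscale real_sqrt_mult)

instantiation complex :: cinner_space
begin

definition cscale_complex :: "complex \<Rightarrow> complex \<Rightarrow> complex" where
  "cscale_complex c x = c * x"

instance
  by standard (auto simp: cscale_complex_def inner_complex_def algebra_simps scaleR_conv_of_real)

end

instantiation prod :: (cinner_space, cinner_space) cinner_space
begin

definition cscale_prod :: "complex \<Rightarrow> 'a \<times> 'b \<Rightarrow> 'a \<times> 'b" where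
  "cscale_prod c x = (c \<star> fst x, c \<star> snd x)"

instance
  by standard
    (auto simp: cscale_prod_def cscale_add_right cscale_add_left cscale_cscale inner_prod_def
      scaleR_prod_def scaleR_cscale inner_cscale_left)

end

lemma cscale_Pair [simp]: "c \<star> (x, y) = (c \<star> x, c \<star> y)"
  by (simp add: cscale_prod_def)

lemma norm_Pair_sq: "(norm (x, y))\<^sup>2 = (norm x)\<^sup>2 + (norm y)\<^sup>2"
  by (simp add: norm_Pair)

instantiation poly_mapping :: (type, cinner_space) cinner_space
begin

lift_definition scaleR_poly_mapping :: "real \<Rightarrow> ('a \<Rightarrow>\<^sub>0 'b) \<Rightarrow> 'a \<Rightarrow>\<^sub>0 'b"
  is "\<lambda>r f k. r *\<^sub>R f k"
  by (rule finite_subset[rotated]) auto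

lift_definition cscale_poly_mapping :: "complex \<Rightarrow> ('a \<Rightarrow>\<^sub>0 'b) \<Rightarrow> 'a \<Rightarrow>\<^sub>0 'b"
  is "\<lambda>c f k. c \<star> f k"
  by (rule finite_subset[rotated]) auto

definition inner_poly_mapping :: "('a \<Rightarrow>\<^sub>0 'b) \<Rightarrow> ('a \<Rightarrow>\<^sub>0 'b) \<Rightarrow> real" where
  "inner_poly_mapping f g = (\<Sum>k\<in>keys f. inner (lookup f k) (lookup g k))"

definition norm_poly_mapping :: "('a \<Rightarrow>\<^sub>0 'b) \<Rightarrow> real" where
  "norm_poly_mapping f = sqrt (inner f f)"

definition sgn_poly_mapping :: "('a \<Rightarrow>\<^sub>0 'b) \<Rightarrow> 'a \<Rightarrow>\<^sub>0 'b" where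
  "sgn_poly_mapping f = inverse (norm f) *\<^sub>R f"

definition dist_poly_mapping :: "('a \<Rightarrow>\<^sub>0 'b) \<Rightarrow> ('a \<Rightarrow>\<^sub>0 'b) \<Rightarrow> real" where
  "dist_poly_mapping f g = norm (f - g)"

definition uniformity_poly_mapping :: "(('a \<Rightarrow>\<^sub>0 'b) \<times> ('a \<Rightarrow>\<^sub>0 'b)) filter" where
  "uniformity_poly_mapping = (INF e\<in>{0<..}. principal {(f, g). dist f g < e})"

definition open_poly_mapping :: "('a \<Rightarrow>\<^sub>0 'b) set \<Rightarrow> bool" where
  "open_poly_mapping U \<longleftrightarrow> (\<forall>f\<in>U. eventually (\<lambda>(f', g). f' = f \<longrightarrow> g \<in> U) uniformity)"

lemma inner_poly_mapping_eq:
  fixes f g :: "'a \<Rightarrow>\<^sub>0 'b"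
  assumes "finite K" "keys f \<subseteq> K"
  shows "inner f g = (\<Sum>k\<in>K. inner (lookup f k) (lookup g k))"
  unfolding inner_poly_mapping_def using assms
  by (intro sum.mono_neutral_left) (auto simp: in_keys_iff)

instance
proof
  fix f g h :: "'a \<Rightarrow>\<^sub>0 'b" and r s :: real and c d :: complex
  show "r *\<^sub>R (f + g) = r *\<^sub>R f + r *\<^sub>R g" "(r + s) *\<^sub>R f = r *\<^sub>R f + s *\<^sub>R f"
    "r *\<^sub>R s *\<^sub>R f = (r * s) *\<^sub>R f" "1 *\<^sub>R f = f"
    by (transfer; simp add: fun_eq_iff scaleR_add_right scaleR_add_left)+
  show "c \<star> (f + g) = c \<star> f + c \<star> g" "(c + d) \<star> f = c \<star> f + d \<star> f"
    "c \<star> d \<star> f = (c * d) \<star> f" "r *\<^sub>R f = of_real r \<star> f"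
    by (transfer; simp add: fun_eq_iff cscale_add_right cscale_add_left cscale_cscale scaleR_cscale)+
  show "dist f g = norm (f - g)" "sgn f = inverse (norm f) *\<^sub>R f" "norm f = sqrt (inner f f)"
    by (simp_all add: dist_poly_mapping_def sgn_poly_mapping_def norm_poly_mapping_def)
  show "(uniformity :: (('a \<Rightarrow>\<^sub>0 'b) \<times> ('a \<Rightarrow>\<^sub>0 'b)) filter)
      = (INF e\<in>{0<..}. principal {(x, y). dist x y < e})"
    by (rule uniformity_poly_mapping_def)
  fix U :: "('a \<Rightarrow>\<^sub>0 'b) set"
  show "open U \<longleftrightarrow> (\<forall>x\<in>U. eventually (\<lambda>(x', y). x' = x \<longrightarrow> y \<in> U) uniformity)"
    by (rule open_poly_mapping_def)
  \<comment> \<open>One finite index set serves all the sums; listing \<open>keys (f + g)\<close>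
    explicitly makes its inclusion trivial.\<close>
  let ?K = "keys f \<union> keys g \<union> keys h \<union> keys (f + g)"
  have 1: "inner f' g' = (\<Sum>k\<in>?K. inner (lookup f' k) (lookup g' k))"
    if "f' \<in> {f, g, h, f + g}" for f' g' :: "'a \<Rightarrow>\<^sub>0 'b"
    using that by (intro inner_poly_mapping_eq) auto
  have l: "lookup (r *\<^sub>R f) k = r *\<^sub>R lookup f k" "lookup (c \<star> f) k = c \<star> lookup f k"
    "lookup (cnj c \<star> g) k = cnj c \<star> lookup g k" for k
    by (transfer; simp)+
  show "inner f g = inner g f"
    using 1[of f g] 1[of g f] by (simp add: inner_commute)
  show "inner (f + g) h = inner f h + inner g h"
    using 1[of "f + g" h] 1[of f h] 1[of g h] by (simp add: lookup_add inner_add_left sum.distrib)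
  have 2: "inner (r *\<^sub>R f) g = (\<Sum>k\<in>keys f. inner (lookup (r *\<^sub>R f) k) (lookup g k))"
    by (intro inner_poly_mapping_eq) (auto simp: in_keys_iff l)
  show "inner (r *\<^sub>R f) g = r * inner f g"
    unfolding 2 by (simp add: l inner_poly_mapping_def sum_distrib_left)
  have 3: "inner (c \<star> f) g = (\<Sum>k\<in>keys f. inner (lookup (c \<star> f) k) (lookup g k))"
    by (intro inner_poly_mapping_eq) (auto simp: in_keys_iff l)
  show "inner (c \<star> f) g = inner f (cnj c \<star> g)"
    unfolding 3 by (simp add: l inner_poly_mapping_def inner_cscale_left)
  show "0 \<le> inner f f"
    by (simp add: inner_poly_mapping_def sum_nonneg)
  show "inner f f = 0 \<longleftrightarrow> f = 0"
  proof
    assume "inner f f = 0"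
    then have "\<forall>k\<in>keys f. inner (lookup f k) (lookup f k) = 0"
      by (simp add: inner_poly_mapping_def sum_nonneg_eq_0_iff)
    then have "lookup f = (\<lambda>_. 0)" by (auto simp: in_keys_iff fun_eq_iff)
    then show "f = 0" by transfer
  qed (simp add: inner_poly_mapping_def)
qed

end

lemma lookup_cscale [simp]: "lookup (c \<star> f) k = c \<star> lookup f k"
  by transfer simp

declare lookup_add [simp] lookup_minus [simp] lookup_sum [simp]

lemma norm_sq_poly_mapping:
  fixes f :: "'k \<Rightarrow>\<^sub>0 'a::cinner_space"
  assumes "finite K" "\<And>k. k \<notin> K \<Longrightarrow> lookup f k = 0"
  shows "(norm f)\<^sup>2 = (\<Sum>k\<in>K. (norm (lookup f k))\<^sup>2)"
proof -
  have "keys f \<subseteq> K" using assms(2) by (auto simp: in_keys_iff)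
  then show ?thesis
    using inner_poly_mapping_eq[of K f f] assms(1) by (simp add: power2_norm_eq_inner)
qed

section \<open>Unitaries between subspaces\<close>

text \<open>Linearity is required on the whole type, so that compositions and block operators are
  formed without membership conditions. Isometry and surjectivity are stated relative to subspaces,
  in \<open>uni\<close>.\<close>

definition clin :: "('a::cinner_space \<Rightarrow> 'b::cinner_space) \<Rightarrow> bool" where
  "clin T \<longleftrightarrow> (\<forall>x y. T (x + y) = T x + T y) \<and> (\<forall>c x. T (c \<star> x) = c \<star> T x)"

lemma clinI: "(\<And>x y. T (x + y) = T x + T y) \<Longrightarrow> (\<And>c x. T (c \<star> x) = c \<star> T x) \<Longrightarrow> clin T"
  by (simp add: clin_def)

lemma clin_add: "clin T \<Longrightarrow> T (x + y) = T x + T y"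
  and clin_scale: "clin T \<Longrightarrow> T (c \<star> x) = c \<star> T x"
  by (simp_all add: clin_def)

lemma clin_zero: "clin T \<Longrightarrow> T 0 = 0"
  using clin_scale[of T 0 0] by simp

lemma clin_diff: "clin T \<Longrightarrow> T (x - y) = T x - T y"
  using clin_add[of T x "(-1) \<star> y"] clin_scale[of T "-1" y] by (simp add: cscale_minus_left)

lemma clin_sum: "clin T \<Longrightarrow> T (sum f A) = (\<Sum>a\<in>A. T (f a))"
  by (induction A rule: infinite_finite_induct) (auto simp: clin_zero clin_add)

lemma clin_id: "clin (\<lambda>x. x)"
  and clin_null: "clin (\<lambda>x. 0)"
  by (simp_all add: clin_def)

lemma clin_comp: "clin T \<Longrightarrow> clin T' \<Longrightarrow> clin (\<lambda>x. T (T' x))"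
  by (simp add: clin_def)

lemma clin_cscale: "clin T \<Longrightarrow> clin (\<lambda>x. c \<star> T x)"
  by (simp add: clin_def cscale_add_right cscale_cscale mult.commute)

lemma clin_funpow: "clin (T :: 'a::cinner_space \<Rightarrow> 'a) \<Longrightarrow> clin (T ^^ k)"
  by (induction k) (auto simp: clin_def)

definition csub :: "'a::cinner_space set \<Rightarrow> bool" where
  "csub S \<longleftrightarrow> 0 \<in> S \<and> (\<forall>x\<in>S. \<forall>y\<in>S. x + y \<in> S) \<and> (\<forall>c. \<forall>x\<in>S. c \<star> x \<in> S)"

lemma csub_zero: "csub S \<Longrightarrow> 0 \<in> S"
  and csub_add: "csub S \<Longrightarrow> x \<in> S \<Longrightarrow> y \<in> S \<Longrightarrow> x + y \<in> S"
  and csub_scale: "csub S \<Longrightarrow> x \<in> S \<Longrightarrow> c \<star> x \<in> S"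
  by (auto simp: csub_def)

lemma csub_diff: "csub S \<Longrightarrow> x \<in> S \<Longrightarrow> y \<in> S \<Longrightarrow> x - y \<in> S"
  using csub_add[of S x "(-1) \<star> y"] csub_scale[of S y "-1"] by (simp add: cscale_minus_left)

lemma csub_sum: "csub S \<Longrightarrow> (\<And>a. a \<in> A \<Longrightarrow> f a \<in> S) \<Longrightarrow> sum f A \<in> S"
  by (induction A rule: infinite_finite_induct) (auto simp: csub_zero csub_add)

lemma csub_UNIV: "csub UNIV"
  by (simp add: csub_def)

lemma csub_Times: "csub S \<Longrightarrow> csub R \<Longrightarrow> csub (S \<times> R)"
  by (auto simp: csub_def zero_prod_def)

text \<open>The inverse is required to be total and linear, so that it is again of the same kind.\<close>

definition uni :: "'a::cinner_space set \<Rightarrow> 'b::cinner_space set \<Rightarrow> ('a \<Rightarrow> 'b) \<Rightarrow> bool" where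
  "uni S R T \<longleftrightarrow> csub S \<and> csub R \<and> clin T \<and> (\<forall>x\<in>S. T x \<in> R \<and> norm (T x) = norm x) \<and>
     (\<exists>T'. clin T' \<and> (\<forall>y\<in>R. T' y \<in> S \<and> T (T' y) = y) \<and> (\<forall>x\<in>S. T' (T x) = x))"

lemma uniI:
  assumes "csub S" "csub R" "clin T" "clin T'"
    and "\<And>x. x \<in> S \<Longrightarrow> T x \<in> R" "\<And>x. x \<in> S \<Longrightarrow> norm (T x) = norm x"
    and "\<And>y. y \<in> R \<Longrightarrow> T' y \<in> S" "\<And>y. y \<in> R \<Longrightarrow> T (T' y) = y" "\<And>x. x \<in> S \<Longrightarrow> T' (T x) = x"
  shows "uni S R T"
  using assms unfolding uni_def by blast

lemma
  assumes "uni S R T"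
  shows uni_dom: "csub S" and uni_cod: "csub R" and uni_clin: "clin T"
    and uni_mem: "x \<in> S \<Longrightarrow> T x \<in> R" and uni_norm: "x \<in> S \<Longrightarrow> norm (T x) = norm x"
  using assms by (auto simp: uni_def)

lemma uni_inverseE:
  assumes "uni S R T"
  obtains T' where "uni R S T'" "\<And>y. y \<in> R \<Longrightarrow> T (T' y) = y" "\<And>x. x \<in> S \<Longrightarrow> T' (T x) = x"
proof -
  obtain T' where T': "clin T'" "\<And>y. y \<in> R \<Longrightarrow> T' y \<in> S" "\<And>y. y \<in> R \<Longrightarrow> T (T' y) = y"
    "\<And>x. x \<in> S \<Longrightarrow> T' (T x) = x"
    using assms by (auto simp: uni_def)
  have "norm (T' y) = norm y" if "y \<in> R" for y
    using T' that uni_norm[OF assms, of "T' y"] by simp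
  then have "uni R S T'"
    using T' assms by (intro uniI[where T' = T]) (auto simp: uni_def)
  then show ?thesis using T' that by blast
qed

lemma uni_id: "csub S \<Longrightarrow> uni S S (\<lambda>x. x)"
  by (rule uniI[where T' = "\<lambda>x. x"]) (auto simp: clin_id)

lemma uni_comp:
  assumes "uni S R T" "uni R P Q"
  shows "uni S P (\<lambda>x. Q (T x))"
proof -
  obtain T' where T': "uni R S T'" "\<And>y. y \<in> R \<Longrightarrow> T (T' y) = y" "\<And>x. x \<in> S \<Longrightarrow> T' (T x) = x"
    using uni_inverseE[OF assms(1)] by blast
  obtain Q' where Q': "uni P R Q'" "\<And>y. y \<in> P \<Longrightarrow> Q (Q' y) = y" "\<And>x. x \<in> R \<Longrightarrow> Q' (Q x) = x"
    using uni_inverseE[OF assms(2)] by blast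
  note m = uni_mem[OF assms(1)] uni_mem[OF assms(2)] uni_mem[OF T'(1)] uni_mem[OF Q'(1)]
  show ?thesis
    by (rule uniI[where T' = "\<lambda>x. T' (Q' x)"])
      (simp_all add: m T' Q' uni_norm[OF assms(1)] uni_norm[OF assms(2)] uni_dom[OF assms(1)]
        uni_cod[OF assms(2)] clin_comp uni_clin[OF assms(1)] uni_clin[OF assms(2)]
        uni_clin[OF T'(1)] uni_clin[OF Q'(1)])
qed

lemma uni_cscale:
  assumes "uni S R T" "cmod c = 1"
  shows "uni S R (\<lambda>x. c \<star> T x)"
proof -
  obtain T' where T': "uni R S T'" "\<And>y. y \<in> R \<Longrightarrow> T (T' y) = y" "\<And>x. x \<in> S \<Longrightarrow> T' (T x) = x"
    using uni_inverseE[OF assms(1)] by blast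
  have "c \<noteq> 0" using assms(2) by auto
  then show ?thesis
    by (intro uniI[where T' = "\<lambda>x. inverse c \<star> T' x"])
      (simp_all add: T' uni_mem[OF assms(1)] uni_norm[OF assms(1)] assms(2) uni_mem[OF T'(1)]
        uni_dom[OF assms(1)] uni_cod[OF assms(1)] clin_cscale uni_clin[OF assms(1)]
        uni_clin[OF T'(1)] clin_scale[OF uni_clin[OF assms(1)]] clin_scale[OF uni_clin[OF T'(1)]]
        cscale_cscale csub_scale)
qed

lemma uni_funpow: "uni S S T \<Longrightarrow> uni S S (T ^^ k)"
proof (induction k)
  case 0
  then show ?case using uni_id[OF uni_dom[OF 0]] by (simp add: id_def)
next
  case (Suc k)
  then show ?case using uni_comp[of S S "T ^^ k" S T] by (simp add: comp_def)
qed

lemma inner_polarization: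
  fixes x y :: "'a::real_inner"
  shows "inner x y = ((norm (x + y))\<^sup>2 - (norm x)\<^sup>2 - (norm y)\<^sup>2) / 2"
  by (simp add: power2_norm_eq_inner inner_add_left inner_add_right inner_commute)

lemma isometry_inner:
  assumes "csub S" "clin T" "\<And>x. x \<in> S \<Longrightarrow> norm (T x) = norm x" "x \<in> S" "y \<in> S"
  shows "inner (T x) (T y) = inner x y"
  using assms by (simp add: inner_polarization clin_add[symmetric] csub_add)

lemma uni_inner: "uni S R T \<Longrightarrow> x \<in> S \<Longrightarrow> y \<in> S \<Longrightarrow> inner (T x) (T y) = inner x y"
  by (rule isometry_inner[of S]) (auto simp: uni_def)

section \<open>Approximate unitary equivalence of pairs of operators\<close>

definition near where
  "near S U V R U' V' e \<longleftrightarrow> (\<exists>Q. uni S R Q \<and>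
     (\<forall>x\<in>S. norm (Q (U x) - U' (Q x)) \<le> e * norm x \<and> norm (Q (V x) - V' (Q x)) \<le> e * norm x))"

lemma nearI:
  assumes "uni S R Q" "\<And>x. x \<in> S \<Longrightarrow> norm (Q (U x) - U' (Q x)) \<le> e * norm x"
    "\<And>x. x \<in> S \<Longrightarrow> norm (Q (V x) - V' (Q x)) \<le> e * norm x"
  shows "near S U V R U' V' e"
  using assms unfolding near_def by blast

lemma near_exactI:
  assumes "uni S R Q" "\<And>x. x \<in> S \<Longrightarrow> Q (U x) = U' (Q x)" "\<And>x. x \<in> S \<Longrightarrow> Q (V x) = V' (Q x)"
  shows "near S U V R U' V' 0"
  using assms by (intro nearI[of S R Q]) auto

lemma near_sym:
  assumes "near S U V R U' V' e" "uni S S U" "uni S S V" "uni R R U'" "uni R R V'"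
  shows "near R U' V' S U V e"
proof -
  obtain Q where Q: "uni S R Q" "\<And>x. x \<in> S \<Longrightarrow> norm (Q (U x) - U' (Q x)) \<le> e * norm x"
    "\<And>x. x \<in> S \<Longrightarrow> norm (Q (V x) - V' (Q x)) \<le> e * norm x"
    using assms(1) by (auto simp: near_def)
  obtain Q' where Q': "uni R S Q'" "\<And>y. y \<in> R \<Longrightarrow> Q (Q' y) = y" "\<And>x. x \<in> S \<Longrightarrow> Q' (Q x) = x"
    using uni_inverseE[OF Q(1)] by blast
  have "norm (Q' (Y y) - X (Q' y)) \<le> e * norm y"
    if "uni S S X" "uni R R Y" "\<And>x. x \<in> S \<Longrightarrow> norm (Q (X x) - Y (Q x)) \<le> e * norm x" "y \<in> R"
    for X Y y
  proof -
    have m: "Q' (Y y) \<in> S" "X (Q' y) \<in> S" "Q' y \<in> S" "Y y \<in> R"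
      by (simp_all add: that(4) uni_mem[OF that(1)] uni_mem[OF that(2)] uni_mem[OF Q'(1)])
    \<comment> \<open>Applying the isometry \<open>Q\<close> moves the estimate into
      \<open>R\<close>, where it is the hypothesis at the point \<open>Q' y\<close>.\<close>
    then have "norm (Q' (Y y) - X (Q' y)) = norm (Q (Q' (Y y) - X (Q' y)))"
      using uni_norm[OF Q(1)] by (simp add: csub_diff[OF uni_dom[OF Q(1)]])
    also have "\<dots> = norm (Q (X (Q' y)) - Y (Q (Q' y)))"
      using m that(4) by (simp add: clin_diff[OF uni_clin[OF Q(1)]] Q' norm_minus_commute)
    also have "\<dots> \<le> e * norm y"
      using that(3)[OF m(3)] uni_norm[OF Q'(1) that(4)] by simp
    finally show ?thesis .
  qed
  from this[OF assms(2,4) Q(2)] this[OF assms(3,5) Q(3)] show ?thesis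
    by (intro nearI[OF Q'(1)]) simp_all
qed

lemma near_trans:
  assumes "near S U V R U' V' e" "near R U' V' P U'' V'' e'"
    "uni S S U" "uni S S V" "uni R R U'" "uni R R V'"
  shows "near S U V P U'' V'' (e + e')"
proof -
  obtain Q where Q: "uni S R Q" "\<And>x. x \<in> S \<Longrightarrow> norm (Q (U x) - U' (Q x)) \<le> e * norm x"
    "\<And>x. x \<in> S \<Longrightarrow> norm (Q (V x) - V' (Q x)) \<le> e * norm x"
    using assms(1) by (auto simp: near_def)
  obtain Q' where Q': "uni R P Q'" "\<And>x. x \<in> R \<Longrightarrow> norm (Q' (U' x) - U'' (Q' x)) \<le> e' * norm x"
    "\<And>x. x \<in> R \<Longrightarrow> norm (Q' (V' x) - V'' (Q' x)) \<le> e' * norm x"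
    using assms(2) by (auto simp: near_def)
  have "norm (Q' (Q (X x)) - Z (Q' (Q x))) \<le> (e + e') * norm x"
    if "uni S S X" "uni R R Y" "\<And>x. x \<in> S \<Longrightarrow> norm (Q (X x) - Y (Q x)) \<le> e * norm x"
      "\<And>x. x \<in> R \<Longrightarrow> norm (Q' (Y x) - Z (Q' x)) \<le> e' * norm x" "x \<in> S" for X Y Z x
  proof -
    have m: "Q (X x) \<in> R" "Y (Q x) \<in> R" "Q x \<in> R"
      by (simp_all add: that(5) uni_mem[OF that(1)] uni_mem[OF that(2)] uni_mem[OF Q(1)])
    have "norm (Q' (Q (X x)) - Q' (Y (Q x))) = norm (Q (X x) - Y (Q x))"
      using m uni_norm[OF Q'(1)] by (simp add: clin_diff[OF uni_clin[OF Q'(1)], symmetric]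
          csub_diff[OF uni_dom[OF Q'(1)]])
    also have "\<dots> \<le> e * norm x" using that by blast
    finally have "norm (Q' (Q (X x)) - Q' (Y (Q x))) \<le> e * norm x" .
    moreover have "norm (Q' (Y (Q x)) - Z (Q' (Q x))) \<le> e' * norm x"
      using that(4)[OF m(3)] uni_norm[OF Q(1) that(5)] by simp
    ultimately show ?thesis
      using norm_triangle_ineq[of "Q' (Q (X x)) - Q' (Y (Q x))" "Q' (Y (Q x)) - Z (Q' (Q x))"]
      by (simp add: algebra_simps)
  qed
  from this[OF assms(3,5) Q(2) Q'(2)] this[OF assms(4,6) Q(3) Q'(3)] show ?thesis
    by (intro nearI[OF uni_comp[OF Q(1) Q'(1)]]) simp_all
qed

section \<open>Direct sums of copies of a subspace, block operators and reindexing\<close>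

definition dsum :: "'k set \<Rightarrow> 'a::cinner_space set \<Rightarrow> ('k \<Rightarrow>\<^sub>0 'a) set" where
  "dsum K S = {f. (\<forall>k. lookup f k \<in> S) \<and> (\<forall>k. k \<notin> K \<longrightarrow> lookup f k = 0)}"

lemma dsumI: "(\<And>k. lookup f k \<in> S) \<Longrightarrow> (\<And>k. k \<notin> K \<Longrightarrow> lookup f k = 0) \<Longrightarrow> f \<in> dsum K S"
  and dsum_mem: "f \<in> dsum K S \<Longrightarrow> lookup f k \<in> S"
  and dsum_zero: "f \<in> dsum K S \<Longrightarrow> k \<notin> K \<Longrightarrow> lookup f k = 0"
  by (auto simp: dsum_def)

text \<open>The algebraic part of the tensor product of \<open>S\<close> with a Hilbert space of
  countably infinite dimension; \<open>amp T\<close> plays the role of T tensor I on it.\<close>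

abbreviation copies :: "'a::cinner_space set \<Rightarrow> (nat \<Rightarrow>\<^sub>0 'a) set" where
  "copies \<equiv> dsum UNIV"

lemma csub_dsum: "csub S \<Longrightarrow> csub (dsum K S)"
  by (auto simp: csub_def dsum_def)

lemma norm_le_lookup:
  fixes f :: "'k \<Rightarrow>\<^sub>0 'a::cinner_space" and g :: "'k \<Rightarrow>\<^sub>0 'b::cinner_space"
  assumes "\<And>k. norm (lookup g k) \<le> e * norm (lookup f k)" "e \<ge> 0"
  shows "norm g \<le> e * norm f"
proof -
  have g0: "lookup g k = 0" if "k \<notin> keys f" for k
    using assms(1)[of k] that by (auto simp: in_keys_iff)
  have "(norm g)\<^sup>2 = (\<Sum>k\<in>keys f. (norm (lookup g k))\<^sup>2)"
    by (rule norm_sq_poly_mapping) (auto simp: g0)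
  also have "\<dots> \<le> (\<Sum>k\<in>keys f. (e * norm (lookup f k))\<^sup>2)"
    by (intro sum_mono power_mono assms) auto
  also have "\<dots> = e\<^sup>2 * (\<Sum>k\<in>keys f. (norm (lookup f k))\<^sup>2)"
    by (simp add: power_mult_distrib sum_distrib_left)
  also have "(\<Sum>k\<in>keys f. (norm (lookup f k))\<^sup>2) = (norm f)\<^sup>2"
    by (rule norm_sq_poly_mapping[symmetric]) (auto simp: in_keys_iff)
  finally have "(norm g)\<^sup>2 \<le> (e * norm f)\<^sup>2"
    by (simp add: power_mult_distrib)
  then show ?thesis
    by (rule power2_le_imp_le) (simp add: assms)
qed

lemma norm_eq_lookup:
  fixes f :: "'k \<Rightarrow>\<^sub>0 'a::cinner_space" and g :: "'k \<Rightarrow>\<^sub>0 'b::cinner_space"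
  assumes "\<And>k. norm (lookup g k) = norm (lookup f k)"
  shows "norm g = norm f"
proof (rule antisym)
  have "norm g \<le> 1 * norm f" "norm f \<le> 1 * norm g"
    by (rule norm_le_lookup; simp only: assms mult_1 order_refl zero_le_one)+
  then show "norm g \<le> norm f" "norm f \<le> norm g" by (simp_all only: mult_1)
qed

text \<open>A direct sum of maps. Finite support of the result is guaranteed when the blocks send 0
  to 0, which is the hypothesis of \<open>lookup_blk\<close>.\<close>

definition blk :: "('k \<Rightarrow> 'a::zero \<Rightarrow> 'b::zero) \<Rightarrow> ('k \<Rightarrow>\<^sub>0 'a) \<Rightarrow> 'k \<Rightarrow>\<^sub>0 'b" where
  "blk T f = Abs_poly_mapping (\<lambda>k. T k (lookup f k))"

abbreviation "amp T \<equiv> blk (\<lambda>_. T)"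

lemma lookup_blk:
  assumes "\<And>k. T k 0 = 0"
  shows "lookup (blk T f) k = T k (lookup f k)"
proof -
  have "finite {k. T k (lookup f k) \<noteq> 0}"
    by (rule finite_subset[of _ "keys f"]) (auto simp: in_keys_iff assms)
  then show ?thesis by (simp add: blk_def)
qed

lemma lookup_blk_clin [simp]: "(\<And>k. clin (T k)) \<Longrightarrow> lookup (blk T f) k = T k (lookup f k)"
  by (rule lookup_blk) (simp add: clin_zero)

lemma clin_blk: "(\<And>k. clin (T k)) \<Longrightarrow> clin (blk T)"
  by (rule clinI) (auto intro!: poly_mapping_eqI simp: clin_add clin_scale)

lemma blk_blk:
  assumes "\<And>k. clin (T k)" "\<And>k. clin (T' k)"
  shows "blk T (blk T' f) = blk (\<lambda>k x. T k (T' k x)) f"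
  by (rule poly_mapping_eqI) (simp add: assms clin_comp)

lemma uni_blk:
  assumes cl: "\<And>k. clin (T k)" and S: "csub S" and R: "csub R"
    and T: "\<And>k. k \<in> K \<Longrightarrow> uni S R (T k)"
  shows "uni (dsum K S) (dsum K R) (blk T)"
proof -
  have "\<exists>T'. clin T' \<and> (\<forall>y\<in>R. T' y \<in> S) \<and>
      (k \<in> K \<longrightarrow> (\<forall>y\<in>R. T k (T' y) = y) \<and> (\<forall>x\<in>S. T' (T k x) = x))" for k
  proof (cases "k \<in> K")
    case True
    then show ?thesis using T[OF True] by (auto simp: uni_def)
  next
    case False
    \<comment> \<open>Families in the domain vanish outside \<open>K\<close>, so zero can serve as
      the inverse block there.\<close>
    then show ?thesis using S by (intro exI[of _ "\<lambda>_. 0"]) (auto simp: clin_null csub_zero)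
  qed
  then obtain T' where T': "\<And>k. clin (T' k)" "\<And>k y. y \<in> R \<Longrightarrow> T' k y \<in> S"
    "\<And>k y. k \<in> K \<Longrightarrow> y \<in> R \<Longrightarrow> T k (T' k y) = y" "\<And>k x. k \<in> K \<Longrightarrow> x \<in> S \<Longrightarrow> T' k (T k x) = x"
    by metis
  show ?thesis
  proof (rule uniI[where T' = "blk T'"])
    fix f assume f: "f \<in> dsum K S"
    have l: "norm (T k (lookup f k)) = norm (lookup f k) \<and> T k (lookup f k) \<in> R
      \<and> T' k (T k (lookup f k)) = lookup f k" for k
    proof (cases "k \<in> K")
      case True
      then show ?thesis
        using uni_mem[OF T[OF True] dsum_mem[OF f]] uni_norm[OF T[OF True] dsum_mem[OF f]]
          T'(4)[OF True dsum_mem[OF f]] by simp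
    next
      case False
      then show ?thesis
        using T'(1) cl by (simp add: dsum_zero[OF f False] clin_zero csub_zero[OF R])
    qed
    show "norm (blk T f) = norm f" by (rule norm_eq_lookup) (simp add: cl l)
    show "blk T f \<in> dsum K R"
      by (intro dsumI) (simp_all add: cl l clin_zero dsum_zero[OF f])
    show "blk T' (blk T f) = f" by (rule poly_mapping_eqI) (simp add: cl T'(1) l)
  next
    fix f assume f: "f \<in> dsum K R"
    have l: "T k (T' k (lookup f k)) = lookup f k" for k
    proof (cases "k \<in> K")
      case True
      then show ?thesis using T'(3)[OF True dsum_mem[OF f]] by simp
    next
      case False
      then show ?thesis using T'(1) cl by (simp add: dsum_zero[OF f False] clin_zero)
    qed
    show "blk T (blk T' f) = f" by (rule poly_mapping_eqI) (simp add: cl T'(1) l)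
    show "blk T' f \<in> dsum K S"
      by (intro dsumI) (simp_all add: T'(1) T'(2)[OF dsum_mem[OF f]] clin_zero dsum_zero[OF f])
  qed (simp_all add: cl T'(1) S R clin_blk csub_dsum)
qed

lemma uni_amp: "uni S R T \<Longrightarrow> uni (dsum K S) (dsum K R) (amp T)"
  by (rule uni_blk) (auto simp: uni_def)

text \<open>Pullback along \<open>\<sigma>\<close>, cut off outside \<open>L\<close>: it takes
  families over the target of \<open>\<sigma>\<close> to families over \<open>L\<close>. Injectivity
  of \<open>\<sigma>\<close> on \<open>L\<close> keeps the support finite.\<close>

definition rix :: "'l set \<Rightarrow> ('l \<Rightarrow> 'k) \<Rightarrow> ('k \<Rightarrow>\<^sub>0 'a::zero) \<Rightarrow> 'l \<Rightarrow>\<^sub>0 'a" where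
  "rix L \<sigma> f = Abs_poly_mapping (\<lambda>l. if l \<in> L then lookup f (\<sigma> l) else 0)"

lemma lookup_rix:
  assumes "inj_on \<sigma> L"
  shows "lookup (rix L \<sigma> f) l = (if l \<in> L then lookup f (\<sigma> l) else 0)"
proof -
  let ?g = "\<lambda>l. if l \<in> L then lookup f (\<sigma> l) else 0"
  have "{l. ?g l \<noteq> 0} \<subseteq> \<sigma> -` keys f \<inter> L"
    by (auto simp: in_keys_iff)
  then have "finite {l. ?g l \<noteq> 0}"
    by (rule finite_subset) (rule finite_vimage_IntI[OF finite_keys assms])
  then show ?thesis unfolding rix_def by (rule lookup_Abs_poly_mapping[THEN fun_cong])
qed

lemma clin_rix: "inj_on \<sigma> L \<Longrightarrow> clin (rix L \<sigma>)"
  by (rule clinI; rule poly_mapping_eqI; simp add: lookup_rix)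

lemma uni_rix:
  assumes b: "bij_betw \<sigma> L K" and S: "csub S"
  shows "uni (dsum K S) (dsum L S) (rix L \<sigma>)"
proof -
  obtain \<tau> where b': "bij_betw \<tau> K L" and st: "\<And>k. k \<in> K \<Longrightarrow> \<sigma> (\<tau> k) = k"
    and ts: "\<And>l. l \<in> L \<Longrightarrow> \<tau> (\<sigma> l) = l"
    by (rule that[OF bij_betw_inv_into[OF b] bij_betw_inv_into_right[OF b]
          bij_betw_inv_into_left[OF b]])
  note inj = bij_betw_imp_inj_on[OF b] bij_betw_imp_inj_on[OF b']
  note m = bij_betw_apply[OF b] bij_betw_apply[OF b']
  show ?thesis
  proof (rule uniI[where T' = "rix K \<tau>"])
    fix f assume f: "f \<in> dsum K S"
    have keys: "keys f \<subseteq> K" using dsum_zero[OF f] by (auto simp: in_keys_iff)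
    have bb: "bij_betw \<tau> (keys f) (\<tau> ` keys f)"
      by (rule bij_betw_subset[OF b' keys]) auto
    have "(norm (rix L \<sigma> f))\<^sup>2 = (\<Sum>l\<in>\<tau> ` keys f. (norm (lookup (rix L \<sigma> f) l))\<^sup>2)"
    proof (rule norm_sq_poly_mapping)
      fix l assume l: "l \<notin> \<tau> ` keys f"
      have "\<sigma> l \<notin> keys f" if "l \<in> L"
        using imageI[of "\<sigma> l" "keys f" \<tau>] l unfolding ts[OF that] by blast
      then show "lookup (rix L \<sigma> f) l = 0" by (simp add: lookup_rix[OF inj(1)] in_keys_iff)
    qed simp
    also have "\<dots> = (\<Sum>k\<in>keys f. (norm (lookup (rix L \<sigma> f) (\<tau> k)))\<^sup>2)"
      by (rule sum.reindex_bij_betw[OF bb, symmetric])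
    also have "\<dots> = (\<Sum>k\<in>keys f. (norm (lookup f k))\<^sup>2)"
      using keys by (intro sum.cong refl) (simp add: lookup_rix[OF inj(1)] st m subset_iff)
    also have "\<dots> = (norm f)\<^sup>2"
      by (rule norm_sq_poly_mapping[symmetric]) (auto simp: in_keys_iff)
    finally show "norm (rix L \<sigma> f) = norm f" by simp
    show "rix L \<sigma> f \<in> dsum L S"
      by (intro dsumI) (simp_all add: lookup_rix[OF inj(1)] csub_zero[OF S] dsum_mem[OF f])
    show "rix K \<tau> (rix L \<sigma> f) = f"
      by (intro poly_mapping_eqI)
        (simp add: lookup_rix[OF inj(1)] lookup_rix[OF inj(2)] st m dsum_zero[OF f])
  next
    fix f assume f: "f \<in> dsum L S"
    show "rix K \<tau> f \<in> dsum K S"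
      by (intro dsumI) (simp_all add: lookup_rix[OF inj(2)] csub_zero[OF S] dsum_mem[OF f])
    show "rix L \<sigma> (rix K \<tau> f) = f"
      by (intro poly_mapping_eqI)
        (simp add: lookup_rix[OF inj(1)] lookup_rix[OF inj(2)] ts m dsum_zero[OF f])
  qed (simp_all add: S inj csub_dsum clin_rix)
qed

text \<open>Together with \<open>cur\<close> this identifies an iterated direct sum with the direct
  sum over pairs of indices.\<close>

definition uncur :: "('k \<Rightarrow>\<^sub>0 ('l \<Rightarrow>\<^sub>0 'a::zero)) \<Rightarrow> ('k \<times> 'l) \<Rightarrow>\<^sub>0 'a" where
  "uncur f = Abs_poly_mapping (\<lambda>(k, l). lookup (lookup f k) l)"

definition cur :: "(('k \<times> 'l) \<Rightarrow>\<^sub>0 'a::zero) \<Rightarrow> 'k \<Rightarrow>\<^sub>0 ('l \<Rightarrow>\<^sub>0 'a)" where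
  "cur g = Abs_poly_mapping (\<lambda>k. Abs_poly_mapping (\<lambda>l. lookup g (k, l)))"

lemma lookup_uncur [simp]: "lookup (uncur f) (k, l) = lookup (lookup f k) l"
proof -
  have "finite (SIGMA k : keys f. keys (lookup f k))" by auto
  then have "finite {x. (case x of (k, l) \<Rightarrow> lookup (lookup f k) l) \<noteq> 0}"
    by (rule rev_finite_subset) (auto simp: in_keys_iff)
  then show ?thesis by (simp add: uncur_def)
qed

lemma lookup_cur [simp]: "lookup (lookup (cur g) k) l = lookup g (k, l)"
proof -
  have "finite {l. lookup g (k, l) \<noteq> 0}" for k
    by (rule finite_subset[of _ "snd ` keys g"]) (force simp: in_keys_iff)+
  then have 1: "lookup (Abs_poly_mapping (\<lambda>l. lookup g (k, l))) l = lookup g (k, l)" for k l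
    by simp
  have "finite {k. Abs_poly_mapping (\<lambda>l. lookup g (k, l)) \<noteq> 0}"
  proof (rule finite_subset[of _ "fst ` keys g"])
    show "{k. Abs_poly_mapping (\<lambda>l. lookup g (k, l)) \<noteq> 0} \<subseteq> fst ` keys g"
    proof
      fix k assume "k \<in> {k. Abs_poly_mapping (\<lambda>l. lookup g (k, l)) \<noteq> 0}"
      then have "lookup (Abs_poly_mapping (\<lambda>l. lookup g (k, l))) \<noteq> (\<lambda>_. 0)"
        by (metis (mono_tags, lifting) lookup_zero mem_Collect_eq poly_mapping_eqI)
      then obtain l where "lookup g (k, l) \<noteq> 0"
        unfolding fun_eq_iff 1 by blast
      then show "k \<in> fst ` keys g" by (force simp: in_keys_iff)
    qed
  qed auto
  then show ?thesis by (simp add: cur_def 1)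
qed

lemma clin_uncur: "clin uncur" and clin_cur: "clin cur"
  by (rule clinI; rule poly_mapping_eqI; auto intro: poly_mapping_eqI)+

lemma cur_uncur [simp]: "cur (uncur f) = f" and uncur_cur [simp]: "uncur (cur g) = g"
  by (auto intro!: poly_mapping_eqI)

lemma norm_uncur: "norm (uncur f) = norm f"
proof -
  have "(norm (uncur f))\<^sup>2 =
      (\<Sum>x\<in>(SIGMA k : keys f. keys (lookup f k)). (norm (lookup (uncur f) x))\<^sup>2)"
    by (rule norm_sq_poly_mapping) (auto simp: in_keys_iff)
  also have "\<dots> = (\<Sum>k\<in>keys f. \<Sum>l\<in>keys (lookup f k). (norm (lookup (lookup f k) l))\<^sup>2)"
    by (subst sum.Sigma) (auto intro!: sum.cong)
  also have "\<dots> = (\<Sum>k\<in>keys f. (norm (lookup f k))\<^sup>2)"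
    by (intro sum.cong refl norm_sq_poly_mapping[symmetric]) (auto simp: in_keys_iff)
  also have "\<dots> = (norm f)\<^sup>2"
    by (rule norm_sq_poly_mapping[symmetric]) (auto simp: in_keys_iff)
  finally show ?thesis by simp
qed

lemma uni_uncur:
  assumes "csub (S :: 'a::cinner_space set)"
  shows "uni (dsum (K :: 'k set) (dsum (L :: 'l set) S)) (dsum (K \<times> L) S) uncur"
proof (rule uniI[where T' = "cur :: ('k \<times> 'l \<Rightarrow>\<^sub>0 'a) \<Rightarrow> _"])
  fix f :: "'k \<Rightarrow>\<^sub>0 'l \<Rightarrow>\<^sub>0 'a" assume f: "f \<in> dsum K (dsum L S)"
  show "uncur f \<in> dsum (K \<times> L) S"
  proof (rule dsumI)
    fix x :: "'k \<times> 'l"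
    obtain k l where x: "x = (k, l)" by (cases x)
    show "lookup (uncur f) x \<in> S"
      by (simp add: x dsum_mem[OF dsum_mem[OF f]])
    assume "x \<notin> K \<times> L"
    then show "lookup (uncur f) x = 0"
      using dsum_zero[OF f, of k] dsum_zero[OF dsum_mem[OF f], of l k] by (cases "k \<in> K") (auto simp: x)
  qed
next
  fix g :: "('k \<times> 'l) \<Rightarrow>\<^sub>0 'a" assume g: "g \<in> dsum (K \<times> L) S"
  show "cur g \<in> dsum K (dsum L S)"
    by (intro dsumI poly_mapping_eqI) (simp_all add: dsum_mem[OF g] dsum_zero[OF g])
qed (simp_all add: assms norm_uncur csub_dsum clin_uncur clin_cur)

section \<open>Absorption of approximate direct summands\<close>

text \<open>Isometries that may fail to be onto. Without completeness the adjoint does not come for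
  free, and it is indispensable later: \<open>B (B' e)\<close> is the projection of \<open>e\<close>
  onto the range of \<open>B\<close>, which has to be split off.\<close>

definition isoadj :: "'a::cinner_space set \<Rightarrow> 'b::cinner_space set \<Rightarrow> ('a \<Rightarrow> 'b) \<Rightarrow> ('b \<Rightarrow> 'a) \<Rightarrow> bool" where
  "isoadj R S B B' \<longleftrightarrow> clin B \<and> clin B' \<and> (\<forall>x\<in>R. B x \<in> S \<and> norm (B x) = norm x) \<and>
     (\<forall>y\<in>S. B' y \<in> R) \<and> (\<forall>x\<in>R. \<forall>y\<in>S. inner (B x) y = inner x (B' y))"

lemma isoadjI:
  assumes "clin B" "clin B'" "\<And>x. x \<in> R \<Longrightarrow> B x \<in> S" "\<And>x. x \<in> R \<Longrightarrow> norm (B x) = norm x"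
    "\<And>y. y \<in> S \<Longrightarrow> B' y \<in> R" "\<And>x y. x \<in> R \<Longrightarrow> y \<in> S \<Longrightarrow> inner (B x) y = inner x (B' y)"
  shows "isoadj R S B B'"
  using assms by (simp add: isoadj_def)

lemma
  assumes "isoadj R S B B'"
  shows isoadj_clin: "clin B" "clin B'"
    and isoadj_mem: "x \<in> R \<Longrightarrow> B x \<in> S" and isoadj_norm: "x \<in> R \<Longrightarrow> norm (B x) = norm x"
    and isoadj_mem': "y \<in> S \<Longrightarrow> B' y \<in> R"
    and isoadj_inner: "x \<in> R \<Longrightarrow> y \<in> S \<Longrightarrow> inner (B x) y = inner x (B' y)"
  using assms by (auto simp: isoadj_def)

lemma isoadj_comp:
  assumes "isoadj R S B B'" "isoadj S P C C'"
  shows "isoadj R P (\<lambda>x. C (B x)) (\<lambda>y. B' (C' y))"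
  by (rule isoadjI)
    (simp_all add: clin_comp isoadj_clin[OF assms(1)] isoadj_clin[OF assms(2)]
      isoadj_mem[OF assms(1)] isoadj_mem[OF assms(2)] isoadj_norm[OF assms(1)]
      isoadj_norm[OF assms(2)] isoadj_mem'[OF assms(1)] isoadj_mem'[OF assms(2)]
      isoadj_inner[OF assms(1)] isoadj_inner[OF assms(2)])

lemma isoadj_uni:
  assumes "uni R S Q"
  obtains Q' where "isoadj R S Q Q'"
proof -
  obtain Q' where Q': "uni S R Q'" "\<And>y. y \<in> S \<Longrightarrow> Q (Q' y) = y" "\<And>x. x \<in> R \<Longrightarrow> Q' (Q x) = x"
    using uni_inverseE[OF assms] by blast
  have "inner (Q x) y = inner x (Q' y)" if "x \<in> R" "y \<in> S" for x y
    using uni_inner[OF assms that(1) uni_mem[OF Q'(1) that(2)]] Q'(2)[OF that(2)] by simp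
  then have "isoadj R S Q Q'"
    by (intro isoadjI) (simp_all add: uni_clin[OF assms] uni_clin[OF Q'(1)] uni_mem[OF assms]
        uni_norm[OF assms] uni_mem[OF Q'(1)])
  then show ?thesis by (rule that)
qed

lemma isoadj_amp:
  assumes "isoadj R S B B'"
  shows "isoadj (dsum K R) (dsum K S) (amp B) (amp B')"
proof -
  note cl = isoadj_clin[OF assms]
  show ?thesis
  proof (rule isoadjI)
    fix f assume f: "f \<in> dsum K R"
    show "amp B f \<in> dsum K S"
      by (rule dsumI)
        (simp_all add: cl isoadj_mem[OF assms dsum_mem[OF f]] dsum_zero[OF f] clin_zero)
    show "norm (amp B f) = norm f"
      by (rule norm_eq_lookup) (simp add: cl isoadj_norm[OF assms dsum_mem[OF f]])
    fix g assume g: "g \<in> dsum K S"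
    have "inner (amp B f) g = (\<Sum>k\<in>keys f. inner (lookup (amp B f) k) (lookup g k))"
      by (rule inner_poly_mapping_eq) (auto simp: in_keys_iff cl clin_zero)
    also have "\<dots> = (\<Sum>k\<in>keys f. inner (lookup f k) (lookup (amp B' g) k))"
      by (simp add: cl isoadj_inner[OF assms dsum_mem[OF f] dsum_mem[OF g]])
    finally show "inner (amp B f) g = inner f (amp B' g)"
      by (simp add: inner_poly_mapping_def)
  next
    fix g assume g: "g \<in> dsum K S"
    show "amp B' g \<in> dsum K R"
      by (rule dsumI)
        (simp_all add: cl isoadj_mem'[OF assms dsum_mem[OF g]] dsum_zero[OF g] clin_zero)
  qed (simp_all add: cl clin_blk)
qed

text \<open>The defect \<open>B' (B x) - x\<close> is orthogonal to itself, because \<open>B\<close>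
  preserves inner products.\<close>

lemma isoadj_left_inverse:
  assumes "csub R" "isoadj R S B B'" "x \<in> R"
  shows "B' (B x) = x"
proof -
  have m: "B' (B x) - x \<in> R"
    by (intro csub_diff assms isoadj_mem[OF assms(2)] isoadj_mem'[OF assms(2)])
  have "inner (B' (B x) - x) (B' (B x) - x) = inner (B (B' (B x) - x)) (B x) - inner (B' (B x) - x) x"
    using isoadj_inner[OF assms(2) m isoadj_mem[OF assms(2,3)]] by (simp add: inner_diff_right)
  also have "\<dots> = 0"
    using isometry_inner[OF assms(1) isoadj_clin(1)[OF assms(2)] isoadj_norm[OF assms(2)] m assms(3)]
    by simp
  finally show ?thesis by simp
qed

text \<open>The adjoint of BD - UB is D'B' - B'U', where D' and U' are the inverses of the
  unitaries; multiplying by D on the left and by U on the right gives B'U - DB' without changing the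
  norm. The proof does this by duality: the defect \<open>y\<close> is tested against itself after
  writing it as \<open>D z\<close>.\<close>

lemma isoadj_adjoint_commutator:
  assumes iso: "isoadj R S B B'" and U: "uni S S U" and D: "uni R R D"
    and err: "\<And>c. c \<in> R \<Longrightarrow> norm (B (D c) - U (B c)) \<le> \<epsilon> * norm c" and \<epsilon>: "\<epsilon> \<ge> 0" and e: "e \<in> S"
  shows "norm (B' (U e) - D (B' e)) \<le> \<epsilon> * norm e"
proof -
  define y where "y = B' (U e) - D (B' e)"
  have y: "y \<in> R"
    unfolding y_def by (intro csub_diff uni_mem[OF D] uni_mem[OF U] uni_dom[OF D] isoadj_mem'[OF iso] e)
  obtain D' where D': "uni R R D'" "\<And>y. y \<in> R \<Longrightarrow> D (D' y) = y" "\<And>x. x \<in> R \<Longrightarrow> D' (D x) = x"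
    using uni_inverseE[OF D] by blast
  define z where "z = D' y"
  have z: "z \<in> R" "D z = y" "norm z = norm y"
    using y by (simp_all add: z_def uni_mem[OF D'(1)] D'(2) uni_norm[OF D'(1)])
  have m: "B z \<in> S" "B y \<in> S" "U e \<in> S" "B' e \<in> R" "B' (U e) \<in> R"
    by (simp_all add: y z e isoadj_mem[OF iso] isoadj_mem'[OF iso] uni_mem[OF U])
  have "(norm y)\<^sup>2 = inner y (B' (U e) - D (B' e))"
    by (simp only: power2_norm_eq_inner y_def)
  also have "\<dots> = inner y (B' (U e)) - inner (D z) (D (B' e))"
    by (simp add: inner_diff_right z(2))
  also have "\<dots> = inner (B y) (U e) - inner z (B' e)"
    by (simp only: isoadj_inner[OF iso y m(3)] uni_inner[OF D z(1) m(4)])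
  also have "\<dots> = inner (B (D z)) (U e) - inner (U (B z)) (U e)"
    by (simp only: uni_inner[OF U m(1) e] isoadj_inner[OF iso z(1) e] z(2))
  also have "\<dots> = inner (B (D z) - U (B z)) (U e)"
    by (simp add: inner_diff_left)
  also have "\<dots> \<le> norm (B (D z) - U (B z)) * norm (U e)"
    by (rule norm_cauchy_schwarz)
  also have "\<dots> \<le> \<epsilon> * norm z * norm (U e)"
    by (intro mult_right_mono err z) auto
  finally have "norm y * norm y \<le> (\<epsilon> * norm e) * norm y"
    by (simp add: z(3) uni_norm[OF U e] power2_eq_square mult_ac)
  then have "norm y \<le> \<epsilon> * norm e"
    using \<epsilon> by (cases "norm y = 0") auto
  then show ?thesis by (simp add: y_def)
qed

text \<open>An Eilenberg swindle: as \<open>R\<close> is twice itself, a copy of \<open>R\<close> inside \<open>S\<close> can make room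
  for another one.\<close>

lemma near_absorb:
  assumes U: "uni S S U" and V: "uni S S V" and D: "uni R R D" and E: "uni R R E"
    and iso: "isoadj R S B B'" and t: "uni (R \<times> R) R t"
    and tD: "\<And>c c'. c \<in> R \<Longrightarrow> c' \<in> R \<Longrightarrow> t (D c, D c') = D (t (c, c'))"
    and tE: "\<And>c c'. c \<in> R \<Longrightarrow> c' \<in> R \<Longrightarrow> t (E c, E c') = E (t (c, c'))"
    and err: "\<And>c. c \<in> R \<Longrightarrow> norm (B (D c) - U (B c)) \<le> \<epsilon> * norm c"
      "\<And>c. c \<in> R \<Longrightarrow> norm (B (E c) - V (B c)) \<le> \<epsilon> * norm c"
    and \<epsilon>: "\<epsilon> \<ge> 0"
  shows "near (R \<times> S) (map_prod D U) (map_prod E V) S U V (4 * \<epsilon>)"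
proof -
  have S: "csub S" and R: "csub R" using uni_dom[OF U] uni_dom[OF D] by auto
  obtain t' where t': "uni R (R \<times> R) t'" "\<And>y. y \<in> R \<Longrightarrow> t (t' y) = y"
    "\<And>x. x \<in> R \<times> R \<Longrightarrow> t' (t x) = x"
    using uni_inverseE[OF t] by blast
  note cB = isoadj_clin(1)[OF iso] and cB' = isoadj_clin(2)[OF iso]
  note ct = uni_clin[OF t] and ct' = uni_clin[OF t'(1)]
  note Bm = isoadj_mem[OF iso] and B'm = isoadj_mem'[OF iso] and Bn = isoadj_norm[OF iso]
  note li = isoadj_left_inverse[OF R iso]
  have tm: "t (c, c') \<in> R" if "c \<in> R" "c' \<in> R" for c c'
    using uni_mem[OF t] that by simp
  have t'm: "fst (t' y) \<in> R" "snd (t' y) \<in> R" if "y \<in> R" for y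
    using uni_mem[OF t'(1) that] by (simp_all add: mem_Times_iff)
  \<comment> \<open>\<open>e - B (B' e)\<close> is the part of \<open>e\<close> orthogonal to the
    range of \<open>B\<close>.\<close>
  have pyth: "(norm (B c + (e - B (B' e))))\<^sup>2 = (norm c)\<^sup>2 + (norm (e - B (B' e)))\<^sup>2"
    if "c \<in> R" "e \<in> S" for c e
  proof -
    have "e - B (B' e) \<in> S" by (intro csub_diff[OF S] that Bm B'm)
    moreover have "B' (e - B (B' e)) = 0"
      by (simp add: clin_diff[OF cB'] li B'm that)
    ultimately have "inner (B c) (e - B (B' e)) = 0"
      using isoadj_inner[OF iso that(1)] by simp
    then have "(norm (B c + (e - B (B' e))))\<^sup>2 = (norm (B c))\<^sup>2 + (norm (e - B (B' e)))\<^sup>2"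
      by (simp add: power2_norm_eq_inner inner_add_left inner_add_right inner_commute)
    then show ?thesis by (simp add: Bn[OF that(1)])
  qed
  have dec: "(norm e)\<^sup>2 = (norm (B' e))\<^sup>2 + (norm (e - B (B' e)))\<^sup>2" if "e \<in> S" for e
    using pyth[OF B'm[OF that] that] by simp
  have B'n: "norm (B' e) \<le> norm e" if "e \<in> S" for e
    by (rule power2_le_imp_le) (simp_all add: dec[OF that])
  \<comment> \<open>The component of \<open>e\<close> in the range of \<open>B\<close> is merged
    with \<open>c\<close> through \<open>t\<close> and put back by \<open>B\<close>, while the
    orthogonal part of \<open>e\<close> stays in place. \<open>Q'\<close> undoes this by splitting
    \<open>B' e\<close> with \<open>t'\<close>.\<close>
  define Q where "Q x = B (t (fst x, B' (snd x))) + (snd x - B (B' (snd x)))" for x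
  define Q' where "Q' e = (fst (t' (B' e)), B (snd (t' (B' e))) + (e - B (B' e)))" for e
  have "uni (R \<times> S) S Q"
  proof (rule uniI[where T' = Q'])
    show "clin Q"
    proof (rule clinI)
      fix x y :: "'b \<times> 'a"
      have "t (fst x + fst y, B' (snd x) + B' (snd y)) = t (fst x, B' (snd x)) + t (fst y, B' (snd y))"
        using clin_add[OF ct, of "(fst x, B' (snd x))" "(fst y, B' (snd y))"] by simp
      then show "Q (x + y) = Q x + Q y"
        by (simp add: Q_def clin_add[OF cB] clin_add[OF cB'])
    next
      fix c and x :: "'b \<times> 'a"
      have "t (c \<star> fst x, c \<star> B' (snd x)) = c \<star> t (fst x, B' (snd x))"
        using clin_scale[OF ct, of c "(fst x, B' (snd x))"] by simp
      then show "Q (c \<star> x) = c \<star> Q x"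
        by (simp add: Q_def cscale_prod_def clin_scale[OF cB] clin_scale[OF cB']
            cscale_add_right cscale_diff_right)
    qed
    show "clin Q'"
      by (rule clinI)
        (simp_all add: Q'_def clin_add[OF cB] clin_add[OF cB'] clin_add[OF ct'] clin_scale[OF cB]
          clin_scale[OF cB'] clin_scale[OF ct'] cscale_prod_def cscale_add_right cscale_diff_right)
  next
    fix x assume "x \<in> R \<times> S"
    then obtain c e where x: "x = (c, e)" "c \<in> R" "e \<in> S" by auto
    have tR: "t (c, B' e) \<in> R" by (intro tm x B'm)
    show "Q x \<in> S"
      unfolding Q_def by (simp add: x csub_add[OF S] csub_diff[OF S] Bm B'm tR)
    have "(norm (Q x))\<^sup>2 = (norm (t (c, B' e)))\<^sup>2 + (norm (e - B (B' e)))\<^sup>2"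
      using pyth[OF tR x(3)] by (simp add: Q_def x)
    also have "norm (t (c, B' e)) = norm (c, B' e)"
      using uni_norm[OF t, of "(c, B' e)"] x B'm by simp
    finally have "(norm (Q x))\<^sup>2 = (norm x)\<^sup>2"
      by (simp add: x(1) norm_Pair_sq dec[OF x(3)])
    then show "norm (Q x) = norm x" by simp
    have B'Q: "B' (Q x) = t (c, B' e)"
      by (simp add: Q_def x clin_add[OF cB'] clin_diff[OF cB'] li tR B'm)
    have "t' (t (c, B' e)) = (c, B' e)" using t'(3) x B'm by simp
    then show "Q' (Q x) = x"
      unfolding Q'_def B'Q by (simp add: Q_def x)
  next
    fix e assume e: "e \<in> S"
    note eR = B'm[OF e]
    show "Q' e \<in> R \<times> S"
      by (simp add: Q'_def csub_add[OF S] csub_diff[OF S] Bm B'm e t'm)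
    have "B' (snd (Q' e)) = snd (t' (B' e))"
      by (simp add: Q'_def clin_add[OF cB'] clin_diff[OF cB'] li t'm[OF eR] eR)
    then show "Q (Q' e) = e"
      unfolding Q_def by (simp add: Q'_def t'(2)[OF eR])
  qed (simp_all add: csub_Times S R)
  moreover have "norm (Q (map_prod X Y x) - Y (Q x)) \<le> 4 * \<epsilon> * norm x"
    if X: "uni R R X" and Y: "uni S S Y"
      and tX: "\<And>c c'. c \<in> R \<Longrightarrow> c' \<in> R \<Longrightarrow> t (X c, X c') = X (t (c, c'))"
      and er: "\<And>c. c \<in> R \<Longrightarrow> norm (B (X c) - Y (B c)) \<le> \<epsilon> * norm c"
      and xm: "x \<in> R \<times> S" for X Y x
  proof -
    obtain c e where x: "x = (c, e)" "c \<in> R" "e \<in> S" using xm by auto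
    \<comment> \<open>The failure of \<open>B'\<close> to intertwine \<open>Y\<close> with
      \<open>X\<close>, which the adjoint estimate controls.\<close>
    define g where "g = B' (Y e) - X (B' e)"
    define s where "s = t (c, B' e)"
    note eR = B'm[OF x(3)]
    have m: "g \<in> R" "s \<in> R"
      unfolding g_def s_def
      by (intro csub_diff[OF R] uni_mem[OF X] uni_mem[OF Y] B'm x tm)+
    have g: "norm g \<le> \<epsilon> * norm e"
      unfolding g_def by (rule isoadj_adjoint_commutator[OF iso Y X er \<epsilon> x(3)])
    have "t (X c, B' (Y e)) = t (X c, X (B' e)) + t (0, g)"
      using clin_add[OF ct, of "(X c, X (B' e))" "(0, g)"] by (simp add: g_def)
    then have tt: "t (X c, B' (Y e)) = X s + t (0, g)"
      by (simp add: tX x eR s_def)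
    have gt: "norm (B (t (0, g))) = norm g" "norm (B g) = norm g"
      using uni_norm[OF t, of "(0, g)"] m csub_zero[OF R] Bn[OF tm[of 0 g]] Bn[OF m(1)]
      by simp_all
    have sn: "norm s \<le> norm x"
    proof (rule power2_le_imp_le)
      have "norm s = norm (c, B' e)"
        using uni_norm[OF t, of "(c, B' e)"] x eR by (simp add: s_def)
      then show "(norm s)\<^sup>2 \<le> (norm x)\<^sup>2"
        using B'n[OF x(3)] by (simp add: x(1) norm_Pair_sq power_mono)
    qed simp
    have en: "norm e \<le> norm x"
      by (rule power2_le_imp_le) (simp_all add: x(1) norm_Pair_sq)
    \<comment> \<open>Four errors of size at most \<open>\<epsilon> * norm x\<close>: the defect of
      \<open>B\<close> at \<open>s\<close> and at \<open>B' e\<close>, and \<open>g\<close> once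
      through \<open>t\<close> and once directly. This is the factor 4.\<close>
    have "Q (map_prod X Y x) - Y (Q x) =
        (B (X s) - Y (B s)) + B (t (0, g)) - B g - (B (X (B' e)) - Y (B (B' e)))"
      by (simp add: Q_def x(1) tt s_def[symmetric] clin_add[OF cB] clin_diff[OF cB]
          clin_add[OF uni_clin[OF Y]] clin_diff[OF uni_clin[OF Y]])
        (simp add: g_def clin_diff[OF cB])
    also have "norm \<dots> \<le> norm (B (X s) - Y (B s)) + norm (B (t (0, g))) + norm (B g)
        + norm (B (X (B' e)) - Y (B (B' e)))"
      by (intro order_trans[OF norm_triangle_ineq4] add_mono order_trans[OF norm_triangle_ineq]
          order_refl)
    also have "\<dots> \<le> \<epsilon> * norm x + \<epsilon> * norm x + \<epsilon> * norm x + \<epsilon> * norm x"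
    proof -
      have "norm (B (X s) - Y (B s)) \<le> \<epsilon> * norm x"
        using er[OF m(2)] mult_left_mono[OF sn \<epsilon>] by linarith
      moreover have "norm (B (X (B' e)) - Y (B (B' e))) \<le> \<epsilon> * norm x"
        using er[OF eR] mult_left_mono[OF order_trans[OF B'n[OF x(3)] en] \<epsilon>] by linarith
      moreover have "norm g \<le> \<epsilon> * norm x"
        using g mult_left_mono[OF en \<epsilon>] by linarith
      ultimately show ?thesis unfolding gt by linarith
    qed
    finally show ?thesis by simp
  qed
  from this[OF D U tD err(1)] this[OF E V tE err(2)] have
    "norm (Q (map_prod D U x) - U (Q x)) \<le> 4 * \<epsilon> * norm x"
    "norm (Q (map_prod E V x) - V (Q x)) \<le> 4 * \<epsilon> * norm x" if "x \<in> R \<times> S" for x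
    using that by blast+
  ultimately show ?thesis by (intro nearI) blast+
qed

text \<open>Interleaving of two families. It acts on the indices only and so commutes with
  ampliations; this is the map \<open>t\<close> that \<open>near_absorb\<close> asks for.\<close>

definition merge :: "(nat \<Rightarrow>\<^sub>0 'a::cinner_space) \<times> (nat \<Rightarrow>\<^sub>0 'a) \<Rightarrow> nat \<Rightarrow>\<^sub>0 'a" where
  "merge x = rix {k. even k} (\<lambda>k. k div 2) (fst x) + rix {k. odd k} (\<lambda>k. k div 2) (snd x)"

lemma bij_even_half: "bij_betw (\<lambda>k. k div 2) {k::nat. even k} UNIV"
  by (rule bij_betw_byWitness[where f' = "\<lambda>k. 2 * k"]) auto

lemma bij_odd_half: "bij_betw (\<lambda>k. k div 2) {k::nat. odd k} UNIV"
  by (rule bij_betw_byWitness[where f' = "\<lambda>k. 2 * k + 1"]) auto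

lemma inj_half: "inj_on (\<lambda>k. k div 2) {k::nat. even k}" "inj_on (\<lambda>k. k div 2) {k::nat. odd k}"
  using bij_even_half bij_odd_half by (auto dest: bij_betw_imp_inj_on)

lemma lookup_merge:
  "lookup (merge x) k = lookup (if even k then fst x else snd x) (k div 2)"
  by (simp add: merge_def lookup_rix inj_half)

lemma clin_merge: "clin merge"
  by (rule clinI; rule poly_mapping_eqI; simp add: lookup_merge cscale_prod_def)

lemma merge_amp: "clin T \<Longrightarrow> merge (amp T f, amp T g) = amp T (merge (f, g))"
  by (rule poly_mapping_eqI) (simp add: lookup_merge)

lemma uni_merge:
  assumes S: "csub S"
  shows "uni (copies S \<times> copies S) (copies S) merge"
proof -
  let ?e = "rix UNIV (\<lambda>k::nat. 2 * k) :: (nat \<Rightarrow>\<^sub>0 'a) \<Rightarrow> nat \<Rightarrow>\<^sub>0 'a"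
  let ?o = "rix UNIV (\<lambda>k::nat. 2 * k + 1) :: (nat \<Rightarrow>\<^sub>0 'a) \<Rightarrow> nat \<Rightarrow>\<^sub>0 'a"
  have inj: "inj (\<lambda>k::nat. 2 * k)" "inj (\<lambda>k::nat. 2 * k + 1)"
    by (auto simp: inj_def)
  have n: "norm (merge (f, g)) = norm (f, g)" for f g :: "nat \<Rightarrow>\<^sub>0 'a"
  proof -
    let ?f = "rix {k. even k} (\<lambda>k. k div 2) f" and ?g = "rix {k. odd k} (\<lambda>k. k div 2) g"
    have "f \<in> dsum UNIV UNIV" "g \<in> dsum UNIV UNIV" by (auto intro: dsumI)
    then have nn: "norm ?f = norm f" "norm ?g = norm g"
      using uni_norm[OF uni_rix[OF bij_even_half csub_UNIV]]
        uni_norm[OF uni_rix[OF bij_odd_half csub_UNIV]] by blast+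
    \<comment> \<open>One summand lives on the even indices, the other on the odd ones.\<close>
    have "inner ?f ?g = 0"
      unfolding inner_poly_mapping_def by (rule sum.neutral) (auto simp: lookup_rix inj_half)
    then have "(norm (?f + ?g))\<^sup>2 = (norm ?f)\<^sup>2 + (norm ?g)\<^sup>2"
      by (simp add: power2_norm_eq_inner inner_add_left inner_add_right inner_commute)
    then have "(norm (merge (f, g)))\<^sup>2 = (norm (f, g))\<^sup>2"
      by (simp add: merge_def norm_Pair_sq nn)
    then show ?thesis by simp
  qed
  show ?thesis
  proof (rule uniI[where T' = "\<lambda>h. (?e h, ?o h)"])
    show "clin (\<lambda>h. (?e h, ?o h))"
      by (rule clinI)
        (simp_all only: clin_add[OF clin_rix[OF inj(1)]] clin_add[OF clin_rix[OF inj(2)]]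
          clin_scale[OF clin_rix[OF inj(1)]] clin_scale[OF clin_rix[OF inj(2)]] add_Pair cscale_Pair)
  next
    fix x assume x: "x \<in> copies S \<times> copies S"
    then have "lookup (fst x) k \<in> S" "lookup (snd x) k \<in> S" for k
      by (auto simp: dsum_mem mem_Times_iff)
    then show "merge x \<in> copies S"
      by (intro dsumI) (auto simp: lookup_merge)
    show "norm (merge x) = norm x" using n[of "fst x" "snd x"] by simp
    have "?e (merge x) = fst x" "?o (merge x) = snd x"
      by (rule poly_mapping_eqI; simp only: lookup_rix[OF inj(1)] lookup_rix[OF inj(2)]; simp add:
          lookup_merge)+
    then show "(?e (merge x), ?o (merge x)) = x" by simp
  next
    fix h assume h: "h \<in> copies S"
    show "(?e h, ?o h) \<in> copies S \<times> copies S"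
      by (auto intro!: dsumI simp: lookup_rix[OF inj(1)] lookup_rix[OF inj(2)] dsum_mem[OF h]
          simp del: add_2_eq_Suc' One_nat_def)
    show "merge (?e h, ?o h) = h"
      by (rule poly_mapping_eqI)
        (auto simp: lookup_merge lookup_rix[OF inj(1)] lookup_rix[OF inj(2), unfolded One_nat_def
            add_Suc_right add_0_right] elim!: evenE oddE)
  qed (simp_all add: csub_Times csub_dsum S clin_merge)
qed

lemma near_swap:
  assumes "csub S" "csub R"
  shows "near (R \<times> S) (map_prod D U) (map_prod E V) (S \<times> R) (map_prod U D) (map_prod V E) 0"
proof (rule near_exactI)
  show "uni (R \<times> S) (S \<times> R) prod.swap"
    using assms
    by (intro uniI[where T' = prod.swap] clinI) (auto simp: csub_Times cscale_prod_def norm_Pair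
        add.commute)
qed auto

lemma uni_map_prod:
  assumes "uni S S U" "uni R R D"
  shows "uni (S \<times> R) (S \<times> R) (map_prod U D)"
proof -
  obtain U' where U': "uni S S U'" "\<And>y. y \<in> S \<Longrightarrow> U (U' y) = y" "\<And>x. x \<in> S \<Longrightarrow> U' (U x) = x"
    using uni_inverseE[OF assms(1)] by blast
  obtain D' where D': "uni R R D'" "\<And>y. y \<in> R \<Longrightarrow> D (D' y) = y" "\<And>x. x \<in> R \<Longrightarrow> D' (D x) = x"
    using uni_inverseE[OF assms(2)] by blast
  have cl: "clin (map_prod X Y)" if "uni S S X" "uni R R Y" for X Y
    by (rule clinI) (auto simp: cscale_prod_def map_prod_def clin_add[OF uni_clin[OF that(1)]]
      clin_add[OF uni_clin[OF that(2)]] clin_scale[OF uni_clin[OF that(1)]]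
      clin_scale[OF uni_clin[OF that(2)]] split_beta)
  show ?thesis
    by (rule uniI[where T' = "map_prod U' D'"])
      (auto simp: norm_Pair U' D' cl assms uni_dom[OF assms(1)] uni_dom[OF assms(2)] csub_Times
        uni_mem[OF assms(1)] uni_mem[OF assms(2)] uni_mem[OF U'(1)] uni_mem[OF D'(1)]
        uni_norm[OF assms(1)] uni_norm[OF assms(2)])
qed

text \<open>A Schroeder-Bernstein argument up to errors: each of the two ampliated pairs absorbs the
  other, so both are close to their direct sum. Each absorption costs \<open>4 * \<epsilon>\<close>,
  and swapping the summands is exact.\<close>

lemma near_amp_mutual:
  assumes U: "uni S S U" and V: "uni S S V" and D: "uni R R D" and E: "uni R R E"
    and A: "isoadj (copies S) (copies R) A A'"
    and B: "isoadj (copies R) (copies S) B B'"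
    and errA: "\<And>f. f \<in> copies S \<Longrightarrow> norm (A (amp U f) - amp D (A f)) \<le> \<epsilon> * norm f"
      "\<And>f. f \<in> copies S \<Longrightarrow> norm (A (amp V f) - amp E (A f)) \<le> \<epsilon> * norm f"
    and errB: "\<And>f. f \<in> copies R \<Longrightarrow> norm (B (amp D f) - amp U (B f)) \<le> \<epsilon> * norm f"
      "\<And>f. f \<in> copies R \<Longrightarrow> norm (B (amp E f) - amp V (B f)) \<le> \<epsilon> * norm f"
    and \<epsilon>: "\<epsilon> \<ge> 0"
  shows "near (copies S) (amp U) (amp V) (copies R) (amp D) (amp E) (8 * \<epsilon>)"
proof -
  let ?S = "copies S" and ?R = "copies R"
  note un = uni_amp[OF U, of "UNIV :: nat set"] uni_amp[OF V, of "UNIV :: nat set"]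
    uni_amp[OF D, of "UNIV :: nat set"] uni_amp[OF E, of "UNIV :: nat set"]
  note cl = uni_clin[OF U] uni_clin[OF V] uni_clin[OF D] uni_clin[OF E]
  have 1: "near (?R \<times> ?S) (map_prod (amp D) (amp U)) (map_prod (amp E) (amp V)) ?S (amp U) (amp V)
      (4 * \<epsilon>)"
    by (rule near_absorb[OF un(1,2,3,4) B uni_merge[OF uni_dom[OF D]]])
      (simp_all add: merge_amp cl errB \<epsilon>)
  have 2: "near (?S \<times> ?R) (map_prod (amp U) (amp D)) (map_prod (amp V) (amp E)) ?R (amp D) (amp E)
      (4 * \<epsilon>)"
    by (rule near_absorb[OF un(3,4,1,2) A uni_merge[OF uni_dom[OF U]]])
      (simp_all add: merge_amp cl errA \<epsilon>)
  note up = uni_map_prod[OF un(3,1)] uni_map_prod[OF un(4,2)]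
    uni_map_prod[OF un(1,3)] uni_map_prod[OF un(2,4)]
  have "near ?S (amp U) (amp V) (?S \<times> ?R) (map_prod (amp U) (amp D)) (map_prod (amp V) (amp E)) (4
      * \<epsilon> + 0)"
    by (rule near_trans[OF near_sym[OF 1 up(1,2) un(1,2)]
          near_swap[OF uni_dom[OF un(1)] uni_dom[OF un(3)]] un(1,2) up(1,2)])
  from near_trans[OF this 2 un(1,2) up(3,4)] show ?thesis by simp
qed

section \<open>Fourier transforms\<close>

definition prim_root :: "nat \<Rightarrow> complex \<Rightarrow> bool" where
  "prim_root N z \<longleftrightarrow> N \<ge> 1 \<and> z ^ N = 1 \<and> (\<forall>k. 0 < k \<and> k < N \<longrightarrow> z ^ k \<noteq> 1)"

lemma root_of_unity_cmod: "z ^ N = 1 \<Longrightarrow> N \<ge> 1 \<Longrightarrow> cmod z = 1"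
  by (metis norm_ge_zero norm_one norm_power not_one_le_zero one_power2 power_eq_imp_eq_base
      power_one zero_le_one zero_less_iff_neq_zero)

lemma cmod_one_cnj: "cmod z = 1 \<Longrightarrow> z * cnj z = 1" "cmod z = 1 \<Longrightarrow> cnj z * z = 1"
  by (simp_all add: complex_norm_square[symmetric] mult.commute[of "cnj z"])

text \<open>A geometric sum whose ratio \<open>w\<close> is an \<open>N\<close>-th root of unity,
  different from 1 by primitivity unless \<open>j = k\<close>.\<close>

lemma prim_root_orthogonality:
  assumes z: "prim_root N z" and jk: "j < N" "k < N"
  shows "(\<Sum>p<N. z ^ (p * j) * cnj (z ^ (p * k))) = (if j = k then of_nat N else 0)"
proof -
  have c: "cmod z = 1" using z root_of_unity_cmod by (auto simp: prim_root_def)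
  have zn: "z ^ N = 1" using z by (simp add: prim_root_def)
  define w where "w = z ^ j * cnj (z ^ k)"
  have "(\<Sum>p<N. z ^ (p * j) * cnj (z ^ (p * k))) = (\<Sum>p<N. w ^ p)"
    by (simp add: w_def power_mult_distrib power_mult[symmetric] mult.commute)
  also have "\<dots> = (if j = k then of_nat N else 0)"
  proof (cases "j = k")
    case True
    have "w = (z * cnj z) ^ k" by (simp add: w_def True power_mult_distrib)
    then show ?thesis by (simp add: True cmod_one_cnj c)
  next
    case False
    have 1: "z ^ a * cnj (z ^ b) \<noteq> 1" if "b < a" "a < N" for a b
    proof
      assume "z ^ a * cnj (z ^ b) = 1"
      moreover have "z ^ a = z ^ (a - b) * z ^ b"
        using that by (simp add: power_add[symmetric])
      ultimately have "z ^ (a - b) * (z ^ b * cnj (z ^ b)) = 1" by (simp add: mult.assoc)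
      then have "z ^ (a - b) = 1" by (simp only: cmod_one_cnj norm_power c power_one mult_1_right)
      moreover have "0 < a - b" "a - b < N" using that by auto
      ultimately show False using z unfolding prim_root_def by blast
    qed
    \<comment> \<open>Primitivity speaks of natural exponents only, so for \<open>j < k\<close> the
      conjugate of \<open>w\<close> is considered.\<close>
    have "w \<noteq> 1"
    proof (cases "k < j")
      case True
      then show ?thesis using 1 jk by (simp add: w_def)
    next
      case 2: False
      have "cnj w \<noteq> 1" using 1[of j k] 2 False jk by (simp add: w_def mult.commute)
      then show ?thesis by auto
    qed
    moreover have "w ^ N = 1"
    proof -
      have "w ^ N = (z ^ N) ^ j * cnj ((z ^ N) ^ k)"
        by (simp add: w_def power_mult_distrib mult.commute flip: power_mult)
      then show ?thesis by (simp add: zn)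
    qed
    ultimately show ?thesis using False by (simp add: geometric_sum)
  qed
  finally show ?thesis .
qed

text \<open>Expanding the squares gives a triple sum, and summing over the frequency
  \<open>p\<close> first leaves only the diagonal terms.\<close>

lemma parseval:
  fixes g :: "nat \<Rightarrow> 'a::cinner_space"
  assumes z: "prim_root N z"
  shows "(\<Sum>p<N. (norm (\<Sum>k<N. z ^ (p * k) \<star> g k))\<^sup>2) = N * (\<Sum>k<N. (norm (g k))\<^sup>2)"
proof -
  have "(\<Sum>p<N. (norm (\<Sum>k<N. z ^ (p * k) \<star> g k))\<^sup>2)
      = (\<Sum>p<N. \<Sum>j<N. \<Sum>k<N. inner ((z ^ (p * j) * cnj (z ^ (p * k))) \<star> g j) (g k))"
    unfolding power2_norm_eq_inner inner_sum_left unfolding inner_sum_right inner_cscale_right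
      cscale_cscale by (simp only: mult.commute)
  also have "\<dots> = (\<Sum>j<N. \<Sum>p<N. \<Sum>k<N. inner ((z ^ (p * j) * cnj (z ^ (p * k))) \<star> g j) (g k))"
    by (rule sum.swap)
  also have "\<dots> = (\<Sum>j<N. \<Sum>k<N. \<Sum>p<N. inner ((z ^ (p * j) * cnj (z ^ (p * k))) \<star> g j) (g k))"
    by (rule sum.cong[OF refl]) (rule sum.swap)
  also have "\<dots> = (\<Sum>j<N. \<Sum>k<N. inner ((if j = k then of_nat N else 0) \<star> g j) (g k))"
    by (intro sum.cong refl)
      (simp only: inner_sum_left[symmetric] cscale_sum_left[symmetric]
        prim_root_orthogonality[OF z] lessThan_iff)
  also have "\<dots> = (\<Sum>j<N. \<Sum>k<N. if j = k then N * (norm (g k))\<^sup>2 else 0)"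
  proof (intro sum.cong refl)
    fix j k
    have "inner (of_nat N \<star> g k) (g k) = N * (norm (g k))\<^sup>2"
    proof -
      have "of_nat N \<star> g k = real N *\<^sub>R g k" by (simp add: scaleR_cscale)
      then show ?thesis by (simp only: inner_scaleR_left power2_norm_eq_inner)
    qed
    then show "inner ((if j = k then of_nat N else 0) \<star> g j) (g k) = (if j
        = k then N * (norm (g k))\<^sup>2 else 0)"
      by simp
  qed
  finally show ?thesis by (simp add: sum_distrib_left)
qed

lemma parseval2:
  fixes g :: "nat \<Rightarrow> nat \<Rightarrow> 'a::cinner_space"
  assumes z: "prim_root N z"
  shows "(\<Sum>p<N. \<Sum>q<N. (norm (\<Sum>k<N. \<Sum>l<N. z ^ (p * k + q * l) \<star> g k l))\<^sup>2)
    = (real N)\<^sup>2 * (\<Sum>k<N. \<Sum>l<N. (norm (g k l))\<^sup>2)"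
proof -
  have "(\<Sum>p<N. \<Sum>q<N. (norm (\<Sum>k<N. \<Sum>l<N. z ^ (p * k + q * l) \<star> g k l))\<^sup>2)
     = (\<Sum>q<N. \<Sum>p<N. (norm (\<Sum>k<N. z ^ (p * k) \<star> (\<Sum>l<N. z ^ (q * l) \<star> g k l)))\<^sup>2)"
    by (subst sum.swap) (simp add: cscale_sum_right cscale_cscale power_add)
  also have "\<dots> = (\<Sum>q<N. N * (\<Sum>k<N. (norm (\<Sum>l<N. z ^ (q * l) \<star> g k l))\<^sup>2))"
    by (simp only: parseval[OF z])
  also have "\<dots> = N * (\<Sum>k<N. \<Sum>q<N. (norm (\<Sum>l<N. z ^ (q * l) \<star> g k l))\<^sup>2)"
    by (subst sum.swap) (simp add: sum_distrib_left)
  also have "\<dots> = N * (\<Sum>k<N. N * (\<Sum>l<N. (norm (g k l))\<^sup>2))"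
    by (simp only: parseval[OF z])
  finally show ?thesis by (simp add: sum_distrib_left power2_eq_square mult.assoc)
qed

text \<open>The unitary normalization would be \<open>1 / N\<close>. With
  \<open>1 / N\<^sup>2\<close> the squared norm of the transform is the mean of the squared norms of
  the \<open>g k l\<close>, so a square array of vectors of equal norm yields an element of that
  same norm.\<close>

definition dft2 :: "nat \<Rightarrow> complex \<Rightarrow> (nat \<Rightarrow> nat \<Rightarrow> 'a::cinner_space) \<Rightarrow> (nat \<times> nat) \<Rightarrow>\<^sub>0 'a" where
  "dft2 N z g = Abs_poly_mapping (\<lambda>(p, q). if p < N \<and> q < N
     then of_real (1 / (real N)\<^sup>2) \<star> (\<Sum>k<N. \<Sum>l<N. z ^ (p * k + q * l) \<star> g k l) else 0)"

lemma lookup_dft2: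
  "lookup (dft2 N z g) (p, q) = (if p < N \<and> q < N
     then of_real (1 / (real N)\<^sup>2) \<star> (\<Sum>k<N. \<Sum>l<N. z ^ (p * k + q * l) \<star> g k l) else 0)"
proof -
  have "finite {x. (case x of (p, q) \<Rightarrow> if p < N \<and> q < N
     then of_real (1 / (real N)\<^sup>2) \<star> (\<Sum>k<N. \<Sum>l<N. z ^ (p * k + q * l) \<star> g k l) else 0) \<noteq> 0}"
  proof (rule finite_subset)
    show "{x. (case x of (p, q) \<Rightarrow> if p < N \<and> q < N
       then of_real (1 / (real N)\<^sup>2) \<star> (\<Sum>k<N. \<Sum>l<N. z ^ (p * k + q * l) \<star> g k l) else 0) \<noteq> 0}
       \<subseteq> {..<N} \<times> {..<N}" (is "{x. ?P x \<noteq> 0} \<subseteq> _")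
    proof
      fix x :: "nat \<times> nat" assume "x \<in> {x. ?P x \<noteq> 0}"
      then show "x \<in> {..<N} \<times> {..<N}"
        by (cases x; cases "fst x < N \<and> snd x < N") auto
    qed
  qed auto
  then show ?thesis by (simp add: dft2_def)
qed

lemma norm_dft2:
  assumes z: "prim_root N z"
  shows "(norm (dft2 N z g))\<^sup>2 = (\<Sum>k<N. \<Sum>l<N. (norm (g k l))\<^sup>2) / (real N)\<^sup>2"
proof -
  have N: "N > 0" using z by (simp add: prim_root_def)
  have "(norm (dft2 N z g))\<^sup>2 = (\<Sum>x\<in>{..<N} \<times> {..<N}. (norm (lookup (dft2 N z g) x))\<^sup>2)"
  proof (rule norm_sq_poly_mapping)
    fix x :: "nat \<times> nat" assume "x \<notin> {..<N} \<times> {..<N}"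
    then have "\<not> (fst x < N \<and> snd x < N)" by (cases x) auto
    then show "lookup (dft2 N z g) x = 0"
      using lookup_dft2[of N z g "fst x" "snd x"] by (simp only: if_False prod.collapse)
  qed simp
  also have "\<dots> = (\<Sum>p<N. \<Sum>q<N. (norm (lookup (dft2 N z g) (p, q)))\<^sup>2)"
    by (simp add: sum.cartesian_product split_def)
  also have "\<dots> = (\<Sum>p<N. \<Sum>q<N. (1 / (real N)\<^sup>2)\<^sup>2 *
      (norm (\<Sum>k<N. \<Sum>l<N. z ^ (p * k + q * l) \<star> g k l))\<^sup>2)"
    by (intro sum.cong refl) (simp add: lookup_dft2 norm_divide norm_power power_divide)
  also have "\<dots> = (1 / (real N)\<^sup>2)\<^sup>2 * ((real N)\<^sup>2 * (\<Sum>k<N. \<Sum>l<N. (norm (g k l))\<^sup>2))"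
    by (simp only: sum_distrib_left[symmetric] parseval2[OF z])
  also have "\<dots> = (\<Sum>k<N. \<Sum>l<N. (norm (g k l))\<^sup>2) / (real N)\<^sup>2"
    using N by (simp add: power2_eq_square field_simps)
  finally show ?thesis .
qed

lemma norm_dft2_le:
  assumes z: "prim_root N z" and "\<And>k l. k < N \<Longrightarrow> l < N \<Longrightarrow> norm (g k l) \<le> c" and "c \<ge> 0"
  shows "norm (dft2 N z g) \<le> c"
proof (rule power2_le_imp_le)
  have N: "N > 0" using z by (simp add: prim_root_def)
  have "(\<Sum>k<N. \<Sum>l<N. (norm (g k l))\<^sup>2) \<le> (\<Sum>k<N. \<Sum>l<N. c\<^sup>2)"
    by (intro sum_mono power_mono assms) auto
  also have "\<dots> = (real N)\<^sup>2 * c\<^sup>2" by (simp add: power2_eq_square)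
  finally show "(norm (dft2 N z g))\<^sup>2 \<le> c\<^sup>2"
    using N by (simp add: norm_dft2[OF z] divide_le_eq mult.commute)
qed fact

text \<open>Only one row or column of the index square contributes, a fraction \<open>1 / N\<close>
  of it, so the mean of the squared norms is at most \<open>c\<^sup>2 / N\<close>.\<close>

lemma norm_dft2_edge:
  assumes z: "prim_root N z" and h: "h = (\<lambda>k l. k) \<or> h = (\<lambda>k l. l :: nat)" and c: "c \<ge> 0"
    and g: "\<And>k l. k < N \<Longrightarrow> l < N \<Longrightarrow> norm (g k l) \<le> (if h k l = N - 1 then c else 0)"
  shows "norm (dft2 N z g) \<le> c / sqrt N"
proof (rule power2_le_imp_le)
  have N: "N > 0" using z by (simp add: prim_root_def)
  have "(\<Sum>k<N. \<Sum>l<N. (norm (g k l))\<^sup>2) \<le> (\<Sum>k<N. \<Sum>l<N. (if h k l = N - 1 then c else 0)\<^sup>2)"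
    by (intro sum_mono power_mono g) auto
  also have "\<dots> = (\<Sum>k<N. \<Sum>l<N. if h k l = N - 1 then c\<^sup>2 else 0)"
    by (intro sum.cong) auto
  also have "\<dots> = N * c\<^sup>2"
    using h N by (elim disjE) (subst sum.swap, simp_all)
  finally have "(norm (dft2 N z g))\<^sup>2 \<le> N * c\<^sup>2 / (real N)\<^sup>2"
    by (simp add: norm_dft2[OF z] divide_right_mono)
  also have "\<dots> = (c / sqrt N)\<^sup>2"
    using N by (simp add: power_divide power2_eq_square)
  finally show "(norm (dft2 N z g))\<^sup>2 \<le> (c / sqrt N)\<^sup>2" .
qed (simp add: c)

lemma dft2_diff: "dft2 N z g - dft2 N z h = dft2 N z (\<lambda>k l. g k l - h k l)"
  by (rule poly_mapping_eqI) (auto simp: lookup_dft2 sum_subtractf cscale_diff_right split_paired_all)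

lemma amp_dft2: "clin T \<Longrightarrow> amp T (dft2 N z g) = dft2 N z (\<lambda>k l. T (g k l))"
  by (rule poly_mapping_eqI) (auto simp: lookup_dft2 clin_scale clin_sum clin_zero split_paired_all)

section \<open>Cyclic shifts under the Fourier transform\<close>

lemma sum_cyclic_shift: "(\<Sum>k<N. f (Suc k mod N)) = (\<Sum>k<N. f k :: 'a::comm_monoid_add)"
proof (cases N)
  case (Suc M)
  have "(\<Sum>k<Suc M. f (Suc k mod Suc M)) = (\<Sum>k<M. f (Suc k)) + f 0"
    by simp
  also have "\<dots> = (\<Sum>k<Suc M. f k)"
    by (subst sum.lessThan_Suc_shift) (simp add: add.commute)
  finally show ?thesis by (simp add: Suc)
qed simp

lemma root_power_mod: "w ^ N = 1 \<Longrightarrow> w ^ (k mod N) = (w :: complex) ^ k"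
  by (metis mult_div_mod_eq mult_1 power_add power_mult power_one)

text \<open>Multiplication by \<open>cnj z ^ p\<close> lowers the exponent \<open>k\<close> by one,
  and \<open>z ^ N = 1\<close> closes the cycle: \<open>cnj z ^ p\<close> is the eigenvalue of the
  cyclic shift at frequency \<open>p\<close>.\<close>

lemma dft_shift:
  assumes z: "z ^ N = 1" "cmod z = 1"
  shows "cnj z ^ p \<star> (\<Sum>k<N. z ^ (p * k) \<star> h k) = (\<Sum>k<N. z ^ (p * k) \<star> (h (Suc k mod N) ::
      'a::cinner_space))"
proof -
  have "cnj z ^ p \<star> (\<Sum>k<N. z ^ (p * k) \<star> h k) = cnj z ^ p \<star> (\<Sum>k<N. z ^ (p * (Suc k mod N)) \<star> h
      (Suc k mod N))"
    using sum_cyclic_shift[of "\<lambda>k. z ^ (p * k) \<star> h k" N] by simp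
  also have "\<dots> = (\<Sum>k<N. z ^ (p * k) \<star> h (Suc k mod N))"
    unfolding cscale_sum_right cscale_cscale
  proof (intro sum.cong refl)
    fix k
    have "(z ^ p) ^ N = 1" using z by (simp flip: power_mult add: mult.commute[of p])
        (simp add: power_mult)
    then have "(z ^ p) ^ (Suc k mod N) = (z ^ p) ^ Suc k" by (rule root_power_mod)
    then have "cnj z ^ p * z ^ (p * (Suc k mod N)) = cnj z ^ p * z ^ p * z ^ (p * k)"
      by (simp add: power_mult)
    also have "cnj z ^ p * z ^ p = 1"
      by (simp add: power_mult_distrib[symmetric] cmod_one_cnj z)
    finally show "(cnj z ^ p * z ^ (p * (Suc k mod N))) \<star> h (Suc k mod N)
        = z ^ (p * k) \<star> h (Suc k mod N)"
      by simp
  qed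
  finally show ?thesis .
qed

lemma clin_lookup: "clin (\<lambda>f. lookup f k)"
  by (simp add: clin_def)

lemma clin_sum_fun: "(\<And>a. clin (T a)) \<Longrightarrow> clin (\<lambda>x. \<Sum>a\<in>A. T a x)"
  by (rule clinI) (simp_all add: clin_add clin_scale sum.distrib cscale_sum_right)

lemma clin_scaling: "clin (\<lambda>v. c \<star> v)"
  by (intro clin_cscale clin_id)

abbreviation diag :: "('k \<Rightarrow> complex) \<Rightarrow> ('k \<Rightarrow>\<^sub>0 'a::cinner_space) \<Rightarrow> 'k \<Rightarrow>\<^sub>0 'a" where
  "diag x \<equiv> blk (\<lambda>p w. x p \<star> w)"

lemma dft2_shift_fst:
  assumes z: "z ^ N = 1" "cmod z = 1"
  shows "diag (\<lambda>p. cnj z ^ fst p) (dft2 N z h) = dft2 N z (\<lambda>k l. h (Suc k mod N) l)"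
proof (rule poly_mapping_eqI)
  fix x :: "nat \<times> nat"
  obtain p q where x: "x = (p, q)" by (cases x)
  have s: "(\<Sum>k<N. \<Sum>l<N. z ^ (p * k + q * l) \<star> g k l) = (\<Sum>k<N. z ^ (p * k) \<star> (\<Sum>l<N. z ^ (q * l) \<star> g k l))"
    for g :: "nat \<Rightarrow> nat \<Rightarrow> 'a"
    by (simp add: cscale_sum_right cscale_cscale power_add)
  have "cnj z ^ p \<star> c \<star> (\<Sum>k<N. z ^ (p * k) \<star> g k) = c \<star> (\<Sum>k<N. z ^ (p * k) \<star> g (Suc k mod N))"
    for c and g :: "nat \<Rightarrow> 'a"
    unfolding dft_shift[OF z, symmetric] cscale_cscale by (simp only: mult.commute)
  then show "lookup (diag (\<lambda>p. cnj z ^ fst p) (dft2 N z h)) x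
      = lookup (dft2 N z (\<lambda>k l. h (Suc k mod N) l)) x"
    unfolding x by (simp add: clin_scaling lookup_dft2 s)
qed

lemma dft2_shift_snd:
  assumes z: "z ^ N = 1" "cmod z = 1"
  shows "diag (\<lambda>p. cnj z ^ snd p) (dft2 N z h) = dft2 N z (\<lambda>k l. h k (Suc l mod N))"
proof (rule poly_mapping_eqI)
  fix x :: "nat \<times> nat"
  obtain p q where x: "x = (p, q)" by (cases x)
  have s: "(\<Sum>k<N. \<Sum>l<N. z ^ (p * k + q * l) \<star> g k l) = (\<Sum>l<N. z ^ (q * l) \<star> (\<Sum>k<N. z ^ (p * k) \<star> g k l))"
    for g :: "nat \<Rightarrow> nat \<Rightarrow> 'a"
    by (subst sum.swap) (simp add: cscale_sum_right cscale_cscale power_add mult.commute)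
  have "cnj z ^ q \<star> c \<star> (\<Sum>k<N. z ^ (q * k) \<star> g k) = c \<star> (\<Sum>k<N. z ^ (q * k) \<star> g (Suc k mod N))"
    for c and g :: "nat \<Rightarrow> 'a"
    unfolding dft_shift[OF z, symmetric] cscale_cscale by (simp only: mult.commute)
  then show "lookup (diag (\<lambda>p. cnj z ^ snd p) (dft2 N z h)) x
      = lookup (dft2 N z (\<lambda>k l. h k (Suc l mod N))) x"
    unfolding x by (simp add: clin_scaling lookup_dft2 s)
qed

text \<open>Each of the \<open>l\<close> exchanges costs \<open>\<delta>\<close>; isometries and
  unimodular factors keep the earlier errors from growing.\<close>

lemma twisted_commute_power_right:
  assumes U: "uni S S U" and V: "uni S S V" and \<omega>: "cmod \<omega> = 1"
    and c: "\<And>x. x \<in> S \<Longrightarrow> norm (U (V x) - \<omega> \<star> V (U x)) \<le> \<delta> * norm x" and x: "x \<in> S"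
  shows "norm (U ((V ^^ l) x) - \<omega> ^ l \<star> (V ^^ l) (U x)) \<le> l * \<delta> * norm x"
proof (induction l)
  case (Suc l)
  define y where "y = (V ^^ l) x"
  have y: "y \<in> S" "norm y = norm x"
    unfolding y_def by (rule uni_mem[OF uni_funpow[OF V] x], rule uni_norm[OF uni_funpow[OF V] x])
  have m: "U y - \<omega> ^ l \<star> (V ^^ l) (U x) \<in> S"
    by (intro csub_diff[OF uni_dom[OF U]] csub_scale[OF uni_dom[OF U]] uni_mem[OF U] y
        uni_mem[OF uni_funpow[OF V]] x)
  have "U ((V ^^ Suc l) x) - \<omega> ^ Suc l \<star> (V ^^ Suc l) (U x)
      = (U (V y) - \<omega> \<star> V (U y)) + \<omega> \<star> V (U y - \<omega> ^ l \<star> (V ^^ l) (U x))"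
    by (simp add: clin_diff[OF uni_clin[OF V]] clin_scale[OF uni_clin[OF V]] cscale_diff_right
        cscale_cscale y_def)
  also have "norm \<dots> \<le> norm (U (V y) - \<omega> \<star> V (U y)) + norm (U y - \<omega> ^ l \<star> (V ^^ l) (U x))"
    using norm_triangle_ineq[of "U (V y) - \<omega> \<star> V (U y)" "\<omega> \<star> V (U y - \<omega> ^ l \<star> (V ^^ l) (U x))"]
    by (simp add: \<omega> uni_norm[OF V m])
  also have "\<dots> \<le> \<delta> * norm x + l * \<delta> * norm x"
    using c[OF y(1)] Suc.IH y by (simp add: y_def)
  finally show ?case by (simp add: algebra_simps)
qed simp

lemma twisted_commute_power_left:
  assumes U: "uni S S U" and V: "uni S S V" and \<omega>: "cmod \<omega> = 1"
    and c: "\<And>x. x \<in> S \<Longrightarrow> norm (U (V x) - \<omega> \<star> V (U x)) \<le> \<delta> * norm x" and x: "x \<in> S"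
  shows "norm ((U ^^ k) (V x) - \<omega> ^ k \<star> V ((U ^^ k) x)) \<le> k * \<delta> * norm x"
proof (induction k)
  case (Suc k)
  define y where "y = (U ^^ k) x"
  have y: "y \<in> S" "norm y = norm x"
    unfolding y_def by (rule uni_mem[OF uni_funpow[OF U] x], rule uni_norm[OF uni_funpow[OF U] x])
  have m: "(U ^^ k) (V x) - \<omega> ^ k \<star> V y \<in> S"
    by (intro csub_diff[OF uni_dom[OF U]] csub_scale[OF uni_dom[OF U]] uni_mem[OF V] y
        uni_mem[OF uni_funpow[OF U]] x)
  have "(U ^^ Suc k) (V x) - \<omega> ^ Suc k \<star> V ((U ^^ Suc k) x)
      = \<omega> ^ k \<star> (U (V y) - \<omega> \<star> V (U y)) + U ((U ^^ k) (V x) - \<omega> ^ k \<star> V y)"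
    by (simp add: clin_diff[OF uni_clin[OF U]] clin_scale[OF uni_clin[OF U]] cscale_diff_right
        cscale_cscale y_def mult.commute)
  also have "norm \<dots> \<le> norm (U (V y) - \<omega> \<star> V (U y)) + norm ((U ^^ k) (V x) - \<omega> ^ k \<star> V y)"
    using norm_triangle_ineq[of "\<omega> ^ k \<star> (U (V y) - \<omega> \<star> V (U y))" "U ((U ^^ k) (V x) - \<omega> ^ k \<star> V y)"]
    by (simp add: \<omega> norm_power uni_norm[OF U m])
  also have "\<dots> \<le> \<delta> * norm x + k * \<delta> * norm x"
    using c[OF y(1)] Suc.IH y by (simp add: y_def)
  finally show ?case by (simp add: algebra_simps)
qed simp


lemma prim_root_cis: "N \<ge> 1 \<Longrightarrow> prim_root N (cis (2 * pi / real N))"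
proof -
  assume N: "N \<ge> 1"
  have "cis (2 * pi / real N) ^ k \<noteq> 1" if "0 < k" "k < N" for k
  proof
    assume "cis (2 * pi / real N) ^ k = 1"
    then have "cis (real k * (2 * pi / real N)) = 1" by (simp add: DeMoivre)
    then have "cos (real k * (2 * pi / real N)) = 1" by (simp add: complex_eq_iff)
    then obtain i :: int where i: "real k * (2 * pi / real N) = of_int i * 2 * pi"
      by (auto simp: cos_one_2pi_int)
    then have "real k = of_int i * real N" using N by (simp add: field_simps)
    then have "int k = i * int N" by (metis of_int_mult of_int_of_nat_eq of_int_eq_iff)
    then have "int N dvd int k" by simp
    then show False using that by (auto dest: dvd_imp_le)
  qed
  moreover have "cis (2 * pi / real N) ^ N = 1" using N by (simp add: DeMoivre)
  ultimately show ?thesis using N by (simp add: prim_root_def)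
qed

section \<open>Almost commuting unitaries\<close>

text \<open>If \<open>U\<close> and \<open>V\<close> commuted and had only \<open>N\<close>-th roots
  of unity as eigenvalues, the component at \<open>(p, q)\<close> would be the projection onto the
  joint eigenspace for \<open>cnj z ^ p\<close> and \<open>cnj z ^ q\<close>. Powers of
  \<open>U\<close> stand outside and powers of \<open>V\<close> inside, so applying \<open>U\<close>
  afterwards or \<open>V\<close> beforehand just raises an exponent.\<close>

definition smear :: "('a::cinner_space \<Rightarrow> 'a) \<Rightarrow> ('a \<Rightarrow> 'a) \<Rightarrow> nat \<Rightarrow> complex \<Rightarrow> 'a \<Rightarrow> (nat \<times> nat) \<Rightarrow>\<^sub>0 'a" where
  "smear U V N z x = dft2 N z (\<lambda>k l. (U ^^ k) ((V ^^ l) x))"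

context
  fixes S :: "'a::cinner_space set" and U V and N :: nat and z :: complex and \<delta> :: real
  assumes U: "uni S S U" and V: "uni S S V" and z: "prim_root N z" and \<delta>: "\<delta> \<ge> 0"
    and comm: "\<And>x. x \<in> S \<Longrightarrow> norm (U (V x) - V (U x)) \<le> \<delta> * norm x"
begin

private abbreviation "A \<equiv> smear U V N z"

private lemma N_pos: "N > 0" and z_root: "z ^ N = 1" and z_cmod: "cmod z = 1"
  using z root_of_unity_cmod by (auto simp: prim_root_def)

private lemmas cU = uni_clin[OF U] and cV = uni_clin[OF V]
private lemmas Uk_mem = uni_mem[OF uni_funpow[OF U]] and Vk_mem = uni_mem[OF uni_funpow[OF V]]
private lemmas Uk_norm = uni_norm[OF uni_funpow[OF U]] and Vk_norm = uni_norm[OF uni_funpow[OF V]]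

lemma clin_smear: "clin A"
  unfolding smear_def
proof (rule clinI; rule poly_mapping_eqI)
  fix x y c and p :: "nat \<times> nat"
  note cl = clin_add[OF clin_funpow[OF cU]] clin_add[OF clin_funpow[OF cV]]
    clin_scale[OF clin_funpow[OF cU]] clin_scale[OF clin_funpow[OF cV]]
  show "lookup (dft2 N z (\<lambda>k l. (U ^^ k) ((V ^^ l) (x + y)))) p
    = lookup (dft2 N z (\<lambda>k l. (U ^^ k) ((V ^^ l) x)) + dft2 N z (\<lambda>k l. (U ^^ k) ((V ^^ l) y))) p"
    by (cases p) (simp add: lookup_dft2 cl cscale_add_right sum.distrib)
  show "lookup (dft2 N z (\<lambda>k l. (U ^^ k) ((V ^^ l) (c \<star> x)))) p
    = lookup (c \<star> dft2 N z (\<lambda>k l. (U ^^ k) ((V ^^ l) x))) p"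
    by (cases p) (simp add: lookup_dft2 cl cscale_sum_right cscale_cscale mult_ac)
qed

lemma smear_mem: "x \<in> S \<Longrightarrow> A x \<in> dsum UNIV S"
proof (rule dsumI)
  fix p assume "x \<in> S"
  then show "lookup (A x) p \<in> S"
    by (cases p) (auto simp: smear_def lookup_dft2 csub_zero[OF uni_dom[OF U]]
      intro!: csub_scale[OF uni_dom[OF U]] csub_sum[OF uni_dom[OF U]] Uk_mem Vk_mem)
qed simp

lemma norm_smear: "x \<in> S \<Longrightarrow> norm (A x) = norm x"
proof -
  assume x: "x \<in> S"
  have "(norm (A x))\<^sup>2 = (\<Sum>k<N. \<Sum>l<N. (norm x)\<^sup>2) / (real N)\<^sup>2"
    by (simp add: smear_def norm_dft2[OF z] Uk_norm Vk_norm Vk_mem x)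
  also have "\<dots> = (norm x)\<^sup>2"
    using N_pos by (simp add: power2_eq_square)
  finally show ?thesis by simp
qed

text \<open>The adjoint is written out: conjugate coefficients in front of the adjoints
  \<open>T' k l\<close> of \<open>U^k V^l\<close>, summed over the finitely many
  frequencies.\<close>

lemma smear_adjoint: "\<exists>A'. isoadj S (dsum UNIV S) A A'"
proof -
  have "\<exists>T'. isoadj S S (\<lambda>x. (U ^^ k) ((V ^^ l) x)) T'" for k l
    by (rule isoadj_uni[OF uni_comp[OF uni_funpow[OF V] uni_funpow[OF U]]]) (rule exI)
  then obtain T' where T': "\<And>k l. isoadj S S (\<lambda>x. (U ^^ k) ((V ^^ l) x)) (T' k l)"
    by metis
  define A' where "A' g = (\<Sum>p<N. \<Sum>q<N. \<Sum>k<N. \<Sum>l<N.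
    (of_real (1 / (real N)\<^sup>2) * cnj (z ^ (p * k + q * l))) \<star> T' k l (lookup g (p, q)))" for g
  have "isoadj S (dsum UNIV S) A A'"
  proof (rule isoadjI[OF clin_smear _ smear_mem norm_smear])
    show "clin A'"
      unfolding A'_def by (intro clin_sum_fun clin_cscale clin_comp[OF isoadj_clin(2)[OF T']
          clin_lookup])
    fix g assume g: "g \<in> dsum (UNIV :: (nat \<times> nat) set) S"
    show "A' g \<in> S"
      unfolding A'_def
      by (intro csub_sum[OF uni_dom[OF U]] csub_scale[OF uni_dom[OF U]] isoadj_mem'[OF T'
          dsum_mem[OF g]])
    fix x assume x: "x \<in> S"
    have j: "inner (c \<star> (U ^^ k) ((V ^^ l) x)) (lookup g p)
        = inner x (cnj c \<star> T' k l (lookup g p))" for c k l p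
      using isoadj_inner[OF T' x csub_scale[OF uni_dom[OF U] dsum_mem[OF g]]]
      by (simp add: inner_cscale_left clin_scale[OF isoadj_clin(2)[OF T']])
    have "inner (A x) g = (\<Sum>p\<in>{..<N} \<times> {..<N}. inner (lookup (A x) p) (lookup g p))"
    proof (rule inner_poly_mapping_eq)
      show "keys (A x) \<subseteq> {..<N} \<times> {..<N}"
      proof
        fix p assume "p \<in> keys (A x)"
        then show "p \<in> {..<N} \<times> {..<N}"
          by (cases p; cases "fst p < N \<and> snd p < N") (auto simp: in_keys_iff smear_def lookup_dft2)
      qed
    qed simp
    also have "\<dots> = (\<Sum>p<N. \<Sum>q<N. inner (lookup (A x) (p, q)) (lookup g (p, q)))"
      by (simp add: sum.cartesian_product split_def)
    also have "\<dots> = inner x (A' g)"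
      unfolding A'_def inner_sum_right
    proof (intro sum.cong refl)
      fix p q assume "p \<in> {..<N}" "q \<in> {..<N}"
      then have "inner (lookup (A x) (p, q)) (lookup g (p, q)) = (\<Sum>k<N. \<Sum>l<N.
          inner ((of_real (1 / (real N)\<^sup>2) * z ^ (p * k + q * l)) \<star> (U ^^ k) ((V ^^ l) x)) (lookup
              g (p, q)))"
        by (simp only: smear_def lookup_dft2 lessThan_iff if_True simp_thms
            cscale_sum_right cscale_cscale inner_sum_left)
      then show "inner (lookup (A x) (p, q)) (lookup g (p, q)) = (\<Sum>k<N. \<Sum>l<N. inner x
          ((of_real (1 / (real N)\<^sup>2) * cnj (z ^ (p * k + q * l))) \<star> T' k l (lookup g (p, q))))"
        unfolding j by simp
    qed
    finally show "inner (A x) g = inner x (A' g)" .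
  qed
  then show ?thesis by blast
qed

text \<open>Both terms raise the exponent of \<open>U\<close> by one and differ only at
  \<open>k = N - 1\<close>, where the cyclic shift wraps around to 0. The two vectors there have
  norm \<open>norm x\<close> each, which gives the 2.\<close>

lemma smear_fst_eigen:
  assumes x: "x \<in> S"
  shows "norm (amp U (A x) - diag (\<lambda>p. cnj z ^ fst p) (A x)) \<le> 2 / sqrt N * norm x"
proof -
  have "amp U (A x) - diag (\<lambda>p. cnj z ^ fst p) (A x)
      = dft2 N z (\<lambda>k l. (U ^^ Suc k) ((V ^^ l) x) - (U ^^ (Suc k mod N)) ((V ^^ l) x))"
    by (simp add: smear_def amp_dft2 uni_clin[OF U] dft2_shift_fst z_root z_cmod dft2_diff)
  also have "norm \<dots> \<le> 2 * norm x / sqrt N"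
  proof (rule norm_dft2_edge[OF z, of "\<lambda>k l. k"])
    fix k l assume k: "k < N"
    have n: "norm ((U ^^ j) ((V ^^ l) x)) = norm x" for j
      by (simp add: Uk_norm Vk_norm Vk_mem x)
    have le: "norm ((U ^^ Suc k) ((V ^^ l) x) - (U ^^ (Suc k mod N)) ((V ^^ l) x)) \<le> 2 * norm x"
      by (rule order_trans[OF norm_triangle_ineq4]) (simp add: n del: funpow.simps)
    show "norm ((U ^^ Suc k) ((V ^^ l) x) - (U ^^ (Suc k mod N)) ((V ^^ l) x))
        \<le> (if k = N - 1 then 2 * norm x else 0)"
    proof (cases "k = N - 1")
      case True
      show ?thesis unfolding if_P[OF True] by (rule le)
    next
      case False
      then have "Suc k mod N = Suc k" using k by simp
      then show ?thesis by simp
    qed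
  qed auto
  finally show ?thesis by simp
qed

text \<open>The same wrap-around, now for the exponent of \<open>V\<close>; being innermost, it is
  raised by applying \<open>V\<close> before \<open>A\<close>.\<close>

lemma smear_snd_eigen:
  assumes x: "x \<in> S"
  shows "norm (A (V x) - diag (\<lambda>p. cnj z ^ snd p) (A x)) \<le> 2 / sqrt N * norm x"
proof -
  have "A (V x) - diag (\<lambda>p. cnj z ^ snd p) (A x)
      = dft2 N z (\<lambda>k l. (U ^^ k) ((V ^^ Suc l) x) - (U ^^ k) ((V ^^ (Suc l mod N)) x))"
    by (simp add: smear_def dft2_shift_snd z_root z_cmod dft2_diff funpow_swap1)
  also have "norm \<dots> \<le> 2 * norm x / sqrt N"
  proof (rule norm_dft2_edge[OF z, of "\<lambda>k l. l"])
    fix k l assume l: "l < N"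
    have n: "norm ((U ^^ k) ((V ^^ j) x)) = norm x" for j
      by (simp add: Uk_norm Vk_norm Vk_mem x)
    have le: "norm ((U ^^ k) ((V ^^ Suc l) x) - (U ^^ k) ((V ^^ (Suc l mod N)) x)) \<le> 2 * norm x"
      by (rule order_trans[OF norm_triangle_ineq4]) (simp add: n del: funpow.simps)
    show "norm ((U ^^ k) ((V ^^ Suc l) x) - (U ^^ k) ((V ^^ (Suc l mod N)) x))
        \<le> (if l = N - 1 then 2 * norm x else 0)"
    proof (cases "l = N - 1")
      case True
      show ?thesis unfolding if_P[OF True] by (rule le)
    next
      case False
      then have "Suc l mod N = Suc l" using l by simp
      then show ?thesis by simp
    qed
  qed auto
  finally show ?thesis by simp
qed

text \<open>Applying \<open>U\<close> before \<open>A\<close> puts it to the right of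
  \<open>V^l\<close>; bringing it to the left passes fewer than \<open>N\<close> factors at a cost
  of \<open>\<delta>\<close> each.\<close>

lemma smear_commute_U:
  assumes x: "x \<in> S"
  shows "norm (A (U x) - amp U (A x)) \<le> N * \<delta> * norm x"
proof -
  have m: "(V ^^ l) (U x) - U ((V ^^ l) x) \<in> S" for l
    by (intro csub_diff[OF uni_dom[OF U]] uni_mem[OF U] uni_mem[OF uni_funpow[OF V]] x)
  have "A (U x) - amp U (A x) = dft2 N z (\<lambda>k l. (U ^^ k) ((V ^^ l) (U x) - U ((V ^^ l) x)))"
    unfolding smear_def amp_dft2[OF uni_clin[OF U]] dft2_diff clin_diff[OF clin_funpow[OF
        uni_clin[OF U]]]
    by (simp only: funpow_swap1)
  also have "norm \<dots> \<le> N * \<delta> * norm x"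
  proof (rule norm_dft2_le[OF z])
    fix k l :: nat assume l: "l < N"
    have "norm ((U ^^ k) ((V ^^ l) (U x) - U ((V ^^ l) x))) = norm (U ((V ^^ l) x) - (V ^^ l) (U x))"
      by (simp add: uni_norm[OF uni_funpow[OF U] m] norm_minus_commute)
    also have "\<dots> \<le> l * \<delta> * norm x"
      using twisted_commute_power_right[OF U V, of 1 \<delta> x l] comm x by simp
    also have "\<dots> \<le> N * \<delta> * norm x" using l \<delta> by (intro mult_right_mono) auto
    finally show "norm ((U ^^ k) ((V ^^ l) (U x) - U ((V ^^ l) x))) \<le> N * \<delta> * norm x" .
  qed (simp add: \<delta>)
  finally show ?thesis .
qed

lemma smear_commute_V:
  assumes x: "x \<in> S"
  shows "norm (amp V (A x) - A (V x)) \<le> N * \<delta> * norm x"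
proof -
  have "amp V (A x) - A (V x) = dft2 N z (\<lambda>k l. V ((U ^^ k) ((V ^^ l) x)) - (U ^^ k) (V ((V ^^ l) x)))"
    unfolding smear_def amp_dft2[OF uni_clin[OF V]] dft2_diff by (simp only: funpow_swap1)
  also have "norm \<dots> \<le> N * \<delta> * norm x"
  proof (rule norm_dft2_le[OF z])
    fix k l :: nat assume k: "k < N"
    have y: "(V ^^ l) x \<in> S" "norm ((V ^^ l) x) = norm x"
      by (rule uni_mem[OF uni_funpow[OF V] x], rule uni_norm[OF uni_funpow[OF V] x])
    have "norm (V ((U ^^ k) ((V ^^ l) x)) - (U ^^ k) (V ((V ^^ l) x))) \<le> k * \<delta> * norm x"
      using twisted_commute_power_left[OF U V, of 1 \<delta> "(V ^^ l) x" k] comm y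
      by (simp add: norm_minus_commute)
    also have "\<dots> \<le> N * \<delta> * norm x" using k \<delta> by (intro mult_right_mono) auto
    finally show "norm (V ((U ^^ k) ((V ^^ l) x)) - (U ^^ k) (V ((V ^^ l) x))) \<le> N * \<delta> * norm x" .
  qed (simp add: \<delta>)
  finally show ?thesis .
qed

text \<open>Points that are no approximate joint eigenvalue carry little weight, so they may be replaced
  by ones that are.\<close>

lemma diagonal_model:
  assumes \<kappa>: "\<kappa> = 2 / sqrt N + N * \<delta>" "\<kappa> < 1" and ne: "\<exists>v\<in>S. v \<noteq> 0"
  shows "\<exists>x y \<xi>. (\<forall>p :: nat \<times> nat. cmod (x p) = 1 \<and> cmod (y p) = 1 \<and> \<xi> p \<in> S \<and> norm (\<xi> p) = 1 \<and>
      norm (U (\<xi> p) - x p \<star> \<xi> p) \<le> 3 * sqrt \<kappa> \<and> norm (V (\<xi> p) - y p \<star> \<xi> p) \<le> 3 * sqrt \<kappa>) \<and>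
    (\<forall>v\<in>S. norm (A (U v) - diag x (A v)) \<le> 3 * sqrt \<kappa> * norm v \<and>
       norm (A (V v) - diag y (A v)) \<le> 3 * sqrt \<kappa> * norm v)"
proof -
  define x0 y0 where "x0 p = cnj z ^ fst p" and "y0 p = cnj z ^ snd p" for p :: "nat \<times> nat"
  have cm: "cmod (x0 p) = 1" "cmod (y0 p) = 1" for p
    by (simp_all add: x0_def y0_def norm_power z_cmod)
  have \<kappa>0: "\<kappa> > 0" using \<kappa> N_pos \<delta> by (simp add: add_pos_nonneg)
  \<comment> \<open>The threshold is set for a Chebyshev estimate. At a bad point the two squared
    defects add up to at least \<open>2 * \<kappa>\<close> times the weight of the point, whereas
    for a unit vector all squared defects together are at most \<open>2 * \<kappa>\<^sup>2\<close>.
    So bad points carry weight at most \<open>\<kappa>\<close>.\<close>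
  define good where "good p \<longleftrightarrow> (\<exists>v\<in>S. norm v = 1 \<and> norm (U v - x0 p \<star> v) \<le> sqrt (2 * \<kappa>) \<and>
    norm (V v - y0 p \<star> v) \<le> sqrt (2 * \<kappa>))" for p
  have bad: "2 * \<kappa> * (norm w)\<^sup>2 \<le> (norm (U w - x0 p \<star> w))\<^sup>2 + (norm (V w - y0 p \<star> w))\<^sup>2"
    if "\<not> good p" "w \<in> S" for p w
  proof (cases "w = 0")
    case False
    define c where "c = complex_of_real (1 / norm w)"
    have n: "norm (c \<star> v) = norm v / norm w" for v :: 'a
      using False by (simp add: c_def norm_divide)
    have "norm (c \<star> w) = 1" "c \<star> w \<in> S" using False n csub_scale[OF uni_dom[OF U] that(2)] by auto
    moreover have e: "U (c \<star> w) - d \<star> c \<star> w = c \<star> (U w - d \<star> w)" "V (c \<star> w) - d \<star> c \<star> w = c \<star> (V w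
        - d \<star> w)" for d
      by (simp_all add: clin_scale[OF uni_clin[OF U]] clin_scale[OF uni_clin[OF V]] cscale_diff_right
          cscale_cscale mult.commute)
    ultimately have "\<not> norm (U w - x0 p \<star> w) / norm w \<le> sqrt (2 * \<kappa>) \<or> \<not> norm (V w
        - y0 p \<star> w) / norm w \<le> sqrt (2 * \<kappa>)"
      using that(1) unfolding good_def by (metis n)
    then have "sqrt (2 * \<kappa>) * norm w \<le> norm (U w - x0 p \<star> w) \<or> sqrt (2 * \<kappa>) * norm w \<le> norm (V w
        - y0 p \<star> w)"
      using False by (auto simp: field_simps)
    then have "(sqrt (2 * \<kappa>) * norm w)\<^sup>2 \<le> (norm (U w - x0 p \<star> w))\<^sup>2 \<or> (sqrt (2 * \<kappa>) * norm w)\<^sup>2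
        \<le> (norm (V w - y0 p \<star> w))\<^sup>2"
      using \<kappa>0 by (auto intro!: power_mono)
    moreover have "(sqrt (2 * \<kappa>) * norm w)\<^sup>2 = 2 * \<kappa> * (norm w)\<^sup>2"
      using \<kappa>0 by (simp add: power_mult_distrib)
    ultimately show ?thesis
      using zero_le_power2[of "norm (U w - x0 p \<star> w)"] zero_le_power2[of "norm (V w - y0 p \<star> w)"]
          by linarith
  qed simp
  let ?P = "{..<N} \<times> {..<N}"
  have A0: "lookup (A v) p = 0" if "p \<notin> ?P" for v p
  proof -
    have "\<not> (fst p < N \<and> snd p < N)" using that by (cases p) auto
    then show ?thesis unfolding smear_def
      using lookup_dft2[of N z _ "fst p" "snd p"] by (simp only: if_False prod.collapse)
  qed
  have Am: "lookup (A v) p \<in> S" if "v \<in> S" for v p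
    by (rule dsum_mem[OF smear_mem[OF that]])
  have E1: "norm (amp U (A v) - diag x0 (A v)) \<le> 2 / sqrt N * norm v"
    and E3: "norm (A (V v) - diag y0 (A v)) \<le> 2 / sqrt N * norm v" if "v \<in> S" for v
    using smear_fst_eigen[OF that] smear_snd_eigen[OF that] by (simp_all add: x0_def y0_def)
  have N\<delta>: "0 \<le> real N * \<delta> * norm v" for v :: 'a
    using \<delta> by simp
  \<comment> \<open>\<open>F1\<close> and \<open>F2\<close> make the components of
    \<open>A v\<close> approximate eigenvectors, \<open>F3\<close> and \<open>F4\<close> make
    \<open>A\<close> an approximate intertwiner. \<open>F1\<close> and \<open>F4\<close> come from
    the wrap-around alone; the other two also pay for reordering.\<close>
  have F1: "norm (amp U (A v) - diag x0 (A v)) \<le> \<kappa> * norm v" if "v \<in> S" for v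
    using E1[OF that] N\<delta>[of v] by (simp add: \<kappa> distrib_right)
  have F2: "norm (amp V (A v) - diag y0 (A v)) \<le> \<kappa> * norm v" if "v \<in> S" for v
    using E3[OF that] smear_commute_V[OF that]
      norm_triangle_ineq[of "amp V (A v) - A (V v)" "A (V v) - diag y0 (A v)"]
    by (simp add: \<kappa> distrib_right)
  have F3: "norm (A (U v) - diag x0 (A v)) \<le> \<kappa> * norm v" if "v \<in> S" for v
    using E1[OF that] smear_commute_U[OF that]
      norm_triangle_ineq[of "A (U v) - amp U (A v)" "amp U (A v) - diag x0 (A v)"]
    by (simp add: \<kappa> distrib_right)
  have F4: "norm (A (V v) - diag y0 (A v)) \<le> \<kappa> * norm v" if "v \<in> S" for v
    using E3[OF that] N\<delta>[of v] by (simp add: \<kappa> distrib_right)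
  have sq: "(norm (amp T (A v) - diag d (A v)))\<^sup>2 = (\<Sum>p\<in>?P. (norm (T (lookup (A v) p)
      - d p \<star> lookup (A v) p))\<^sup>2)"
    if "clin T" for T d v
  proof -
    have "lookup (amp T (A v) - diag d (A v)) p = T (lookup (A v) p) - d p \<star> lookup (A v) p" for p
      by (simp add: that clin_scaling)
    then show ?thesis
      by (subst norm_sq_poly_mapping[of ?P]) (auto simp: A0 clin_zero that)
  qed
  have badsum: "(\<Sum>p\<in>{p\<in>?P. \<not> good p}. (norm (lookup (A v) p))\<^sup>2) \<le> \<kappa> * (norm v)\<^sup>2" if v: "v \<in> S" for v
  proof -
    have "2 * \<kappa> * (\<Sum>p\<in>{p\<in>?P. \<not> good p}. (norm (lookup (A v) p))\<^sup>2)
       \<le> (\<Sum>p\<in>{p\<in>?P. \<not> good p}. (norm (U (lookup (A v) p) - x0 p \<star> lookup (A v) p))\<^sup>2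
            + (norm (V (lookup (A v) p) - y0 p \<star> lookup (A v) p))\<^sup>2)"
      unfolding sum_distrib_left by (intro sum_mono bad Am v) auto
    also have "\<dots> \<le> (\<Sum>p\<in>?P. (norm (U (lookup (A v) p) - x0 p \<star> lookup (A v) p))\<^sup>2
            + (norm (V (lookup (A v) p) - y0 p \<star> lookup (A v) p))\<^sup>2)"
      by (intro sum_mono2) auto
    also have "\<dots> = (norm (amp U (A v) - diag x0 (A v)))\<^sup>2 + (norm (amp V (A v) - diag y0 (A v)))\<^sup>2"
      by (simp only: sum.distrib sq uni_clin[OF U] uni_clin[OF V])
    also have "\<dots> \<le> (\<kappa> * norm v)\<^sup>2 + (\<kappa> * norm v)\<^sup>2"
      by (intro add_mono power_mono F1 F2 v) auto
    also have "\<dots> = 2 * \<kappa> * (\<kappa> * (norm v)\<^sup>2)" by (simp add: power2_eq_square)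
    finally show ?thesis using \<kappa>0 by simp
  qed
  have An: "(norm v)\<^sup>2 = (\<Sum>p\<in>?P. (norm (lookup (A v) p))\<^sup>2)" if "v \<in> S" for v
    using norm_sq_poly_mapping[of ?P "A v"] A0 norm_smear[OF that] by simp
  \<comment> \<open>If all points were bad, the squared norm of a nonzero vector would be at most
    \<open>\<kappa> < 1\<close> times itself.\<close>
  have "\<exists>p\<in>?P. good p"
  proof (rule ccontr)
    assume "\<not> (\<exists>p\<in>?P. good p)"
    then have "{p\<in>?P. \<not> good p} = ?P" by auto
    moreover obtain v where "v \<in> S" "v \<noteq> 0" using ne by blast
    ultimately have "(norm v)\<^sup>2 \<le> \<kappa> * (norm v)\<^sup>2" using badsum[of v] An[of v] by simp
    then show False using \<kappa> \<open>v \<noteq> 0\<close> by simp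
  qed
  then obtain g0 where g0: "good g0" by blast
  \<comment> \<open>All bad points are sent to one fixed good point, so every \<open>r p\<close>
    comes with an approximate eigenvector.\<close>
  define r where "r p = (if good p then p else g0)" for p
  have r: "good (r p)" for p using g0 by (simp add: r_def)
  then have "\<forall>p. \<exists>v. v \<in> S \<and> norm v = 1 \<and> norm (U v - x0 (r p) \<star> v) \<le> sqrt (2 * \<kappa>) \<and>
    norm (V v - y0 (r p) \<star> v) \<le> sqrt (2 * \<kappa>)"
    unfolding good_def by blast
  then obtain \<xi> where \<xi>: "\<And>p. \<xi> p \<in> S \<and> norm (\<xi> p) = 1 \<and> norm (U (\<xi> p) - x0 (r p) \<star> \<xi> p) \<le> sqrt (2 * \<kappa>) \<and>
    norm (V (\<xi> p) - y0 (r p) \<star> \<xi> p) \<le> sqrt (2 * \<kappa>)"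
    by metis
  have s2: "sqrt (2 * \<kappa>) \<le> 3 * sqrt \<kappa>"
    by (rule real_le_lsqrt) (use \<kappa>0 in \<open>auto simp: power_mult_distrib\<close>)
  \<comment> \<open>As \<open>\<kappa> < 1\<close>, the direct error \<open>\<kappa>\<close> is
    absorbed into \<open>sqrt \<kappa>\<close>; together with the cost of redirecting this is the
    constant 3.\<close>
  have k3: "\<kappa> + 2 * sqrt \<kappa> \<le> 3 * sqrt \<kappa>"
  proof -
    have "sqrt \<kappa> * sqrt \<kappa> \<le> sqrt \<kappa> * 1"
      using \<kappa> \<kappa>0 by (intro mult_left_mono) auto
    then show ?thesis using \<kappa>0 by simp
  qed
  \<comment> \<open>Only bad points move, each by at most 2 since the values are unimodular, and
    their total weight is at most \<open>\<kappa>\<close>.\<close>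
  have redirect: "norm (diag d (A v) - diag (\<lambda>p. d (r p)) (A v)) \<le> 2 * sqrt \<kappa> * norm v"
    if "\<And>p. cmod (d p) = 1" "v \<in> S" for d v
  proof (rule power2_le_imp_le)
    have "(norm (diag d (A v) - diag (\<lambda>p. d (r p)) (A v)))\<^sup>2
       = (\<Sum>p\<in>?P. (norm ((d p - d (r p)) \<star> lookup (A v) p))\<^sup>2)"
      by (subst norm_sq_poly_mapping[of ?P]) (auto simp: A0 clin_scaling cscale_diff_left simp
          del: norm_cscale)
    also have "\<dots> = (\<Sum>p\<in>{p\<in>?P. \<not> good p}. (norm ((d p - d (r p)) \<star> lookup (A v) p))\<^sup>2)"
      by (rule sum.mono_neutral_right) (auto simp: r_def)
    also have "\<dots> \<le> (\<Sum>p\<in>{p\<in>?P. \<not> good p}. (2 * norm (lookup (A v) p))\<^sup>2)"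
    proof (intro sum_mono power_mono)
      fix p
      have "cmod (d p - d (r p)) \<le> 2" using norm_triangle_ineq4[of "d p" "d (r p)"] that(1) by simp
      then show "norm ((d p - d (r p)) \<star> lookup (A v) p) \<le> 2 * norm (lookup (A v) p)"
        by (simp add: mult_right_mono)
    qed auto
    also have "\<dots> = 4 * (\<Sum>p\<in>{p\<in>?P. \<not> good p}. (norm (lookup (A v) p))\<^sup>2)"
      by (simp add: power_mult_distrib sum_distrib_left)
    also have "\<dots> \<le> 4 * (\<kappa> * (norm v)\<^sup>2)" using badsum[OF that(2)] by simp
    also have "\<dots> = (2 * sqrt \<kappa> * norm v)\<^sup>2" using \<kappa>0 by (simp add: power_mult_distrib)
    finally show "(norm (diag d (A v) - diag (\<lambda>p. d (r p)) (A v)))\<^sup>2 \<le> (2 * sqrt \<kappa> * norm v)\<^sup>2" .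
  qed (use \<kappa>0 in simp)
  have fin: "norm (W - diag (\<lambda>p. d (r p)) (A v)) \<le> 3 * sqrt \<kappa> * norm v"
    if "norm (W - diag d (A v)) \<le> \<kappa> * norm v" "\<And>p. cmod (d p) = 1" "v \<in> S" for W d v
  proof -
    have "norm (W - diag (\<lambda>p. d (r p)) (A v)) \<le> \<kappa> * norm v + 2 * sqrt \<kappa> * norm v"
      using that(1) redirect[of d v, OF that(2,3)] norm_triangle_ineq[of "W - diag d (A v)"
          "diag d (A v) - diag (\<lambda>p. d (r p)) (A v)"] by simp
    also have "\<dots> \<le> 3 * sqrt \<kappa> * norm v"
      using mult_right_mono[OF k3, of "norm v"] by (simp add: distrib_right)
    finally show ?thesis .
  qed
  show ?thesis
    by (intro exI[of _ "\<lambda>p. x0 (r p)"] exI[of _ "\<lambda>p. y0 (r p)"] exI[of _ \<xi>] conjI allI ballI)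
      (use \<xi> s2 cm F3 F4 fin in \<open>auto intro: order_trans\<close>)
qed

end

text \<open>On the scalars this is \<open>hcoef x y = x * cnj y\<close>.\<close>

definition hcoef :: "'a::cinner_space \<Rightarrow> 'a \<Rightarrow> complex" where
  "hcoef g \<xi> = Complex (inner g \<xi>) (inner g (\<i> \<star> \<xi>))"

section \<open>From the diagonal model back into copies of the space\<close>

lemma cscale_split: "c \<star> x = Re c *\<^sub>R x + Im c *\<^sub>R \<i> \<star> x"
  by (metis complex_eq cscale_add_left cscale_cscale mult.commute scaleR_cscale)

text \<open>This makes \<open>hcoef\<close>, in its first argument, the adjoint of \<open>c\<close>
  -> \<open>c \<star> \<xi>\<close>: a complex coefficient is read off from the real inner products
  with \<open>\<xi>\<close> and \<open>\<i> \<star> \<xi>\<close>.\<close>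

lemma inner_cscale_hcoef: "inner (c \<star> \<xi>) g = inner c (hcoef g \<xi>)"
  by (subst cscale_split) (simp add: hcoef_def inner_add_left inner_complex_def inner_commute[of g])

lemma clin_hcoef: "clin (\<lambda>g. hcoef g \<xi>)"
proof (rule clinI)
  show "hcoef (x + y) \<xi> = hcoef x \<xi> + hcoef y \<xi>" for x y
    by (simp add: hcoef_def inner_add_left complex_eq_iff)
  have i: "inner (\<i> \<star> g) \<xi> = - inner g (\<i> \<star> \<xi>)" "inner (\<i> \<star> g) (\<i> \<star> \<xi>) = inner g \<xi>" for g
    using inner_cscale_cscale[of "\<i>" g \<xi>] by (simp_all add: inner_cscale_left[of _ g \<xi>]
        cscale_minus_left)
  show "hcoef (c \<star> g) \<xi> = c \<star> hcoef g \<xi>" for c g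
    by (subst cscale_split[of c g])
      (simp add: hcoef_def inner_add_left i complex_eq_iff cscale_complex_def)
qed

lemma clin_cscale_left: "clin (\<lambda>c. c \<star> \<xi>)"
  by (rule clinI) (simp_all add: cscale_add_left cscale_cscale cscale_complex_def)

text \<open>Each coordinate is sent to a line in its own summand, so the images are orthogonal by
  their index and have the right norm because the \<open>\<xi> k\<close> are unit vectors.\<close>

lemma isoadj_vectors:
  assumes S: "csub S" and \<xi>: "\<And>k. k \<in> K \<Longrightarrow> \<xi> k \<in> S \<and> norm (\<xi> k) = 1"
  shows "isoadj (dsum K UNIV) (dsum K S) (blk (\<lambda>k c. c \<star> \<xi> k)) (blk (\<lambda>k g. hcoef g (\<xi> k)))"
proof (rule isoadjI)
  note cl = clin_cscale_left clin_hcoef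
  fix f :: "'b \<Rightarrow>\<^sub>0 complex" assume f: "f \<in> dsum K UNIV"
  show "blk (\<lambda>k c. c \<star> \<xi> k) f \<in> dsum K S"
  proof (rule dsumI)
    fix k
    show "lookup (blk (\<lambda>k c. c \<star> \<xi> k) f) k \<in> S"
      using \<xi>[of k] dsum_zero[OF f, of k] by (cases "k \<in> K") (simp_all add: cl csub_scale S csub_zero)
    show "lookup (blk (\<lambda>k c. c \<star> \<xi> k) f) k = 0" if "k \<notin> K"
      by (simp add: cl dsum_zero[OF f that])
  qed
  show "norm (blk (\<lambda>k c. c \<star> \<xi> k) f) = norm f"
  proof (rule norm_eq_lookup)
    fix k
    show "norm (lookup (blk (\<lambda>k c. c \<star> \<xi> k) f) k) = norm (lookup f k)"
      using \<xi>[of k] dsum_zero[OF f, of k] by (cases "k \<in> K") (simp_all add: cl)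
  qed
  fix g assume g: "g \<in> dsum K S"
  have "inner (blk (\<lambda>k c. c \<star> \<xi> k) f) g = (\<Sum>k\<in>keys f. inner (lookup (blk (\<lambda>k c. c \<star> \<xi> k) f) k)
      (lookup g k))"
    by (rule inner_poly_mapping_eq) (auto simp: in_keys_iff cl)
  then show "inner (blk (\<lambda>k c. c \<star> \<xi> k) f) g = inner f (blk (\<lambda>k g. hcoef g (\<xi> k)) g)"
    by (simp add: inner_poly_mapping_def cl inner_cscale_hcoef)
next
  fix g assume g: "g \<in> dsum K S"
  show "blk (\<lambda>k g. hcoef g (\<xi> k)) g \<in> dsum K UNIV"
    by (rule dsumI) (simp_all add: clin_hcoef dsum_zero[OF g] clin_zero[OF clin_hcoef])
qed (simp_all add: clin_blk clin_hcoef clin_cscale_left)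

text \<open>The multiplicity space \<open>S\<close> of the diagonal operators is replaced by its coordinates, and each
  coordinate of the \<open>p\<close>-th summand is spent on a separate copy of the vector \<open>\<xi> p\<close>.\<close>

lemma diagonal_embeds:
  fixes \<xi> :: "'p \<Rightarrow> 'a::cinner_space" and \<Phi> :: "'a \<Rightarrow> 'i \<Rightarrow>\<^sub>0 complex"
  assumes U: "uni S S U" and V: "uni S S V" and \<Phi>: "uni S (dsum I UNIV) \<Phi>"
    and \<xi>: "\<And>p. \<xi> p \<in> S \<and> norm (\<xi> p) = 1"
    and err: "\<And>p. norm (U (\<xi> p) - x p \<star> \<xi> p) \<le> \<eta>" "\<And>p. norm (V (\<xi> p) - y p \<star> \<xi> p) \<le> \<eta>"
  shows "\<exists>B B'. isoadj (dsum UNIV S) (dsum ((UNIV :: 'p set) \<times> I) S) B B' \<and>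
    (\<forall>f\<in>dsum UNIV S. norm (B (diag x f) - amp U (B f)) \<le> \<eta> * norm f \<and>
       norm (B (diag y f) - amp V (B f)) \<le> \<eta> * norm f)"
proof -
  let ?K = "UNIV \<times> I :: ('p \<times> 'i) set"
  \<comment> \<open>Passage to the coordinates given by \<open>\<Phi>\<close>. By linearity of
    \<open>\<Phi>\<close>, \<open>diag d\<close> becomes multiplication by \<open>d p\<close> at
    \<open>(p, i)\<close>, so the error at \<open>(p, i)\<close> is a scalar times the eigenvector
    defect of \<open>\<xi> p\<close>.\<close>
  define \<Psi> where "\<Psi> f = uncur (amp \<Phi> f)" for f :: "'p \<Rightarrow>\<^sub>0 'a"
  have \<Psi>: "uni (dsum UNIV S) (dsum ?K UNIV) \<Psi>"
    unfolding \<Psi>_def by (rule uni_comp[OF uni_amp[OF \<Phi>] uni_uncur[OF csub_UNIV]])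
  obtain \<Psi>' where \<Psi>': "isoadj (dsum UNIV S) (dsum ?K UNIV) \<Psi> \<Psi>'"
    using isoadj_uni[OF \<Psi>] by blast
  let ?G = "blk (\<lambda>k c. c \<star> \<xi> (fst k)) :: ('p \<times> 'i \<Rightarrow>\<^sub>0 complex) \<Rightarrow> _"
  have G: "isoadj (dsum ?K UNIV) (dsum ?K S) ?G (blk (\<lambda>k g. hcoef g (\<xi> (fst k))))"
    by (rule isoadj_vectors[OF uni_dom[OF U]]) (simp add: \<xi>)
  have \<eta>: "\<eta> \<ge> 0" using err(1) norm_ge_zero order_trans by blast
  have "norm (?G (\<Psi> (diag d f)) - amp T (?G (\<Psi> f))) \<le> \<eta> * norm f"
    if T: "clin T" and e: "\<And>p. norm (T (\<xi> p) - d p \<star> \<xi> p) \<le> \<eta>" and f: "f \<in> dsum UNIV S" for T d f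
  proof -
    have l: "lookup (\<Psi> f) (p, i) = lookup (\<Phi> (lookup f p)) i" for f p i
      by (simp add: \<Psi>_def uni_clin[OF \<Phi>])
    have "norm (?G (\<Psi> (diag d f)) - amp T (?G (\<Psi> f))) \<le> \<eta> * norm (\<Psi> f)"
    proof (rule norm_le_lookup)
      fix k :: "'p \<times> 'i"
      obtain p i where k: "k = (p, i)" by (cases k)
      define c where "c = lookup (\<Phi> (lookup f p)) i"
      have "lookup (?G (\<Psi> (diag d f)) - amp T (?G (\<Psi> f))) k = c \<star> (d p \<star> \<xi> p - T (\<xi> p))"
        by (simp add: k l clin_cscale_left T clin_scaling clin_scale[OF uni_clin[OF \<Phi>]] clin_scale[OF T]
            c_def cscale_diff_right cscale_cscale cscale_complex_def mult.commute)
      also have "norm \<dots> \<le> \<eta> * cmod c"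
        using mult_left_mono[OF e[of p], of "cmod c"] by (simp add: norm_minus_commute mult.commute)
      finally show "norm (lookup (?G (\<Psi> (diag d f)) - amp T (?G (\<Psi> f))) k)
          \<le> \<eta> * norm (lookup (\<Psi> f) k)"
        by (simp add: k l c_def)
    qed (rule \<eta>)
    then show ?thesis using uni_norm[OF \<Psi> f] by simp
  qed
  then have fin: "\<forall>f\<in>dsum UNIV S. norm (?G (\<Psi> (diag x f)) - amp U (?G (\<Psi> f))) \<le> \<eta> * norm f \<and>
       norm (?G (\<Psi> (diag y f)) - amp V (?G (\<Psi> f))) \<le> \<eta> * norm f"
    using uni_clin[OF U] uni_clin[OF V] err by blast
  show ?thesis
    by (rule exI[of _ "\<lambda>f. ?G (\<Psi> f)"], rule exI[of _ "\<lambda>g. \<Psi>' (blk (\<lambda>k g. hcoef g (\<xi> (fst k))) g)"])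
      (intro conjI isoadj_comp[OF \<Psi>' G] fin)
qed

lemma uncur_amp_amp: "clin T \<Longrightarrow> uncur (amp (amp T) f) = amp T (uncur f)"
  by (rule poly_mapping_eqI) (simp add: split_paired_all clin_blk)

lemma rix_amp: "inj_on \<sigma> L \<Longrightarrow> clin T \<Longrightarrow> rix L \<sigma> (amp T f) = amp T (rix L \<sigma> f)"
  by (rule poly_mapping_eqI) (simp add: lookup_rix clin_zero)

text \<open>The product of the naturals with \<open>K\<close> is countably infinite whether
  \<open>K\<close> is finite or not, and reindexing along a bijection with the naturals commutes
  with ampliations.\<close>

lemma flatten:
  fixes S :: "'a::cinner_space set" and K :: "'k set"
  assumes S: "csub S" and K: "countable K" "K \<noteq> {}"
  shows "\<exists>Q. uni (copies (dsum K S)) (copies S) Q \<and>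
    (\<forall>T f. clin T \<longrightarrow> Q (amp (amp T) f) = amp T (Q f))"
proof -
  let ?L = "(UNIV :: nat set) \<times> K"
  have "countable ?L" "infinite ?L" using K by (auto simp: finite_cartesian_product_iff)
  then have b: "bij_betw (from_nat_into ?L) UNIV ?L"
    by (rule bij_betw_from_nat_into)
  have "uni (copies (dsum K S)) (dsum UNIV S) (\<lambda>f. rix UNIV (from_nat_into ?L) (uncur f))"
    by (rule uni_comp[OF uni_uncur[OF S] uni_rix[OF b S]])
  then show ?thesis
    by (intro exI[of _ "\<lambda>f. rix UNIV (from_nat_into ?L) (uncur f)"] conjI)
      (auto simp: uncur_amp_amp rix_amp bij_betw_imp_inj_on[OF b])
qed

lemma near_flatten:
  fixes S :: "'a::cinner_space set" and K :: "'k set"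
  assumes U: "uni S S U" and V: "uni S S V" and K: "countable K" "K \<noteq> {}"
  shows "near (copies (dsum K S)) (amp (amp U)) (amp (amp V))
    (copies S) (amp U) (amp V) 0"
proof -
  obtain Q where "uni (copies (dsum K S)) (copies S) Q"
    "\<And>T f. clin T \<Longrightarrow> Q (amp (amp T) f) = amp T (Q f)"
    using flatten[OF uni_dom[OF U] K] by blast
  then show ?thesis using uni_clin[OF U] uni_clin[OF V] by (intro near_exactI) auto
qed

lemma uni_diag: "csub S \<Longrightarrow> (\<And>p. cmod (x p) = 1) \<Longrightarrow> uni (dsum K S) (dsum K S) (diag x)"
  by (rule uni_blk) (simp_all add: clin_scaling uni_cscale uni_id)

text \<open>Both halves of the swindle meet here: \<open>smear\<close> embeds the pair into the
  diagonal model, and the approximate eigenvectors embed the model into copies of \<open>S\<close>,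
  for which \<open>\<Phi>\<close> provides an orthonormal coordinate system. Either embedding has
  defect \<open>3 * sqrt \<kappa>\<close>, and \<open>near_amp_mutual\<close> contributes the factor
  8.\<close>

theorem near_diagonal:
  fixes S :: "'a::cinner_space set" and \<Phi> :: "'a \<Rightarrow> 'i \<Rightarrow>\<^sub>0 complex" and N :: nat and \<delta> :: real
  assumes U: "uni S S U" and V: "uni S S V"
    and comm: "\<And>x. x \<in> S \<Longrightarrow> norm (U (V x) - V (U x)) \<le> \<delta> * norm x" and \<delta>: "\<delta> \<ge> 0"
    and \<Phi>: "uni S (dsum I UNIV) \<Phi>" and I: "countable I" and ne: "\<exists>v\<in>S. v \<noteq> 0"
    and N: "N \<ge> 1" and \<kappa>: "\<kappa> = 2 / sqrt N + N * \<delta>" "\<kappa> < 1"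
  shows "\<exists>x y :: nat \<times> nat \<Rightarrow> complex. (\<forall>p. cmod (x p) = 1 \<and> cmod (y p) = 1) \<and>
    near (copies S) (amp U) (amp V) (copies (dsum UNIV S))
      (amp (diag x)) (amp (diag y)) (24 * sqrt \<kappa>)"
proof -
  let ?K = "(UNIV :: (nat \<times> nat) set) \<times> I" and ?\<epsilon> = "3 * sqrt \<kappa>"
  note z = prim_root_cis[OF N]
  define A where "A = smear U V N (cis (2 * pi / real N))"
  obtain x y \<xi> where xy: "\<And>p :: nat \<times> nat. cmod (x p) = 1" "\<And>p. cmod (y p) = 1"
    and \<xi>: "\<And>p. \<xi> p \<in> S \<and> norm (\<xi> p) = 1"
      "\<And>p. norm (U (\<xi> p) - x p \<star> \<xi> p) \<le> ?\<epsilon>" "\<And>p. norm (V (\<xi> p) - y p \<star> \<xi> p) \<le> ?\<epsilon>"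
    and A: "\<And>v. v \<in> S \<Longrightarrow> norm (A (U v) - diag x (A v)) \<le> ?\<epsilon> * norm v"
      "\<And>v. v \<in> S \<Longrightarrow> norm (A (V v) - diag y (A v)) \<le> ?\<epsilon> * norm v"
    using diagonal_model[OF U V z \<delta> comm \<kappa> ne] unfolding A_def by metis
  obtain A' where A': "isoadj S (dsum UNIV S) A A'"
    using smear_adjoint[OF U V z \<delta> comm] unfolding A_def by blast
  let ?D = "diag x" and ?E = "diag y"
  have \<epsilon>: "?\<epsilon> \<ge> 0" using \<kappa>(1) \<delta> by simp
  have D: "uni (dsum UNIV S) (dsum UNIV S) ?D" and E: "uni (dsum UNIV S) (dsum UNIV S) ?E"
    by (simp_all add: uni_diag uni_dom[OF U] xy)
  note cl = uni_clin[OF U] uni_clin[OF V] uni_clin[OF D] uni_clin[OF E]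
  obtain B B' where B: "isoadj (dsum UNIV S) (dsum ?K S) B B'"
    and Be: "\<And>f. f \<in> dsum UNIV S \<Longrightarrow> norm (B (?D f) - amp U (B f)) \<le> ?\<epsilon> * norm f"
      "\<And>f. f \<in> dsum UNIV S \<Longrightarrow> norm (B (?E f) - amp V (B f)) \<le> ?\<epsilon> * norm f"
    using diagonal_embeds[where x = x and y = y, OF U V \<Phi> \<xi>] by blast
  \<comment> \<open>A nonzero space has no isometry into the zero space. The index set must be
    nonempty for \<open>flatten\<close>.\<close>
  have "I \<noteq> {}"
  proof
    assume "I = {}"
    obtain v where v: "v \<in> S" "v \<noteq> 0" using ne by blast
    have "\<Phi> v = 0"
      using dsum_zero[OF uni_mem[OF \<Phi> v(1)]] \<open>I = {}\<close> by (intro poly_mapping_eqI) simp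
    then show False using uni_norm[OF \<Phi> v(1)] v(2) by simp
  qed
  then have K: "countable ?K" "?K \<noteq> {}"
    using I by auto
  obtain Q where Q: "uni (copies (dsum ?K S)) (copies S) Q"
    "\<And>T f. clin T \<Longrightarrow> Q (amp (amp T) f) = amp T (Q f)"
    using flatten[OF uni_dom[OF U] K] by blast
  obtain Q' where Q': "isoadj (copies (dsum ?K S)) (copies S) Q Q'"
    using isoadj_uni[OF Q(1)] by blast
  have amp_err: "norm (amp C (amp X f) - amp Y (amp C f)) \<le> ?\<epsilon> * norm f"
    if "f \<in> copies P" "clin C" "clin X" "clin Y" "\<And>v. v \<in> P \<Longrightarrow> norm (C (X v) - Y (C v)) \<le> ?\<epsilon> * norm v"
    for C :: "'b::cinner_space \<Rightarrow> 'c::cinner_space" and X Y f P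
    by (rule norm_le_lookup[OF _ \<epsilon>]) (simp add: that dsum_mem[OF that(1)])
  have "near (copies S) (amp U) (amp V) (copies (dsum UNIV S)) (amp ?D) (amp ?E) (8 * ?\<epsilon>)"
  proof (rule near_amp_mutual[OF U V D E isoadj_amp[OF A'] isoadj_comp[OF isoadj_amp[OF B] Q']])
    fix f assume f: "f \<in> copies S"
    show "norm (amp A (amp U f) - amp ?D (amp A f)) \<le> ?\<epsilon> * norm f"
      "norm (amp A (amp V f) - amp ?E (amp A f)) \<le> ?\<epsilon> * norm f"
      by (rule amp_err[OF f isoadj_clin(1)[OF A']]; simp add: cl A)+
  next
    fix f assume f: "f \<in> copies (dsum (UNIV :: (nat \<times> nat) set) S)"
    have B2: "norm (Q (amp B (amp X f)) - amp Y (Q (amp B f))) \<le> ?\<epsilon> * norm f"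
      if "uni (dsum UNIV S) (dsum UNIV S) X" "uni S S Y"
        "\<And>v. v \<in> dsum UNIV S \<Longrightarrow> norm (B (X v) - amp Y (B v)) \<le> ?\<epsilon> * norm v" for X Y
    proof -
      have m: "amp B (amp X f) \<in> copies (dsum ?K S)" "amp (amp Y) (amp B f) \<in> copies (dsum ?K S)"
        by (intro isoadj_mem[OF isoadj_amp[OF B]] uni_mem[OF uni_amp[OF that(1)]]
            uni_mem[OF uni_amp[OF uni_amp[OF that(2)]]] f)+
      have "Q (amp B (amp X f)) - amp Y (Q (amp B f)) = Q (amp B (amp X f) - amp (amp Y) (amp B f))"
        by (simp add: clin_diff[OF uni_clin[OF Q(1)]] Q(2) uni_clin[OF that(2)])
      also have "norm \<dots> = norm (amp B (amp X f) - amp (amp Y) (amp B f))"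
        by (rule uni_norm[OF Q(1) csub_diff[OF uni_dom[OF Q(1)] m]])
      also have "\<dots> \<le> ?\<epsilon> * norm f"
        by (rule amp_err[OF f isoadj_clin(1)[OF B] uni_clin[OF that(1)] clin_blk that(3)])
          (rule uni_clin[OF that(2)])
      finally show ?thesis .
    qed
    show "norm (Q (amp B (amp ?D f)) - amp U (Q (amp B f))) \<le> ?\<epsilon> * norm f"
      "norm (Q (amp B (amp ?E f)) - amp V (Q (amp B f))) \<le> ?\<epsilon> * norm f"
      by (rule B2[OF D U Be(1)] B2[OF E V Be(2)]; assumption)+
  qed (rule \<epsilon>)
  then show ?thesis using xy by (intro exI[of _ x] exI[of _ y]) simp
qed

section \<open>Clock and shift\<close>

text \<open>The clock matrix with diagonal \<open>1, \<alpha>, \<alpha>^2, ...\<close>, tensored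
  with \<open>T\<close>. Its size is fixed only by the domain to which it is restricted.\<close>

definition clock :: "complex \<Rightarrow> ('a::cinner_space \<Rightarrow> 'b::cinner_space) \<Rightarrow> (nat \<Rightarrow>\<^sub>0 'a) \<Rightarrow> nat \<Rightarrow>\<^sub>0 'b" where
  "clock \<alpha> T = blk (\<lambda>a x. \<alpha> ^ a \<star> T x)"

definition cpred :: "nat \<Rightarrow> nat \<Rightarrow> nat" where
  "cpred d a = (if a = 0 then d - 1 else a - 1)"

text \<open>The cyclic shift tensored with \<open>T\<close>: entry \<open>a\<close> is taken from
  its cyclic predecessor. Hence clock after shift picks up one more factor \<open>\<alpha>\<close>
  than shift after clock, provided \<open>\<alpha> ^ d = 1\<close>.\<close>

definition shift :: "nat \<Rightarrow> ('a::cinner_space \<Rightarrow> 'b::cinner_space) \<Rightarrow> (nat \<Rightarrow>\<^sub>0 'a) \<Rightarrow> nat \<Rightarrow>\<^sub>0 'b" where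
  "shift d T f = amp T (rix {..<d} (cpred d) f)"

lemma bij_cpred: "bij_betw (cpred d) {..<d} {..<d}"
  by (rule bij_betw_byWitness[where f' = "\<lambda>a. if Suc a = d then 0 else Suc a"])
    (auto simp: cpred_def)

lemma inj_cpred: "inj_on (cpred d) {..<d}"
  using bij_cpred by (rule bij_betw_imp_inj_on)

lemma cpred_less: "a < d \<Longrightarrow> cpred d a < d"
  by (auto simp: cpred_def)

text \<open>At \<open>a = 0\<close> the predecessor is \<open>d - 1\<close>, and the wrap-around is
  paid for by \<open>\<omega> ^ d = 1\<close>.\<close>

lemma power_cpred: "\<omega> ^ d = 1 \<Longrightarrow> a < d \<Longrightarrow> \<omega> * \<omega> ^ cpred d a = (\<omega> :: complex) ^ a"
  by (cases a) (auto simp: cpred_def simp flip: power_Suc)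

lemma lookup_clock [simp]: "clin T \<Longrightarrow> lookup (clock \<alpha> T f) a = \<alpha> ^ a \<star> T (lookup f a)"
  by (simp add: clock_def clin_cscale)

lemma clin_clock: "clin T \<Longrightarrow> clin (clock \<alpha> T)"
  by (simp add: clock_def clin_blk clin_cscale)

lemma lookup_shift [simp]:
  "clin T \<Longrightarrow> lookup (shift d T f) a = (if a < d then T (lookup f (cpred d a)) else 0)"
  by (simp add: shift_def lookup_rix inj_cpred clin_zero)

lemma clin_shift: "clin T \<Longrightarrow> clin (shift d T)"
  unfolding shift_def by (rule clin_comp[OF clin_blk clin_rix[OF inj_cpred]])

lemma uni_clock: "uni S R T \<Longrightarrow> cmod \<alpha> = 1 \<Longrightarrow> uni (dsum K S) (dsum K R) (clock \<alpha> T)"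
  unfolding clock_def
  by (rule uni_blk) (simp_all add: clin_cscale uni_clin uni_dom uni_cod uni_cscale norm_power)

lemma uni_shift: "uni S R T \<Longrightarrow> uni (dsum {..<d} S) (dsum {..<d} R) (shift d T)"
  unfolding shift_def by (rule uni_comp[OF uni_rix[OF bij_cpred uni_dom] uni_amp])

lemma norm_le_lookup_shift:
  fixes g :: "nat \<Rightarrow>\<^sub>0 'b::cinner_space"
  assumes S: "csub S" and f: "f \<in> dsum {..<d} S" and e: "e \<ge> 0"
    and le: "\<And>a. a < d \<Longrightarrow> norm (lookup g a) \<le> e * norm (lookup f (cpred d a))"
    and z: "\<And>a. a \<ge> d \<Longrightarrow> lookup g a = 0"
  shows "norm g \<le> e * norm f"
proof -
  have "norm g \<le> e * norm (rix {..<d} (cpred d) f)"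
    by (rule norm_le_lookup) (use le z e in \<open>auto simp: lookup_rix inj_cpred\<close>)
  also have "norm (rix {..<d} (cpred d) f) = norm f"
    by (rule uni_norm[OF uni_rix[OF bij_cpred S] f])
  finally show ?thesis .
qed

text \<open>The clock for \<open>cnj \<omega>\<close> cancels the twist: at each index the
  commutator is a unimodular multiple of \<open>U V - \<omega> V U\<close>, evaluated at the shifted
  entry.\<close>

lemma clock_shift_almost_commute:
  assumes U: "uni S S U" and V: "uni S S V" and \<omega>: "\<omega> ^ d = 1" "cmod \<omega> = 1" and \<delta>: "\<delta> \<ge> 0"
    and c: "\<And>x. x \<in> S \<Longrightarrow> norm (U (V x) - \<omega> \<star> V (U x)) \<le> \<delta> * norm x" and f: "f \<in> dsum {..<d} S"
  shows "norm (clock (cnj \<omega>) U (shift d V f) - shift d V (clock (cnj \<omega>) U f)) \<le> \<delta> * norm f"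
proof (rule norm_le_lookup_shift[OF uni_dom[OF U] f \<delta>])
  fix a assume a: "a < d"
  let ?y = "lookup f (cpred d a)"
  have "cnj \<omega> ^ d = 1" using \<omega>(1) by (metis complex_cnj_one complex_cnj_power)
  then have "\<omega> * (cnj \<omega> * cnj \<omega> ^ cpred d a) = \<omega> * cnj \<omega> ^ a"
    using power_cpred a by simp
  then have w: "cnj \<omega> ^ cpred d a = cnj \<omega> ^ a * \<omega>"
    using cmod_one_cnj(1)[OF \<omega>(2)] by (simp add: mult.assoc[symmetric] mult.commute)
  have "lookup (clock (cnj \<omega>) U (shift d V f) - shift d V (clock (cnj \<omega>) U f)) a
    = cnj \<omega> ^ a \<star> (U (V ?y) - \<omega> \<star> V (U ?y))"
    by (simp add: a uni_clin[OF U] uni_clin[OF V] clin_clock clin_shift w cscale_diff_right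
        cscale_cscale clin_scale[OF uni_clin[OF V]])
  then show "norm (lookup (clock (cnj \<omega>) U (shift d V f) - shift d V (clock (cnj \<omega>) U f)) a)
      \<le> \<delta> * norm ?y"
    using c[OF dsum_mem[OF f]] by (simp add: norm_power \<omega>)
next
  fix a assume "a \<ge> d"
  then show "lookup (clock (cnj \<omega>) U (shift d V f) - shift d V (clock (cnj \<omega>) U f)) a = 0"
    by (simp add: uni_clin[OF U] uni_clin[OF V] dsum_zero[OF f] clin_zero)
qed

text \<open>The converse step: the clock for \<open>\<omega>\<close> puts the twist back onto a
  commuting pair, now exactly.\<close>

lemma clock_shift_commute:
  assumes U: "clin U" and V: "clin V" and \<omega>: "\<omega> ^ d = 1"
    and c: "\<And>x. x \<in> S \<Longrightarrow> U (V x) = V (U x)" and f: "f \<in> dsum {..<d} S"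
  shows "clock \<omega> U (shift d V f) = \<omega> \<star> shift d V (clock \<omega> U f)"
proof (rule poly_mapping_eqI)
  fix a
  show "lookup (clock \<omega> U (shift d V f)) a = lookup (\<omega> \<star> shift d V (clock \<omega> U f)) a"
    using power_cpred[OF \<omega>, of a] c[OF dsum_mem[OF f]]
    by (cases "a < d") (simp_all add: U V clin_scale[OF V] cscale_cscale clin_zero)
qed

lemma near_clock_shift:
  assumes n: "near S U V R U' V' e" and e: "e \<ge> 0" and \<alpha>: "cmod \<alpha> = 1"
    and cl: "clin U" "clin V" "clin U'" "clin V'"
  shows "near (dsum {..<d} S) (clock \<alpha> U) (shift d V) (dsum {..<d} R) (clock \<alpha> U') (shift d V') e"
proof -
  obtain Q where Q: "uni S R Q" and QU: "\<And>x. x \<in> S \<Longrightarrow> norm (Q (U x) - U' (Q x)) \<le> e * norm x"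
    and QV: "\<And>x. x \<in> S \<Longrightarrow> norm (Q (V x) - V' (Q x)) \<le> e * norm x"
    using n by (auto simp: near_def)
  note cQ = uni_clin[OF Q]
  show ?thesis
  proof (rule nearI[OF uni_amp[OF Q]])
    fix f assume f: "f \<in> dsum {..<d} S"
    show "norm (amp Q (clock \<alpha> U f) - clock \<alpha> U' (amp Q f)) \<le> e * norm f"
    proof (rule norm_le_lookup[OF _ e])
      fix a
      have "lookup (amp Q (clock \<alpha> U f) - clock \<alpha> U' (amp Q f)) a = \<alpha> ^ a \<star> (Q (U (lookup f a))
          - U' (Q (lookup f a)))"
        by (simp add: cl cQ clin_scale[OF cQ] cscale_diff_right)
      then show "norm (lookup (amp Q (clock \<alpha> U f) - clock \<alpha> U' (amp Q f)) a) \<le> e * norm (lookup f a)"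
        using QU[OF dsum_mem[OF f]] by (simp add: norm_power \<alpha>)
    qed
    show "norm (amp Q (shift d V f) - shift d V' (amp Q f)) \<le> e * norm f"
      by (rule norm_le_lookup_shift[OF uni_dom[OF Q] f e])
        (use QV[OF dsum_mem[OF f]] in \<open>simp_all add: cl cQ clin_zero\<close>)
  qed
qed

lemma near_amp:
  assumes n: "near S U V R U' V' e" and e: "e \<ge> 0"
    and cl: "clin U" "clin V" "clin U'" "clin V'"
  shows "near (dsum K S) (amp U) (amp V) (dsum K R) (amp U') (amp V') e"
proof -
  obtain Q where Q: "uni S R Q" and QU: "\<And>x. x \<in> S \<Longrightarrow> norm (Q (U x) - U' (Q x)) \<le> e * norm x"
    and QV: "\<And>x. x \<in> S \<Longrightarrow> norm (Q (V x) - V' (Q x)) \<le> e * norm x"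
    using n by (auto simp: near_def)
  note cQ = uni_clin[OF Q]
  show ?thesis
  proof (rule nearI[OF uni_amp[OF Q]])
    fix f assume f: "f \<in> dsum K S"
    show "norm (amp Q (amp U f) - amp U' (amp Q f)) \<le> e * norm f"
      "norm (amp Q (amp V f) - amp V' (amp Q f)) \<le> e * norm f"
      by (rule norm_le_lookup[OF _ e]; simp add: cl cQ QU QV dsum_mem[OF f])+
  qed
qed

text \<open>The swap of two tensor factors, which brings the index of the outer clock in front of
  the infinite multiplicity.\<close>

definition flip :: "('k \<Rightarrow>\<^sub>0 ('l \<Rightarrow>\<^sub>0 'a::zero)) \<Rightarrow> 'l \<Rightarrow>\<^sub>0 ('k \<Rightarrow>\<^sub>0 'a)" where
  "flip f = cur (rix UNIV prod.swap (uncur f))"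

lemma lookup_flip [simp]: "lookup (lookup (flip f) l) k = lookup (lookup f k) l"
  by (simp add: flip_def lookup_rix inj_swap)

lemma uni_cur:
  fixes S :: "'a::cinner_space set" and K :: "'k set" and L :: "'l set"
  assumes S: "csub S"
  shows "uni (dsum (K \<times> L) S) (dsum K (dsum L S)) cur"
proof -
  obtain T' where T': "uni (dsum (K \<times> L) S) (dsum K (dsum L S)) T'"
    "\<And>y. y \<in> dsum (K \<times> L) S \<Longrightarrow> uncur (T' y) = y" "\<And>x. x \<in> dsum K (dsum L S) \<Longrightarrow> T' (uncur x) = x"
    using uni_inverseE[OF uni_uncur[OF S, of K L]] by blast
  have e: "cur y = T' y" if "y \<in> dsum (K \<times> L) S" for y
    using T'(2)[OF that] by (metis cur_uncur)
  show ?thesis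
    by (rule uniI[where T' = "uncur :: ('k \<Rightarrow>\<^sub>0 'l \<Rightarrow>\<^sub>0 'a) \<Rightarrow> _"])
      (simp_all add: e uni_mem[OF T'(1)] uni_norm[OF T'(1)] T'(2) uni_mem[OF uni_uncur[OF S]]
        csub_dsum S clin_uncur clin_cur)
qed

lemma clin_flip: "clin flip"
  by (rule clinI; rule poly_mapping_eqI; rule poly_mapping_eqI) simp_all

lemma norm_flip: "norm (flip f) = norm f"
proof -
  let ?g = "rix UNIV prod.swap (uncur f)"
  have u: "uncur f \<in> dsum UNIV UNIV" "?g \<in> dsum (UNIV \<times> UNIV) UNIV"
    by (auto intro: dsumI)
  have "norm (cur ?g) = norm ?g"
    by (rule uni_norm[OF uni_cur[OF csub_UNIV] u(2)])
  also have "\<dots> = norm (uncur f)"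
    by (rule uni_norm[OF uni_rix[OF _ csub_UNIV] u(1)]) (simp add: bij_swap)
  finally show ?thesis by (simp add: flip_def norm_uncur)
qed

lemma uni_flip:
  fixes S :: "'a::cinner_space set" and K :: "'k set" and L :: "'l set"
  assumes S: "csub S"
  shows "uni (dsum K (dsum L S)) (dsum L (dsum K S)) flip"
proof -
  have m: "flip f \<in> dsum L' (dsum K' S)" if f: "f \<in> dsum K' (dsum L' S)" for f and K' :: "'x set"
      and L' :: "'y set"
  proof (intro dsumI poly_mapping_eqI)
    fix k l
    show "lookup (lookup (flip f) l) k \<in> S" by (simp add: dsum_mem[OF dsum_mem[OF f]])
    show "lookup (lookup (flip f) l) k = 0" if "k \<notin> K'" by (simp add: dsum_zero[OF f that])
    show "lookup (lookup (flip f) l) k = lookup 0 k" if "l \<notin> L'"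
      by (simp add: dsum_zero[OF dsum_mem[OF f] that])
  qed
  have ff: "flip (flip f) = f" for f :: "'x \<Rightarrow>\<^sub>0 'y \<Rightarrow>\<^sub>0 'a"
    by (rule poly_mapping_eqI; rule poly_mapping_eqI) simp
  show ?thesis
    by (rule uniI[where T' = flip]) (simp_all add: m csub_dsum S clin_flip norm_flip ff)
qed

lemma near_flip:
  assumes S: "csub S" and cl: "clin U" "clin V"
  shows "near (dsum K (dsum {..<d} S)) (amp (clock \<alpha> U)) (amp (shift d V))
    (dsum {..<d} (dsum K S)) (clock \<alpha> (amp U)) (shift d (amp V)) 0"
proof (rule near_exactI[OF uni_flip[OF S]])
  fix f
  show "flip (amp (clock \<alpha> U) f) = clock \<alpha> (amp U) (flip f)"
    by (rule poly_mapping_eqI; rule poly_mapping_eqI) (simp add: cl clin_clock clin_blk)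
  show "flip (amp (shift d V) f) = shift d (amp V) (flip f)"
    by (rule poly_mapping_eqI; rule poly_mapping_eqI) (simp add: cl clin_shift clin_blk)
qed

text \<open>The unitary Fourier matrix of order \<open>d\<close>, tensored with the identity. It
  conjugates the clock for \<open>cnj \<omega>\<close> into the shift.\<close>

definition dft :: "nat \<Rightarrow> complex \<Rightarrow> (nat \<Rightarrow>\<^sub>0 'a::cinner_space) \<Rightarrow> nat \<Rightarrow>\<^sub>0 'a" where
  "dft d \<omega> h = Abs_poly_mapping (\<lambda>b. if b < d
     then of_real (1 / sqrt d) \<star> (\<Sum>e<d. \<omega> ^ (b * e) \<star> lookup h e) else 0)"

lemma lookup_dft: "lookup (dft d \<omega> h) b = (if b < d
     then of_real (1 / sqrt d) \<star> (\<Sum>e<d. \<omega> ^ (b * e) \<star> lookup h e) else 0)"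
proof -
  have "finite {b. (if b < d then of_real (1 / sqrt d) \<star> (\<Sum>e<d. \<omega> ^ (b * e) \<star> lookup h e) else 0) \<noteq> 0}"
    by (rule finite_subset[of _ "{..<d}"]) (auto split: if_split_asm)
  then show ?thesis by (simp add: dft_def)
qed

lemma clin_dft: "clin (dft d \<omega>)"
  by (rule clinI; rule poly_mapping_eqI)
    (simp_all add: lookup_dft cscale_add_right sum.distrib cscale_sum_right cscale_cscale mult_ac)

lemma prim_root_cnj: "prim_root d \<omega> \<Longrightarrow> prim_root d (cnj \<omega>)"
  unfolding prim_root_def by (metis complex_cnj_cnj complex_cnj_one complex_cnj_power)

lemma dft_dft_cnj:
  assumes \<omega>: "prim_root d \<omega>" and h: "h \<in> dsum {..<d} S"
  shows "dft d (cnj \<omega>) (dft d \<omega> h) = h"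
proof (rule poly_mapping_eqI)
  fix b
  have d: "d > 0" using \<omega> by (simp add: prim_root_def)
  show "lookup (dft d (cnj \<omega>) (dft d \<omega> h)) b = lookup h b"
  proof (cases "b < d")
    case True
    have c: "complex_of_real (1 / sqrt d) * of_real (1 / sqrt d) = of_real (1 / d)"
      using d by (simp flip: of_real_mult)
    have "lookup (dft d (cnj \<omega>) (dft d \<omega> h)) b
      = of_real (1 / sqrt d) \<star> (\<Sum>e<d. cnj \<omega> ^ (b * e) \<star> of_real (1 / sqrt d) \<star> (\<Sum>j<d. \<omega> ^ (e * j)
          \<star> lookup h j))"
      using True by (simp only: lookup_dft if_True lessThan_iff cong: sum.cong) (simp add: lookup_dft)
    also have "\<dots> = of_real (1 / d) \<star> (\<Sum>e<d. \<Sum>j<d. (\<omega> ^ (e * j) * cnj (\<omega> ^ (e * b))) \<star> lookup h j)"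
      unfolding cscale_sum_right cscale_cscale c[symmetric]
      by (intro sum.cong refl) (simp add: mult_ac)
    also have "(\<Sum>e<d. \<Sum>j<d. (\<omega> ^ (e * j) * cnj (\<omega> ^ (e * b))) \<star> lookup h j)
        = (\<Sum>j<d. (if j = b then of_nat d else 0) \<star> lookup h j)"
    proof (subst sum.swap, rule sum.cong[OF refl])
      fix j assume "j \<in> {..<d}"
      then show "(\<Sum>e<d. (\<omega> ^ (e * j) * cnj (\<omega> ^ (e * b))) \<star> lookup h j) = (if j
          = b then of_nat d else 0) \<star> lookup h j"
        using prim_root_orthogonality[OF \<omega>, of j b] True by
            (simp only: cscale_sum_left[symmetric] lessThan_iff)
    qed
    also have "\<dots> = (\<Sum>j<d. if j = b then of_nat d \<star> lookup h b else 0)"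
      by (intro sum.cong) auto
    also have "\<dots> = of_nat d \<star> lookup h b" using True by simp
    finally show ?thesis using d by (simp add: cscale_cscale)
  next
    case False
    then show ?thesis using dsum_zero[OF h] by (simp add: lookup_dft)
  qed
qed

lemma uni_dft:
  assumes \<omega>: "prim_root d \<omega>" and S: "csub S"
  shows "uni (dsum {..<d} S) (dsum {..<d} S) (dft d \<omega>)"
proof -
  have m: "dft d \<alpha> h \<in> dsum {..<d} S" if "h \<in> dsum {..<d} S" for h \<alpha>
    by (rule dsumI) (auto simp: lookup_dft csub_zero S intro!: csub_scale csub_sum dsum_mem[OF that])
  show ?thesis
  proof (rule uniI[where T' = "dft d (cnj \<omega>)"])
    fix h assume h: "h \<in> dsum {..<d} S"
    show "dft d (cnj \<omega>) (dft d \<omega> h) = h" by (rule dft_dft_cnj[OF \<omega> h])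
    show "dft d \<omega> (dft d (cnj \<omega>) h) = h" using dft_dft_cnj[OF prim_root_cnj[OF \<omega>] h] by simp
    have d: "d > 0" using \<omega> by (simp add: prim_root_def)
    have "(norm (dft d \<omega> h))\<^sup>2 = (\<Sum>b<d. (norm (lookup (dft d \<omega> h) b))\<^sup>2)"
      by (rule norm_sq_poly_mapping) (auto simp: lookup_dft)
    also have "\<dots> = (\<Sum>b<d. (norm (\<Sum>e<d. \<omega> ^ (b * e) \<star> lookup h e))\<^sup>2 / d)"
      by (intro sum.cong refl) (simp add: lookup_dft norm_divide power_divide)
    also have "\<dots> = (\<Sum>e<d. (norm (lookup h e))\<^sup>2)"
      using d by (simp add: parseval[OF \<omega>] flip: sum_divide_distrib)
    also have "\<dots> = (norm h)\<^sup>2"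
      by (rule norm_sq_poly_mapping[symmetric]) (auto simp: dsum_zero[OF h])
    finally show "norm (dft d \<omega> h) = norm h" by simp
  qed (simp_all add: m csub_dsum S clin_dft)
qed

text \<open>In the coordinates \<open>(c, b)\<close> with \<open>c = a - b\<close> modulo \<open>d\<close>, the product of the clocks in \<open>a\<close> and \<open>b\<close>
  only sees \<open>c\<close>, and the product of the shifts only moves \<open>b\<close>.\<close>

definition shear :: "nat \<Rightarrow> (nat \<Rightarrow>\<^sub>0 (nat \<Rightarrow>\<^sub>0 'a::zero)) \<Rightarrow> nat \<Rightarrow>\<^sub>0 (nat \<Rightarrow>\<^sub>0 'a)" where
  "shear d f = cur (rix ({..<d} \<times> {..<d}) (\<lambda>(a, b). ((a + d - b) mod d, b)) (uncur f))"

lemma bij_shear: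
  fixes d :: nat
  shows "bij_betw (\<lambda>(a, b). ((a + d - b) mod d, b)) ({..<d} \<times> {..<d}) ({..<d} \<times> {..<d})"
proof (rule bij_betw_byWitness[where f' = "\<lambda>(c, b). ((c + b) mod d, b)"])
  have "((a + d - b) mod d + b) mod d = a" if "a < d" "b < d" for a b
  proof -
    have "((a + d - b) mod d + b) mod d = (a + d - b + b) mod d" by (rule mod_add_left_eq)
    then show ?thesis using that by simp
  qed
  then show "\<forall>x\<in>{..<d} \<times> {..<d}. (case case x of (a, b) \<Rightarrow> ((a + d
      - b) mod d, b) of (c, b) \<Rightarrow> ((c + b) mod d, b)) = x"
    by auto
  have "((c + b) mod d + d - b) mod d = c" if "c < d" "b < d" for c b
  proof (cases "c + b < d")
    case False
    then have "(c + b) mod d = c + b - d" using that by (simp add: mod_if)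
    then show ?thesis using False that by simp
  qed simp
  then show "\<forall>x\<in>{..<d} \<times> {..<d}. (case case x of (c, b) \<Rightarrow> ((c + b) mod d, b) of (a, b) \<Rightarrow> ((a + d
      - b) mod d, b)) = x"
    by auto
qed (auto intro!: mod_less_divisor)

lemma uni_shear:
  assumes S: "csub S"
  shows "uni (dsum {..<d} (dsum {..<d} S)) (dsum {..<d} (dsum {..<d} S)) (shear d)"
  unfolding shear_def by (rule uni_comp[OF uni_uncur[OF S] uni_comp[OF uni_rix[OF bij_shear S]
      uni_cur[OF S]]])

lemma lookup_shear [simp]: "lookup (lookup (shear d f) a) b =
    (if a < d \<and> b < d then lookup (lookup f ((a + d - b) mod d)) b else 0)"
  by (simp add: shear_def lookup_rix bij_betw_imp_inj_on[OF bij_shear])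

text \<open>The reason why the product of the two shifts fixes the coordinate \<open>c\<close> of
  the shear. When exactly one index wraps around, the two sides differ by a full turn
  \<open>d\<close> before reduction.\<close>

lemma cpred_diff_mod: "a < d \<Longrightarrow> b < d \<Longrightarrow> (cpred d a + d - cpred d b) mod d = (a + d - b) mod d"
proof -
  assume ab: "a < d" "b < d"
  consider "a = 0" "b = 0" | "a = 0" "b > 0" | "a > 0" "b = 0" | "a > 0" "b > 0" by auto
  then show ?thesis
  proof cases
    case 2
    then have "cpred d a + d - cpred d b = d + (d - b)" using ab by (simp add: cpred_def)
    then show ?thesis using 2 by simp
  next
    case 3
    then have "cpred d a + d - cpred d b = a" using ab by (simp add: cpred_def)
    then show ?thesis using 3 by simp
  qed (use ab in \<open>simp_all add: cpred_def\<close>)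
qed

text \<open>Of the three conjugations only the first has an error: \<open>n1\<close> uses the words
  \<open>U^e V^c\<close> with exponents below \<open>d\<close>, \<open>n2\<close> is a Fourier
  transform in \<open>e\<close> that turns the remaining clock into a shift, and \<open>n3\<close>
  is the shear.\<close>

lemma near_twist:
  assumes U: "uni S S U" and V: "uni S S V" and \<omega>: "prim_root d \<omega>" and \<delta>: "\<delta> \<ge> 0"
    and c: "\<And>x. x \<in> S \<Longrightarrow> norm (U (V x) - \<omega> \<star> V (U x)) \<le> \<delta> * norm x"
  shows "near (dsum {..<d} (dsum {..<d} S)) (amp (amp U)) (amp (amp V))
    (dsum {..<d} (dsum {..<d} S)) (clock \<omega> (clock (cnj \<omega>) U)) (shift d (shift d V)) (d * \<delta>)"
proof -
  let ?T = "dsum {..<d} (dsum {..<d} S)"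
  have S: "csub S" using uni_dom[OF U] .
  have wd: "\<omega> ^ d = 1" "cmod \<omega> = 1" using \<omega> root_of_unity_cmod by (auto simp: prim_root_def)
  have wd': "cnj \<omega> ^ d = 1" "cmod (cnj \<omega>) = 1"
    using wd by (metis complex_cnj_one complex_cnj_power, simp)
  note cl = uni_clin[OF U] uni_clin[OF V]
  define M where "M c e x = (U ^^ e) ((V ^^ c) x)" for c e x
  have M: "uni S S (M c e)" for c e
    unfolding M_def by (rule uni_comp[OF uni_funpow[OF V] uni_funpow[OF U]])
  note cM = uni_clin[OF M]
  let ?M = "blk (\<lambda>c. blk (\<lambda>e. M c e))"
  let ?U1 = "clock \<omega> (amp U)" and ?V1 = "amp (clock (cnj \<omega>) V)"
  have uM: "uni ?T ?T ?M"
    by (intro uni_blk csub_dsum S M clin_blk cM)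
  have n1: "near ?T ?U1 ?V1 ?T (amp (amp U)) (amp (amp V)) (d * \<delta>)"
  proof (rule nearI[OF uM])
    fix f assume f: "f \<in> ?T"
    have m: "lookup (lookup f c) e \<in> S" for c e by (rule dsum_mem[OF dsum_mem[OF f]])
    have d\<delta>: "real d * \<delta> \<ge> 0" using \<delta> by simp
    show "norm (?M (?U1 f) - amp (amp U) (?M f)) \<le> d * \<delta> * norm f"
    proof (rule norm_le_lookup[OF _ d\<delta>], rule norm_le_lookup[OF _ d\<delta>])
      fix a e
      let ?x = "lookup (lookup f a) e"
      have "lookup (lookup (?M (?U1 f) - amp (amp U) (?M f)) a) e
          = (U ^^ e) (\<omega> ^ a \<star> (V ^^ a) (U ?x) - U ((V ^^ a) ?x))"
        by (simp add: cl clin_blk cM M_def clin_diff[OF clin_funpow[OF cl(1)]]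
            clin_scale[OF clin_funpow[OF cl(2)]] funpow_swap1)
      also have "norm \<dots> = norm (U ((V ^^ a) ?x) - \<omega> ^ a \<star> (V ^^ a) (U ?x))"
        by (subst uni_norm[OF uni_funpow[OF U]])
          (intro csub_diff csub_scale S uni_mem[OF uni_funpow[OF V]] uni_mem[OF U] m, rule
              norm_minus_commute)
      also have "\<dots> \<le> d * \<delta> * norm ?x"
      proof (cases "a < d")
        case True
        have "norm (U ((V ^^ a) ?x) - \<omega> ^ a \<star> (V ^^ a) (U ?x)) \<le> a * \<delta> * norm ?x"
          by (rule twisted_commute_power_right[OF U V wd(2) c m])
        also have "\<dots> \<le> d * \<delta> * norm ?x" using True \<delta> by (intro mult_right_mono) auto
        finally show ?thesis .
      next
        case False
        then show ?thesis using dsum_zero[OF f, of a] by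
            (simp add: clin_zero cl clin_zero[OF clin_funpow])
      qed
      finally show "norm (lookup (lookup (?M (?U1 f) - amp (amp U) (?M f)) a) e) \<le> d * \<delta> * norm ?x" .
    qed
    show "norm (?M (?V1 f) - amp (amp V) (?M f)) \<le> d * \<delta> * norm f"
    proof (rule norm_le_lookup[OF _ d\<delta>], rule norm_le_lookup[OF _ d\<delta>])
      fix a e
      let ?x = "lookup (lookup f a) e"
      let ?y = "(V ^^ a) ?x"
      have y: "?y \<in> S" "norm ?y = norm ?x"
        by (rule uni_mem[OF uni_funpow[OF V] m], rule uni_norm[OF uni_funpow[OF V] m])
      have "lookup (lookup (?M (?V1 f) - amp (amp V) (?M f)) a) e
          = cnj \<omega> ^ e \<star> (U ^^ e) (V ?y) - V ((U ^^ e) ?y)"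
        by (simp add: cl clin_blk clin_clock cM M_def
            clin_scale[OF clin_funpow[OF cl(1)]] clin_scale[OF clin_funpow[OF cl(2)]] funpow_swap1)
      also have "\<dots> = cnj \<omega> ^ e \<star> ((U ^^ e) (V ?y) - \<omega> ^ e \<star> V ((U ^^ e) ?y))"
        using cmod_one_cnj(2)[OF wd(2)] by (simp add: cscale_diff_right cscale_cscale flip:
            power_mult_distrib)
      also have "norm \<dots> = norm ((U ^^ e) (V ?y) - \<omega> ^ e \<star> V ((U ^^ e) ?y))"
        by (simp add: norm_power wd)
      also have "\<dots> \<le> d * \<delta> * norm ?x"
      proof (cases "e < d")
        case True
        have "norm ((U ^^ e) (V ?y) - \<omega> ^ e \<star> V ((U ^^ e) ?y)) \<le> e * \<delta> * norm ?y"
          by (rule twisted_commute_power_left[OF U V wd(2) c y(1)])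
        also have "\<dots> \<le> d * \<delta> * norm ?x" using True \<delta> by (simp add: y mult_right_mono)
        finally show ?thesis .
      next
        case False
        then show ?thesis using dsum_zero[OF dsum_mem[OF f], of e] by
            (simp add: clin_zero cl clin_zero[OF clin_funpow])
      qed
      finally show "norm (lookup (lookup (?M (?V1 f) - amp (amp V) (?M f)) a) e) \<le> d * \<delta> * norm ?x" .
    qed
  qed
  let ?V2 = "amp (shift d V)"
  have cd: "clin (dft d \<omega>)" by (rule clin_dft)
  have n2: "near ?T ?U1 ?V1 ?T ?U1 ?V2 0"
  proof (rule near_exactI[OF uni_amp[OF uni_dft[OF \<omega> S]]])
    fix f assume f: "f \<in> ?T"
    show "amp (dft d \<omega>) (?U1 f) = ?U1 (amp (dft d \<omega>) f)"
      by (rule poly_mapping_eqI; rule poly_mapping_eqI)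
        (simp add: cd cl clin_blk lookup_dft clin_zero clin_scale clin_sum cscale_sum_right
            cscale_cscale mult_ac)
    show "amp (dft d \<omega>) (?V1 f) = ?V2 (amp (dft d \<omega>) f)"
    proof (rule poly_mapping_eqI; rule poly_mapping_eqI)
      fix a b
      show "lookup (lookup (amp (dft d \<omega>) (?V1 f)) a) b = lookup (lookup (?V2 (amp (dft d \<omega>) f)) a) b"
      proof (cases "b < d")
        case True
        have w: "\<omega> ^ (b * e) * cnj \<omega> ^ e = \<omega> ^ (cpred d b * e)" for e
        proof -
          have "\<omega> ^ b * cnj \<omega> = \<omega> ^ cpred d b * (\<omega> * cnj \<omega>)"
            using power_cpred[OF wd(1) True] by (metis mult.assoc mult.commute)
          then have "\<omega> ^ b * cnj \<omega> = \<omega> ^ cpred d b" by (simp add: cmod_one_cnj wd)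
          then show ?thesis by (simp add: power_mult power_mult_distrib[symmetric])
        qed
        show ?thesis using True
          by (simp add: cd cl clin_clock clin_shift lookup_dft clin_scale[OF cl(2)] clin_sum[OF cl(2)]
              cpred_less cscale_cscale w)
      next
        case False
        then show ?thesis by (simp add: cd cl clin_clock clin_shift lookup_dft)
      qed
    qed
  qed
  have n3: "near ?T ?U1 ?V2 ?T (clock \<omega> (clock (cnj \<omega>) U)) (shift d (shift d V)) 0"
  proof (rule near_exactI[OF uni_shear[OF S]])
    fix f assume f: "f \<in> ?T"
    show "shear d (?U1 f) = clock \<omega> (clock (cnj \<omega>) U) (shear d f)"
    proof (rule poly_mapping_eqI; rule poly_mapping_eqI)
      fix a b
      have "\<omega> ^ ((a + d - b) mod d) = \<omega> ^ a * cnj \<omega> ^ b" if "a < d" "b < d"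
      proof -
        have "\<omega> ^ ((a + d - b) mod d) = \<omega> ^ (a + d - b)" by (rule root_power_mod[OF wd(1)])
        also have "\<dots> = \<omega> ^ (a + d - b) * (\<omega> * cnj \<omega>) ^ b" by (simp add: cmod_one_cnj wd)
        also have "\<dots> = \<omega> ^ (a + d - b + b) * cnj \<omega> ^ b" by
            (simp add: power_mult_distrib power_add mult.assoc)
        also have "a + d - b + b = a + d" using that by simp
        finally show ?thesis by (simp add: power_add wd)
      qed
      then show "lookup (lookup (shear d (?U1 f)) a) b
          = lookup (lookup (clock \<omega> (clock (cnj \<omega>) U) (shear d f)) a) b"
        by (simp add: cl clin_clock clin_blk cscale_cscale clin_zero)
    qed
    show "shear d (?V2 f) = shift d (shift d V) (shear d f)"
      by (rule poly_mapping_eqI; rule poly_mapping_eqI)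
        (auto simp: cl clin_shift cpred_less cpred_diff_mod clin_zero)
  qed
  have u: "uni ?T ?T (amp (amp U))" "uni ?T ?T (amp (amp V))" "uni ?T ?T ?U1" "uni ?T ?T ?V1" "uni
      ?T ?T ?V2"
    by (intro uni_amp uni_clock uni_shift U V wd wd')+
  from near_trans[OF near_trans[OF near_sym[OF n1 u(3,4,1,2)] n2 u(1,2,3,4)] n3 u(1,2,3,5)]
  show ?thesis by simp
qed

text \<open>The chain passes to copies indexed by \<open>d \<times> d\<close> (\<open>s1\<close>),
  twists them by both clock-shift pairs (\<open>s2\<close>), moves the outer pair outside the
  multiplicity (\<open>s3\<close>) and replaces the almost commuting inner part by commuting
  diagonal operators (\<open>s4\<close>). The outer pair then makes the relation exact.\<close>

theorem near_twisted:
  fixes S :: "'a::cinner_space set" and \<Phi> :: "'a \<Rightarrow> 'i \<Rightarrow>\<^sub>0 complex" and N d :: nat and \<delta> :: real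
  assumes U: "uni S S U" and V: "uni S S V" and \<omega>: "prim_root d \<omega>"
    and comm: "\<And>x. x \<in> S \<Longrightarrow> norm (U (V x) - \<omega> \<star> V (U x)) \<le> \<delta> * norm x" and \<delta>: "\<delta> \<ge> 0"
    and \<Phi>: "uni S (dsum I UNIV) \<Phi>" and I: "countable I" and ne: "\<exists>v\<in>S. v \<noteq> 0"
    and N: "N \<ge> 1" and \<kappa>: "\<kappa> = 2 / sqrt N + N * \<delta>" "\<kappa> < 1"
  shows "\<exists>(R :: (nat \<Rightarrow>\<^sub>0 nat \<Rightarrow>\<^sub>0 nat \<times> nat \<Rightarrow>\<^sub>0 nat \<Rightarrow>\<^sub>0 'a) set) X Y.
    uni R R X \<and> uni R R Y \<and> (\<forall>f\<in>R. X (Y f) = \<omega> \<star> Y (X f)) \<and>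
    near (copies S) (amp U) (amp V) R X Y (d * \<delta> + 24 * sqrt \<kappa>)"
proof -
  let ?d = "{..<d}"
  have d: "d > 0" and wd: "\<omega> ^ d = 1" "cmod \<omega> = 1"
    using \<omega> root_of_unity_cmod by (auto simp: prim_root_def)
  have wd': "cmod (cnj \<omega>) = 1" using wd by simp
  note S = uni_dom[OF U] and cl = uni_clin[OF U] uni_clin[OF V]
  have K: "countable ?d" "?d \<noteq> {}" using d by auto
  let ?T = "copies (dsum ?d (dsum ?d S))"
  note ud = uni_amp[OF U, of ?d] uni_amp[OF V, of ?d]
  have "near ?T (amp (amp (amp U))) (amp (amp (amp V))) (copies (dsum ?d S)) (amp (amp U)) (amp
      (amp V)) 0"
    by (rule near_flatten[OF ud K])
  moreover have "near (copies (dsum ?d S)) (amp (amp U)) (amp (amp V)) (copies S) (amp U) (amp V) 0"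
    by (rule near_flatten[OF U V K])
  ultimately have "near ?T (amp (amp (amp U))) (amp (amp (amp V))) (copies S) (amp U) (amp V) (0 + 0)"
    by (rule near_trans) (intro uni_amp U V)+
  then have s1: "near (copies S) (amp U) (amp V) ?T (amp (amp (amp U))) (amp (amp (amp V))) 0"
    by (simp, elim near_sym) (intro uni_amp U V)+
  define U' V' where "U' = clock (cnj \<omega>) U" and "V' = shift d V"
  let ?S' = "dsum ?d S"
  have U': "uni ?S' ?S' U'" and V': "uni ?S' ?S' V'"
    unfolding U'_def V'_def by (rule uni_clock[OF U wd'], rule uni_shift[OF V])
  note cl' = uni_clin[OF U'] uni_clin[OF V']
  have s2: "near ?T (amp (amp (amp U))) (amp (amp (amp V))) ?T (amp (clock \<omega> U')) (amp (shift d
      V')) (d * \<delta>)"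
    unfolding U'_def V'_def
    by (rule near_amp[OF near_twist[OF U V \<omega> \<delta> comm]])
      (use \<delta> cl in \<open>simp_all add: clin_blk clin_clock clin_shift\<close>)
  let ?W = "dsum ?d (copies ?S')"
  \<comment> \<open>\<open>near_diagonal\<close> speaks of ampliations of \<open>(U', V')\<close>,
    so the multiplicity has to sit directly on them, inside the outer clock and shift.\<close>
  have s3: "near ?T (amp (clock \<omega> U')) (amp (shift d V')) ?W (clock \<omega> (amp U')) (shift d (amp V')) 0"
    by (rule near_flip[OF csub_dsum[OF S] cl'])
  have \<Phi>': "uni ?S' (dsum (?d \<times> I) UNIV) (\<lambda>f. uncur (amp \<Phi> f))"
    by (rule uni_comp[OF uni_amp[OF \<Phi>] uni_uncur[OF csub_UNIV]])
  have comm': "norm (U' (V' f) - V' (U' f)) \<le> \<delta> * norm f" if "f \<in> ?S'" for f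
    unfolding U'_def V'_def by (rule clock_shift_almost_commute[OF U V wd \<delta> comm that])
  have ne': "\<exists>v\<in>?S'. v \<noteq> 0"
  proof -
    obtain v where v: "v \<in> S" "v \<noteq> 0" using ne by blast
    have "single 0 v \<in> ?S'"
    proof (rule dsumI)
      fix k :: nat
      show "lookup (single 0 v) k \<in> S"
        using v csub_zero[OF S] by (cases "k = 0") (simp_all add: lookup_single)
      show "lookup (single 0 v) k = 0" if "k \<notin> ?d"
        using that d by (cases "k = 0") (simp_all add: lookup_single)
    qed
    moreover have "single (0::nat) v \<noteq> 0" using v by (metis lookup_single_eq lookup_zero)
    ultimately show ?thesis by blast
  qed
  have I': "countable (?d \<times> I)" using I by auto
  obtain x y :: "nat \<times> nat \<Rightarrow> complex" where xy: "\<And>p. cmod (x p) = 1" "\<And>p. cmod (y p) = 1"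
    and n: "near (copies ?S') (amp U') (amp V') (copies (dsum UNIV ?S'))
      (amp (diag x)) (amp (diag y)) (24 * sqrt \<kappa>)"
    using near_diagonal[OF U' V' comm' \<delta> \<Phi>' I' ne' N \<kappa>] by blast
  let ?D = "amp (diag x)" and ?E = "amp (diag y)"
  let ?P = "copies (dsum (UNIV :: (nat \<times> nat) set) ?S')"
  have D: "uni ?P ?P ?D" and E: "uni ?P ?P ?E"
    by (intro uni_amp uni_diag csub_dsum S xy)+
  let ?R = "dsum ?d ?P"
  have \<kappa>0: "24 * sqrt \<kappa> \<ge> 0" using \<kappa>(1) \<delta> by simp
  have s4: "near ?W (clock \<omega> (amp U')) (shift d (amp V')) ?R (clock \<omega> ?D) (shift d ?E) (24 * sqrt \<kappa>)"
    by (rule near_clock_shift[OF n \<kappa>0 wd(2)]) (simp_all add: cl' clin_blk clin_scaling)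
  have u: "uni ?R ?R (clock \<omega> ?D)" "uni ?R ?R (shift d ?E)"
    by (rule uni_clock[OF D wd(2)], rule uni_shift[OF E])
  have u0: "uni (copies S) (copies S) (amp U)" "uni (copies S) (copies S) (amp V)"
    "uni ?T ?T (amp (amp (amp U)))" "uni ?T ?T (amp (amp (amp V)))"
    "uni ?T ?T (amp (clock \<omega> U'))" "uni ?T ?T (amp (shift d V'))"
    "uni ?W ?W (clock \<omega> (amp U'))" "uni ?W ?W (shift d (amp V'))"
    by (intro uni_amp uni_clock uni_shift U V U' V' wd)+
  from near_trans[OF near_trans[OF near_trans[OF s1 s2 u0(1-4)] s3 u0(1,2,5,6)] s4 u0(1,2,7,8)]
  have "near (copies S) (amp U) (amp V) ?R (clock \<omega> ?D) (shift d ?E) (d * \<delta> + 24 * sqrt \<kappa>)" by simp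
  moreover have "clock \<omega> ?D (shift d ?E f) = \<omega> \<star> shift d ?E (clock \<omega> ?D f)" if "f \<in> ?R" for f
  proof (rule clock_shift_commute[OF uni_clin[OF D] uni_clin[OF E] wd(1) _ that])
    show "?D (?E g) = ?E (?D g)" for g :: "nat \<Rightarrow>\<^sub>0 nat \<times> nat \<Rightarrow>\<^sub>0 nat \<Rightarrow>\<^sub>0 'a"
      by (simp add: blk_blk clin_blk clin_scaling cscale_cscale mult.commute)
  qed
  ultimately show ?thesis using u by blast
qed

section \<open>Completion\<close>

definition twisted_pair_near where
  "twisted_pair_near \<omega> S U V e \<longleftrightarrow> (\<exists>U' V'. uni S S U' \<and> uni S S V' \<and>
     (\<forall>x\<in>S. U' (V' x) = \<omega> \<star> V' (U' x)) \<and>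
     (\<forall>x\<in>S. norm (U' x - U x) \<le> e * norm x \<and> norm (V' x - V x) \<le> e * norm x))"

lemma twisted_pair_near_pullback:
  assumes U: "uni S S U" and V: "uni S S V" and X: "uni R R X" and Y: "uni R R Y"
    and c: "\<And>f. f \<in> R \<Longrightarrow> X (Y f) = \<omega> \<star> Y (X f)" and n: "near S U V R X Y e"
  shows "twisted_pair_near \<omega> S U V e"
proof -
  obtain Q where Q: "uni S R Q" and QU: "\<And>x. x \<in> S \<Longrightarrow> norm (Q (U x) - X (Q x)) \<le> e * norm x"
    and QV: "\<And>x. x \<in> S \<Longrightarrow> norm (Q (V x) - Y (Q x)) \<le> e * norm x"
    using n by (auto simp: near_def)
  obtain Q' where Q': "uni R S Q'" "\<And>y. y \<in> R \<Longrightarrow> Q (Q' y) = y" "\<And>x. x \<in> S \<Longrightarrow> Q' (Q x) = x"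
    using uni_inverseE[OF Q] by blast
  have u: "uni S S (\<lambda>x. Q' (X (Q x)))" "uni S S (\<lambda>x. Q' (Y (Q x)))"
    by (rule uni_comp[OF uni_comp[OF Q X] Q'(1)], rule uni_comp[OF uni_comp[OF Q Y] Q'(1)])
  have near: "norm (Q' (Z (Q x)) - T x) \<le> e * norm x"
    if "uni S S T" "uni R R Z" "norm (Q (T x) - Z (Q x)) \<le> e * norm x" "x \<in> S" for T Z x
  proof -
    have m: "Z (Q x) \<in> R" "Q (T x) \<in> R" "T x \<in> S"
      by (simp_all add: that uni_mem[OF that(1)] uni_mem[OF that(2)] uni_mem[OF Q])
    have "Q' (Z (Q x)) - T x = Q' (Z (Q x) - Q (T x))"
      by (simp add: clin_diff[OF uni_clin[OF Q'(1)]] Q'(3)[OF m(3)])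
    also have "norm \<dots> = norm (Z (Q x) - Q (T x))"
      by (rule uni_norm[OF Q'(1) csub_diff[OF uni_dom[OF Q'(1)] m(1,2)]])
    finally show ?thesis using that(3) by (simp add: norm_minus_commute)
  qed
  have "Q' (X (Q (Q' (Y (Q x))))) = \<omega> \<star> Q' (Y (Q (Q' (X (Q x)))))" if x: "x \<in> S" for x
  proof -
    have m: "Q x \<in> R" "Y (Q x) \<in> R" "X (Q x) \<in> R"
      by (simp_all add: x uni_mem[OF Q] uni_mem[OF X] uni_mem[OF Y])
    show ?thesis by (simp add: Q'(2) m c clin_scale[OF uni_clin[OF Q'(1)]])
  qed
  then show ?thesis
    unfolding twisted_pair_near_def
    using u near[OF U X QU] near[OF V Y QV] by blast
qed

text \<open>Two unitaries differ by at most 2 in norm, so any exact twisted pair on a space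
  isomorphic to \<open>copies S\<close> will do; clock and shift with the identity as entry provide
  one. This is the fallback where the estimates do not apply.\<close>

lemma twisted_pair_near_two:
  assumes U: "uni S S U" and V: "uni S S V" and \<omega>: "prim_root d \<omega>"
  shows "twisted_pair_near \<omega> (copies S) (amp U) (amp V) 2"
proof -
  have d: "d > 0" and wd: "\<omega> ^ d = 1" "cmod \<omega> = 1"
    using \<omega> root_of_unity_cmod by (auto simp: prim_root_def)
  let ?R = "copies (dsum {..<d} S)" and ?S = "copies S"
  let ?X = "amp (clock \<omega> (\<lambda>x. x))" and ?Y = "amp (shift d (\<lambda>x. x))"
  note S = uni_dom[OF U]
  have K: "countable {..<d}" "{..<d} \<noteq> {}" using d by auto
  have X: "uni ?R ?R ?X" and Y: "uni ?R ?R ?Y"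
    by (rule uni_amp[OF uni_clock[OF uni_id[OF S] wd(2)]], rule uni_amp[OF uni_shift[OF uni_id[OF S]]])
  obtain W where W: "uni ?R ?S W"
    using flatten[OF S K] by blast
  obtain Q where Q: "uni ?S ?R Q" by (rule uni_inverseE[OF W])
  have two: "norm (Q (T x) - Z (Q x)) \<le> 2 * norm x" if "uni ?S ?S T" "uni ?R ?R Z" "x \<in> ?S" for T Z x
  proof -
    have "norm (Q (T x)) = norm x" "norm (Z (Q x)) = norm x"
      by (simp_all add: that uni_norm[OF Q] uni_norm[OF that(1)] uni_norm[OF that(2)] uni_mem[OF
          that(1)] uni_mem[OF Q])
    then show ?thesis using norm_triangle_ineq4[of "Q (T x)" "Z (Q x)"] by simp
  qed
  show ?thesis
  proof (rule twisted_pair_near_pullback[OF uni_amp[OF U] uni_amp[OF V] X Y])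
    show "near ?S (amp U) (amp V) ?R ?X ?Y 2"
      by (rule nearI[OF Q two[OF uni_amp[OF U] X] two[OF uni_amp[OF V] Y]])
    fix f assume f: "f \<in> ?R"
    show "?X (?Y f) = \<omega> \<star> ?Y (?X f)"
      by (rule poly_mapping_eqI)
        (simp add: clin_clock clin_shift clin_id clock_shift_commute[OF clin_id clin_id wd(1) refl
            dsum_mem[OF f]])
  qed
qed

lemma twisted_pair_near_mono:
  assumes "twisted_pair_near \<omega> S U V e" "\<And>x. x \<in> S \<Longrightarrow> e * norm x \<le> e' * norm x"
  shows "twisted_pair_near \<omega> S U V e'"
  using assms unfolding twisted_pair_near_def by (meson order_trans)

lemma prim_root_exists:
  assumes "\<omega> ^ m = (1::complex)" "m \<ge> 1"
  obtains d where "prim_root d \<omega>" "d \<le> m"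
proof -
  define d where "d = (LEAST k. k \<ge> 1 \<and> \<omega> ^ k = 1)"
  have "d \<ge> 1 \<and> \<omega> ^ d = 1" unfolding d_def by (rule LeastI[of _ m]) (use assms in simp)
  moreover have "d \<le> m" unfolding d_def by (rule Least_le) (use assms in simp)
  moreover have "\<omega> ^ k \<noteq> 1" if "0 < k" "k < d" for k
    using not_less_Least[of k "\<lambda>k. k \<ge> 1 \<and> \<omega> ^ k = 1"] that by (auto simp: d_def)
  ultimately show ?thesis using that by (auto simp: prim_root_def)
qed

section \<open>Orthonormal expansions in a Hilbert space\<close>

lemma scaleC_zero_left: "0 *\<^sub>C (x :: 'h::complex_hilbert_space) = 0"
  using scaleR_eq_scaleC[of 0 x] by simp

lemma scaleC_sum_right: "c *\<^sub>C sum f A = (\<Sum>a\<in>A. c *\<^sub>C (f a :: 'h::complex_hilbert_space))"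
proof (induction A rule: infinite_finite_induct)
  case empty
  show ?case using scaleC_add_right[of c "0::'h" 0] by simp
next
  case (infinite A)
  then show ?case using scaleC_add_right[of c "0::'h" 0] by simp
qed (simp add: scaleC_add_right)

lemma scaleC_sum_left: "sum f A *\<^sub>C (x :: 'h::complex_hilbert_space) = (\<Sum>a\<in>A. f a *\<^sub>C x)"
  by (induction A rule: infinite_finite_induct) (simp_all add: scaleC_zero_left scaleC_add_left)

lemma cinner_diff_left: "cinner (x - y) z = cinner x z - cinner y (z :: 'h::complex_hilbert_space)"
  using cinner_add_left[of "x - y" y z] by simp

lemma cinner_zero_left: "cinner 0 (z :: 'h::complex_hilbert_space) = 0"
  using cinner_add_left[of 0 0 z] by simp

lemma cinner_sum_left: "cinner (sum f A) (z :: 'h::complex_hilbert_space) = (\<Sum>a\<in>A. cinner (f a) z)"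
  by (induction A rule: infinite_finite_induct) (simp_all add: cinner_zero_left cinner_add_left)

lemma cinner_add_right: "cinner z (x + y) = cinner z x + cinner z (y :: 'h::complex_hilbert_space)"
  by (metis cinner_commute cinner_add_left complex_cnj_add)

lemma cinner_sum_right: "cinner z (sum f A) = (\<Sum>a\<in>A. cinner z (f a :: 'h::complex_hilbert_space))"
  by (subst cinner_commute) (simp add: cinner_sum_left cinner_commute[of z])

lemma cinner_scaleC_right: "cinner x (c *\<^sub>C y) = cnj c * cinner x (y :: 'h::complex_hilbert_space)"
  by (metis cinner_commute cinner_scaleC_left complex_cnj_mult)

lemma norm_sq_cinner: "complex_of_real ((norm x)\<^sup>2) = cinner x (x :: 'h::complex_hilbert_space)"
  by (rule cinner_self[symmetric])

lemma norm_scaleC: "norm (c *\<^sub>C (x :: 'h::complex_hilbert_space)) = cmod c * norm x"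
proof -
  have "complex_of_real ((norm (c *\<^sub>C x))\<^sup>2) = (c * cnj c) * cinner x x"
    by (simp add: norm_sq_cinner cinner_scaleC_left cinner_scaleC_right del: of_real_power)
  also have "\<dots> = complex_of_real ((cmod c * norm x)\<^sup>2)"
    by (simp add: power_mult_distrib cinner_self flip: complex_norm_square)
  finally have "(norm (c *\<^sub>C x))\<^sup>2 = (cmod c * norm x)\<^sup>2"
    by (simp only: of_real_eq_iff)
  then show ?thesis by simp
qed

context
  fixes e :: "nat \<Rightarrow> 'h::complex_hilbert_space"
  assumes e: "orthonormal_basis e"
begin

lemma cinner_basis: "cinner (e i) (e j) = (if i = j then 1 else 0)"
  using e by (simp add: orthonormal_basis_def)

lemma cinner_basis_sum:
  "finite K \<Longrightarrow> cinner (\<Sum>k\<in>K. c k *\<^sub>C e k) (e j) = (if j \<in> K then c j else 0)"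
  by (simp add: cinner_sum_left cinner_scaleC_left cinner_basis if_distrib cong: if_cong)

lemma norm_sq_basis_sum:
  assumes "finite K"
  shows "(norm (\<Sum>k\<in>K. c k *\<^sub>C e k))\<^sup>2 = (\<Sum>k\<in>K. (cmod (c k))\<^sup>2)"
proof -
  have "complex_of_real ((norm (\<Sum>k\<in>K. c k *\<^sub>C e k))\<^sup>2) = (\<Sum>k\<in>K. cnj (c k) * c k)"
    unfolding norm_sq_cinner by (subst cinner_sum_right)
      (simp add: cinner_scaleC_right cinner_basis_sum assms)
  also have "\<dots> = complex_of_real (\<Sum>k\<in>K. (cmod (c k))\<^sup>2)"
    unfolding of_real_sum complex_norm_square by (simp add: mult.commute)
  finally show ?thesis by (simp only: of_real_eq_iff)
qed

text \<open>The remainder is orthogonal to the partial sum, so the squared norms add up.\<close>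

lemma bessel:
  assumes "finite K"
  shows "(norm (x - (\<Sum>k\<in>K. cinner x (e k) *\<^sub>C e k)))\<^sup>2 = (norm x)\<^sup>2 - (\<Sum>k\<in>K. (cmod (cinner x (e k)))\<^sup>2)"
proof -
  let ?s = "\<Sum>k\<in>K. cinner x (e k) *\<^sub>C e k"
  have 1: "cinner (x - ?s) ?s = 0"
    by (subst cinner_sum_right) (simp add: cinner_scaleC_right cinner_diff_left cinner_basis_sum assms)
  have "cinner x x = cinner ((x - ?s) + ?s) ((x - ?s) + ?s)" by simp
  also have "\<dots> = cinner (x - ?s) (x - ?s) + cinner ?s ?s + (cinner (x - ?s) ?s + cnj (cinner (x
      - ?s) ?s))"
    unfolding cinner_add_left cinner_add_right by (simp add: cinner_commute[of ?s "x - ?s"])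
  finally have "complex_of_real ((norm x)\<^sup>2) = of_real ((norm (x - ?s))\<^sup>2 + (norm ?s)\<^sup>2)"
    by (simp only: 1 cinner_self of_real_add complex_cnj_zero add_0_right)
  then have "(norm x)\<^sup>2 = (norm (x - ?s))\<^sup>2 + (norm ?s)\<^sup>2" by (simp only: of_real_eq_iff)
  then show ?thesis by (simp add: norm_sq_basis_sum[OF assms])
qed

lemma cinner_basis_le: "cmod (cinner x (e k)) \<le> norm x"
proof (rule power2_le_imp_le)
  have "0 \<le> (norm x)\<^sup>2 - (\<Sum>k\<in>{k}. (cmod (cinner x (e k)))\<^sup>2)"
    unfolding bessel[symmetric, OF finite.insertI[OF finite.emptyI]] by simp
  then show "(cmod (cinner x (e k)))\<^sup>2 \<le> (norm x)\<^sup>2" by simp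
qed simp

text \<open>Bessel's inequality makes the partial sums Cauchy, completeness gives a limit
  \<open>y\<close>, and \<open>x - y\<close> is orthogonal to every basis vector, hence
  zero.\<close>

lemma basis_expansion: "(\<lambda>r. \<Sum>k<r. cinner x (e k) *\<^sub>C e k) \<longlonglongrightarrow> x"
proof -
  let ?c = "\<lambda>k. cinner x (e k)"
  let ?s = "\<lambda>r. \<Sum>k<r. ?c k *\<^sub>C e k" and ?t = "\<lambda>r. \<Sum>k<r. (cmod (?c k))\<^sup>2"
  have "?t r \<le> (norm x)\<^sup>2" for r
    using bessel[of "{..<r}" x] zero_le_power2[of "norm (x - ?s r)"] by simp
  then have "summable (\<lambda>k. (cmod (?c k))\<^sup>2)"
    by (intro summableI_nonneg_bounded[of _ "(norm x)\<^sup>2"]) auto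
  then have "convergent ?t" by (simp add: summable_iff_convergent)
  then have t: "Cauchy ?t" by (rule convergent_Cauchy)
  \<comment> \<open>By orthonormality the squared distances of the partial sums are the distances of
    the partial sums of a convergent real series.\<close>
  have d: "(dist (?s a) (?s b))\<^sup>2 = dist (?t a) (?t b)" if "a \<le> b" for a b
  proof -
    have "?s b - ?s a = (\<Sum>k\<in>{a..<b}. ?c k *\<^sub>C e k)" "?t b - ?t a = (\<Sum>k\<in>{a..<b}. (cmod (?c k))\<^sup>2)"
      using that by (simp_all add: lessThan_atLeast0 sum_diff_nat_ivl)
    then have "dist (?s b) (?s a) = norm (\<Sum>k\<in>{a..<b}. ?c k *\<^sub>C e k)"
      "dist (?t b) (?t a) = norm (\<Sum>k\<in>{a..<b}. (cmod (?c k))\<^sup>2)"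
      by (simp_all only: dist_norm)
    then show ?thesis
      by (simp add: dist_commute[of "?s a"] dist_commute[of "?t a"] norm_sq_basis_sum sum_nonneg)
  qed
  have d': "(dist (?s a) (?s b))\<^sup>2 = dist (?t a) (?t b)" for a b
    using d[of a b] d[of b a] nat_le_linear[of a b] dist_commute[of "?s a"] dist_commute[of "?t
        a"] by auto
  have "Cauchy ?s"
  proof (rule metric_CauchyI)
    fix \<epsilon> :: real assume "\<epsilon> > 0"
    then obtain M where M: "\<And>a b. a \<ge> M \<Longrightarrow> b \<ge> M \<Longrightarrow> dist (?t a) (?t b) < \<epsilon>\<^sup>2"
      using t by (metis metric_CauchyD zero_less_power)
    have "dist (?s a) (?s b) < \<epsilon>" if "a \<ge> M" "b \<ge> M" for a b
      using M[OF that] \<open>\<epsilon> > 0\<close> unfolding d'[symmetric] by (intro power2_less_imp_less[of _ \<epsilon>]) auto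
    then show "\<exists>M. \<forall>a\<ge>M. \<forall>b\<ge>M. dist (?s a) (?s b) < \<epsilon>" by blast
  qed
  then obtain y where y: "?s \<longlonglongrightarrow> y" by (auto simp: Cauchy_convergent_iff convergent_def)
  have "cinner (x - y) (e k) = 0" for k
  proof -
    have lim: "(\<lambda>r. norm (?s r - y)) \<longlonglongrightarrow> 0" using y by (simp add: LIM_zero tendsto_norm_zero)
    have le: "cmod (cinner (x - y) (e k)) \<le> norm (?s r - y)" if "r > k" for r
    proof -
      have "cinner (x - y) (e k) = cinner (?s r - y) (e k)"
        using that by (simp add: cinner_diff_left cinner_basis_sum)
      then show ?thesis using cinner_basis_le by simp
    qed
    have ev: "\<forall>\<^sub>F r in sequentially. cmod (cinner (x - y) (e k)) \<le> norm (?s r - y)"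
      by (rule eventually_mono[OF eventually_gt_at_top[of k] le])
    have "cmod (cinner (x - y) (e k)) \<le> 0"
      by (rule tendsto_lowerbound[OF lim ev]) simp
    then show ?thesis by simp
  qed
  then have "x - y = 0" using e unfolding orthonormal_basis_def by blast
  then show ?thesis using y by simp
qed

end

section \<open>Extension by continuity from finitely supported families\<close>

lemma tendsto_scaleC:
  "f \<longlonglongrightarrow> x \<Longrightarrow> (\<lambda>r. c *\<^sub>C f r) \<longlonglongrightarrow> c *\<^sub>C (x :: 'h::complex_hilbert_space)"
proof -
  assume f: "f \<longlonglongrightarrow> x"
  have d: "c *\<^sub>C a - c *\<^sub>C b = c *\<^sub>C (a - b)" for a b :: 'h
    using scaleC_add_right[of c "a - b" b] by (simp add: algebra_simps)
  have "(\<lambda>r. cmod c * norm (f r - x)) \<longlonglongrightarrow> cmod c * 0"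
    by (intro tendsto_intros tendsto_norm_zero LIM_zero f)
  then show ?thesis
    by (subst LIM_zero_iff[symmetric], subst tendsto_norm_zero_iff[symmetric]) (simp add: d norm_scaleC)
qed

text \<open>The basis index is the outer one and the coordinate in the n-fold sum the inner one, so
  that a matrix tensored with the identity becomes an \<open>amp\<close>. The expansion is truncated
  at \<open>r\<close>.\<close>

definition coeffs :: "(nat \<Rightarrow> 'h::complex_hilbert_space) \<Rightarrow> nat \<Rightarrow> 'h vec \<Rightarrow> nat \<Rightarrow> nat \<Rightarrow>\<^sub>0 (nat \<Rightarrow>\<^sub>0
    complex)" where
  "coeffs e n x r = (\<Sum>k<r. single k (\<Sum>i<n. single i (cinner (x $ i) (e k))))"

definition embed :: "(nat \<Rightarrow> 'h::complex_hilbert_space) \<Rightarrow> nat \<Rightarrow> (nat \<Rightarrow>\<^sub>0 (nat \<Rightarrow>\<^sub>0 complex)) \<Rightarrow> 'h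
    vec" where
  "embed e n f = vec n (\<lambda>i. \<Sum>k\<in>keys f. lookup (lookup f k) i *\<^sub>C e k)"

lemma lookup_sum_single:
  fixes r :: nat
  shows "lookup (\<Sum>k<r. single k (g k)) j = (if j < r then g j else (0 :: 'b::comm_monoid_add))"
proof -
  have "lookup (\<Sum>k<r. single k (g k)) j = (\<Sum>k<r. if k = j then g k else 0)"
    unfolding Poly_Mapping.lookup_sum by (rule sum.cong) (simp_all add: lookup_single when_def)
  also have "\<dots> = (if j \<in> {..<r} then g j else 0)"
    by (rule sum.delta) simp
  finally show ?thesis by (simp only: lessThan_iff)
qed

lemma lookup_coeffs:
  "lookup (lookup (coeffs e n x r) k) i = (if k < r \<and> i < n then cinner (x $ i) (e k) else 0)"
  unfolding coeffs_def lookup_sum_single by (cases "k < r")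
      (simp_all only: lookup_sum_single lookup_zero if_True if_False simp_thms)

definition fin_vecs :: "nat \<Rightarrow> (nat \<Rightarrow>\<^sub>0 complex) set" where
  "fin_vecs n = dsum {..<n} UNIV"

definition dense_vecs :: "nat \<Rightarrow> (nat \<Rightarrow>\<^sub>0 nat \<Rightarrow>\<^sub>0 complex) set" where
  "dense_vecs n = dsum UNIV (fin_vecs n)"

lemma csub_dense: "csub (dense_vecs n)"
  by (simp add: dense_vecs_def fin_vecs_def csub_dsum csub_UNIV)

lemma coeffs_dense: "coeffs e n x r \<in> dense_vecs n"
  unfolding dense_vecs_def fin_vecs_def by (intro dsumI) (auto simp: lookup_coeffs)

lemma embed_carrier [simp]: "embed e n f \<in> carrier_vec n" "dim_vec (embed e n f) = n"
  by (simp_all add: embed_def)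

lemma embed_index:
  assumes "finite K" "\<And>k. k \<notin> K \<Longrightarrow> lookup (lookup f k) i = 0" "i < n"
  shows "embed e n f $ i = (\<Sum>k\<in>K. lookup (lookup f k) i *\<^sub>C e k)"
proof -
  have "(\<Sum>k\<in>keys f. lookup (lookup f k) i *\<^sub>C e k) = (\<Sum>k\<in>keys f \<union> K. lookup (lookup f k) i *\<^sub>C e k)"
    by (rule sum.mono_neutral_left) (auto simp: assms in_keys_iff scaleC_zero_left)
  also have "\<dots> = (\<Sum>k\<in>K. lookup (lookup f k) i *\<^sub>C e k)"
    by (rule sum.mono_neutral_right) (auto simp: assms scaleC_zero_left)
  finally show ?thesis using assms(3) by (simp add: embed_def)
qed

lemma embed_add: "i < n \<Longrightarrow> embed e n (f + g) $ i = embed e n f $ i + embed e n g $ i"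
  by (subst (1 2 3) embed_index[of "keys f \<union> keys g"])
    (auto simp: in_keys_iff scaleC_add_left sum.distrib)

lemma embed_scale: "i < n \<Longrightarrow> embed e n (c \<star> f) $ i = c *\<^sub>C embed e n f $ i"
  by (subst (1 2) embed_index[of "keys f"])
    (auto simp: in_keys_iff cscale_complex_def scaleC_scaleC scaleC_sum_right)

lemma embed_diff: "i < n \<Longrightarrow> embed e n (f - g) $ i = embed e n f $ i - embed e n g $ i"
  using embed_add[of i n e "f - g" g] by simp

text \<open>Approximating sequences take the place of a completion. With finitely many coordinates,
  convergence in each of them amounts to convergence in norm.\<close>

definition emb_lim :: "(nat \<Rightarrow> 'h::complex_hilbert_space) \<Rightarrow> nat \<Rightarrow> (nat \<Rightarrow> nat \<Rightarrow>\<^sub>0 (nat \<Rightarrow>\<^sub>0 complex))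
    \<Rightarrow> 'h vec \<Rightarrow> bool" where
  "emb_lim e n f x \<longleftrightarrow> (\<forall>r. f r \<in> dense_vecs n) \<and> x \<in> carrier_vec n \<and>
     (\<forall>i<n. (\<lambda>r. embed e n (f r) $ i) \<longlonglongrightarrow> x $ i)"

lemma
  assumes "emb_lim e n f x"
  shows emb_lim_dense: "f r \<in> dense_vecs n" and emb_lim_carrier: "x \<in> carrier_vec n"
    and emb_lim_index: "i < n \<Longrightarrow> (\<lambda>r. embed e n (f r) $ i) \<longlonglongrightarrow> x $ i"
  using assms by (simp_all add: emb_lim_def)

lemma emb_limI:
  assumes "\<And>r. f r \<in> dense_vecs n" "x \<in> carrier_vec n" "\<And>i. i < n \<Longrightarrow> (\<lambda>r. embed e n (f r) $ i) \<longlonglongrightarrow> x $ i"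
  shows "emb_lim e n f x"
  using assms by (simp add: emb_lim_def)

lemma emb_lim_add:
  assumes "emb_lim e n f x" "emb_lim e n g y"
  shows "emb_lim e n (\<lambda>r. f r + g r) (x + y)"
  using emb_lim_carrier[OF assms(1)] emb_lim_carrier[OF assms(2)]
  by (intro emb_limI) (auto simp: embed_add csub_add[OF csub_dense] emb_lim_dense[OF assms(1)]
      emb_lim_dense[OF assms(2)] intro!: tendsto_add emb_lim_index[OF assms(1)] emb_lim_index[OF
          assms(2)])

lemma emb_lim_diff:
  assumes "emb_lim e n f x" "emb_lim e n g y"
  shows "emb_lim e n (\<lambda>r. f r - g r) (x - y)"
  using emb_lim_carrier[OF assms(1)] emb_lim_carrier[OF assms(2)]
  by (intro emb_limI) (auto simp: embed_diff csub_diff[OF csub_dense] emb_lim_dense[OF assms(1)]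
      emb_lim_dense[OF assms(2)] intro!: tendsto_diff emb_lim_index[OF assms(1)] emb_lim_index[OF
          assms(2)])

lemma emb_lim_scale:
  assumes "emb_lim e n f x"
  shows "emb_lim e n (\<lambda>r. c \<star> f r) (map_vec (scaleC c) x)"
  using emb_lim_carrier[OF assms]
  by (intro emb_limI) (auto simp: embed_scale csub_scale[OF csub_dense] emb_lim_dense[OF assms]
      intro!: tendsto_scaleC emb_lim_index[OF assms])

lemma emb_lim_unique: "emb_lim e n f x \<Longrightarrow> emb_lim e n f y \<Longrightarrow> x = y"
  unfolding emb_lim_def by (intro eq_vecI) (metis LIMSEQ_unique carrier_vecD, metis carrier_vecD)

context
  fixes e :: "nat \<Rightarrow> 'h::complex_hilbert_space" and n :: nat
  assumes e: "orthonormal_basis e"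
begin

lemma norm_sq_embed:
  assumes f: "f \<in> dense_vecs n"
  shows "(norm f)\<^sup>2 = (\<Sum>i<n. (norm (embed e n f $ i))\<^sup>2)"
proof -
  have "(norm f)\<^sup>2 = (\<Sum>k\<in>keys f. (norm (lookup f k))\<^sup>2)"
    by (rule norm_sq_poly_mapping) (auto simp: in_keys_iff)
  also have "\<dots> = (\<Sum>k\<in>keys f. \<Sum>i<n. (cmod (lookup (lookup f k) i))\<^sup>2)"
    using f unfolding dense_vecs_def fin_vecs_def
    by (intro sum.cong refl norm_sq_poly_mapping) (auto dest: dsum_mem[of f _ _] simp: dsum_def)
  also have "\<dots> = (\<Sum>i<n. \<Sum>k\<in>keys f. (cmod (lookup (lookup f k) i))\<^sup>2)"
    by (rule sum.swap)
  also have "\<dots> = (\<Sum>i<n. (norm (embed e n f $ i))\<^sup>2)"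
    by (intro sum.cong refl) (simp add: embed_def norm_sq_basis_sum[OF e])
  finally show ?thesis .
qed

lemma norm_embed: "f \<in> dense_vecs n \<Longrightarrow> norm f = l2norm_vec (embed e n f)"
  by (simp add: l2norm_vec_def norm_sq_embed[symmetric])

lemma norm_embed_index_le: "f \<in> dense_vecs n \<Longrightarrow> i < n \<Longrightarrow> norm (embed e n f $ i) \<le> norm f"
  by (rule power2_le_imp_le)
    (simp_all add: norm_sq_embed member_le_sum[of i "{..<n}" "\<lambda>i. (norm (embed e n f $ i))\<^sup>2"])

lemma emb_lim_coeffs:
  assumes x: "x \<in> carrier_vec n"
  shows "emb_lim e n (coeffs e n x) x"
proof (rule emb_limI[OF coeffs_dense x])
  fix i assume i: "i < n"
  have "embed e n (coeffs e n x r) $ i = (\<Sum>k<r. cinner (x $ i) (e k) *\<^sub>C e k)" for r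
    by (subst embed_index[of "{..<r}"]) (auto simp: lookup_coeffs i)
  then show "(\<lambda>r. embed e n (coeffs e n x r) $ i) \<longlonglongrightarrow> x $ i"
    using basis_expansion[OF e] by simp
qed

lemma emb_lim_norm:
  assumes "emb_lim e n f x"
  shows "(\<lambda>r. norm (f r)) \<longlonglongrightarrow> l2norm_vec x"
proof -
  have d: "dim_vec x = n" using emb_lim_carrier[OF assms] by simp
  have "(\<lambda>r. l2norm_vec (embed e n (f r))) \<longlonglongrightarrow> l2norm_vec x"
    unfolding l2norm_vec_def embed_carrier d
    by (intro tendsto_real_sqrt tendsto_sum tendsto_power tendsto_norm emb_lim_index[OF assms]) simp
  then show ?thesis by (simp only: norm_embed[OF emb_lim_dense[OF assms]])
qed

text \<open>The norm of a difference is at most the sum of the norms of its \<open>n\<close>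
  coordinates, each of which converges.\<close>

lemma emb_lim_Cauchy:
  assumes "emb_lim e n f x"
  shows "Cauchy f"
proof (rule metric_CauchyI)
  fix \<epsilon> :: real assume \<epsilon>: "\<epsilon> > 0"
  define h where "h r = (\<Sum>i<n. dist (embed e n (f r) $ i) (x $ i))" for r
  have "h \<longlonglongrightarrow> (\<Sum>i<n. 0)"
    unfolding h_def by (intro tendsto_sum) (rule tendsto_dist_iff[THEN iffD1, OF emb_lim_index[OF
        assms]], simp)
  then have "\<forall>\<^sub>F r in sequentially. h r < \<epsilon> / 2" using \<epsilon> by (intro order_tendstoD) auto
  then obtain M where M: "\<And>r. r \<ge> M \<Longrightarrow> h r < \<epsilon> / 2" by (auto simp: eventually_sequentially)
  have "dist (f r) (f s) < \<epsilon>" if "r \<ge> M" "s \<ge> M" for r s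
  proof -
    have m: "f r - f s \<in> dense_vecs n"
      by (intro csub_diff csub_dense emb_lim_dense[OF assms])
    have "dist (f r) (f s) = L2_set (\<lambda>i. norm (embed e n (f r - f s) $ i)) {..<n}"
      by (simp add: dist_norm norm_embed[OF m] l2norm_vec_def L2_set_def)
    also have "\<dots> \<le> (\<Sum>i<n. norm (embed e n (f r - f s) $ i))"
      by (rule L2_set_le_sum) simp
    also have "\<dots> \<le> (\<Sum>i<n. dist (embed e n (f r) $ i) (x $ i) + dist (embed e n (f s) $ i) (x $ i))"
      by (intro sum_mono) (simp add: embed_diff dist_triangle2 flip: dist_norm)
    also have "\<dots> = h r + h s" by (simp add: h_def sum.distrib)
    also have "\<dots> < \<epsilon>" using M[OF that(1)] M[OF that(2)] by simp
    finally show ?thesis .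
  qed
  then show "\<exists>M. \<forall>r\<ge>M. \<forall>s\<ge>M. dist (f r) (f s) < \<epsilon>" by blast
qed

text \<open>The limit is taken along the truncated expansions of \<open>x\<close>;
  \<open>emb_lim_extend\<close> shows that every approximating sequence gives the same
  value.\<close>

definition extend :: "((nat \<Rightarrow>\<^sub>0 nat \<Rightarrow>\<^sub>0 complex) \<Rightarrow> nat \<Rightarrow>\<^sub>0 nat \<Rightarrow>\<^sub>0 complex) \<Rightarrow> 'h vec \<Rightarrow> 'h vec" where
  "extend T x = vec n (\<lambda>i. lim (\<lambda>r. embed e n (T (coeffs e n x r)) $ i))"

text \<open>An isometry preserves Cauchy sequences and sends sequences with vanishing difference to
  such sequences. The algebraic properties of \<open>extend T\<close> all follow from this by
  uniqueness of limits.\<close>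

lemma emb_lim_extend:
  assumes T: "uni (dense_vecs n) (dense_vecs n) T" and f: "emb_lim e n f x"
  shows "emb_lim e n (\<lambda>r. T (f r)) (extend T x)"
proof -
  let ?c = "coeffs e n x"
  have c: "emb_lim e n ?c x" by (rule emb_lim_coeffs[OF emb_lim_carrier[OF f]])
  have Td: "T (?c r) \<in> dense_vecs n" for r by (rule uni_mem[OF T coeffs_dense])
  have iso: "norm (T (g - h)) = norm (g - h)" if "g \<in> dense_vecs n" "h \<in> dense_vecs n" for g h
    by (rule uni_norm[OF T csub_diff[OF csub_dense that]])
  have cc: "emb_lim e n (\<lambda>r. T (?c r)) (extend T x)"
  proof (rule emb_limI[OF Td])
    fix i assume i: "i < n"
    have "Cauchy (\<lambda>r. embed e n (T (?c r)) $ i)"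
    proof (rule metric_CauchyI)
      fix \<epsilon> :: real assume "\<epsilon> > 0"
      then obtain M where M: "\<And>r s. r \<ge> M \<Longrightarrow> s \<ge> M \<Longrightarrow> dist (?c r) (?c s) < \<epsilon>"
        using emb_lim_Cauchy[OF c] by (metis metric_CauchyD)
      have "dist (embed e n (T (?c r)) $ i) (embed e n (T (?c s)) $ i) \<le> dist (?c r) (?c s)" for r s
        using norm_embed_index_le[OF csub_diff[OF csub_dense Td Td] i, of r s] iso[OF
            coeffs_dense[of e n x r] coeffs_dense[of e n x s]]
        by (simp add: dist_norm embed_diff[OF i] clin_diff[OF uni_clin[OF T]])
      then show "\<exists>M. \<forall>r\<ge>M. \<forall>s\<ge>M. dist (embed e n (T (?c r)) $ i) (embed e n (T (?c s)) $ i) < \<epsilon>"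
        using M by (meson le_less_trans)
    qed
    then have "(\<lambda>r. embed e n (T (?c r)) $ i) \<longlonglongrightarrow> lim (\<lambda>r. embed e n (T (?c r)) $ i)"
      by (intro convergent_LIMSEQ_iff[THEN iffD1] Cauchy_convergent)
    then show "(\<lambda>r. embed e n (T (?c r)) $ i) \<longlonglongrightarrow> extend T x $ i"
      using i by (simp add: extend_def)
  qed (simp add: extend_def)
  show ?thesis
  proof (rule emb_limI)
    show Tf: "T (f r) \<in> dense_vecs n" for r by (rule uni_mem[OF T emb_lim_dense[OF f]])
    show "extend T x \<in> carrier_vec n" by (rule emb_lim_carrier[OF cc])
    fix i assume i: "i < n"
    have "(\<lambda>r. norm (f r - ?c r)) \<longlonglongrightarrow> l2norm_vec (x - x)"
      by (rule emb_lim_norm[OF emb_lim_diff[OF f c]])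
    moreover have "l2norm_vec (x - x) = 0" by (simp add: l2norm_vec_def)
    ultimately have lim: "(\<lambda>r. norm (f r - ?c r)) \<longlonglongrightarrow> 0" by simp
    have le: "norm (embed e n (T (f r)) $ i - embed e n (T (?c r)) $ i) \<le> norm (f r - ?c r)" for r
      using norm_embed_index_le[OF csub_diff[OF csub_dense Tf Td] i, of r r] iso[OF
          emb_lim_dense[OF f] coeffs_dense[of e n x r]]
      by (simp add: embed_diff[OF i] clin_diff[OF uni_clin[OF T]])
    have "(\<lambda>r. embed e n (T (f r)) $ i - embed e n (T (?c r)) $ i) \<longlonglongrightarrow> 0"
      by (rule tendsto_0_le[OF lim, where K = 1]) (simp add: le always_eventually)
    from tendsto_add[OF this emb_lim_index[OF cc i]]
    show "(\<lambda>r. embed e n (T (f r)) $ i) \<longlonglongrightarrow> extend T x $ i" by simp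
  qed
qed

lemma extend_add:
  assumes T: "uni (dense_vecs n) (dense_vecs n) T" and "x \<in> carrier_vec n" "y \<in> carrier_vec n"
  shows "extend T (x + y) = extend T x + extend T y"
proof -
  note c = emb_lim_coeffs[OF assms(2)] emb_lim_coeffs[OF assms(3)]
  show ?thesis
    using emb_lim_extend[OF T emb_lim_add[OF c]] emb_lim_add[OF emb_lim_extend[OF T c(1)]
        emb_lim_extend[OF T c(2)]]
    unfolding clin_add[OF uni_clin[OF T]] by (rule emb_lim_unique)
qed

lemma extend_scale:
  assumes T: "uni (dense_vecs n) (dense_vecs n) T" and "x \<in> carrier_vec n"
  shows "extend T (map_vec (scaleC c) x) = map_vec (scaleC c) (extend T x)"
proof -
  note c = emb_lim_coeffs[OF assms(2)]
  show ?thesis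
    using emb_lim_extend[OF T emb_lim_scale[OF c]] emb_lim_scale[OF emb_lim_extend[OF T c]]
    unfolding clin_scale[OF uni_clin[OF T]] by (rule emb_lim_unique)
qed

lemma extend_carrier: "extend T x \<in> carrier_vec n"
  by (simp add: extend_def)

lemma extend_norm:
  assumes T: "uni (dense_vecs n) (dense_vecs n) T" and "x \<in> carrier_vec n"
  shows "l2norm_vec (extend T x) = l2norm_vec x"
proof -
  note c = emb_lim_coeffs[OF assms(2)]
  show ?thesis
    using emb_lim_norm[OF emb_lim_extend[OF T c]] emb_lim_norm[OF c]
    unfolding uni_norm[OF T coeffs_dense] by (rule LIMSEQ_unique)
qed

lemma emb_lim_extend_extend:
  assumes "uni (dense_vecs n) (dense_vecs n) T" "uni (dense_vecs n) (dense_vecs n) T'" "x \<in>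
      carrier_vec n"
  shows "emb_lim e n (\<lambda>r. T (T' (coeffs e n x r))) (extend T (extend T' x))"
  by (rule emb_lim_extend[OF assms(1) emb_lim_extend[OF assms(2) emb_lim_coeffs[OF assms(3)]]])

lemma extend_inverse:
  assumes T: "uni (dense_vecs n) (dense_vecs n) T" "uni (dense_vecs n) (dense_vecs n) T'"
    and "\<And>f. f \<in> dense_vecs n \<Longrightarrow> T (T' f) = f" and x: "x \<in> carrier_vec n"
  shows "extend T (extend T' x) = x"
  using emb_lim_extend_extend[OF T x] emb_lim_coeffs[OF x]
  unfolding assms(3)[OF coeffs_dense] by (rule emb_lim_unique)

lemma bounded_op_extend: "uni (dense_vecs n) (dense_vecs n) T \<Longrightarrow> bounded_op n (extend T)"
  unfolding bounded_op_def
  by (intro conjI ballI allI exI[of _ 1]) (simp_all add: extend_carrier extend_add extend_scale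
      extend_norm)

text \<open>With inner products expressed by norms, isometry and linearity of
  \<open>extend T\<close> give its adjoint. The form is antilinear in the second argument, so
  scaling that argument by \<i> turns the imaginary part into a real part.\<close>

lemma cinner_vec_polarization:
  fixes x y :: "'h vec"
  assumes "x \<in> carrier_vec n" "y \<in> carrier_vec n"
  shows "Re (cinner_vec x y) = ((l2norm_vec (x + y))\<^sup>2 - (l2norm_vec x)\<^sup>2 - (l2norm_vec y)\<^sup>2) / 2"
    and "Im (cinner_vec x y) = Re (cinner_vec x (map_vec (scaleC \<i>) y))"
proof -
  have p: "Re (cinner a b) = ((norm (a + b))\<^sup>2 - (norm a)\<^sup>2 - (norm b)\<^sup>2) / 2" for a b :: 'h
  proof -
    have "complex_of_real ((norm (a + b))\<^sup>2) = of_real ((norm a)\<^sup>2) + of_real ((norm b)\<^sup>2) +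
        (cinner a b + cnj (cinner a b))"
      unfolding norm_sq_cinner cinner_add_left cinner_add_right by (simp add: cinner_commute[of b a])
    then have "(norm (a + b))\<^sup>2 = (norm a)\<^sup>2 + (norm b)\<^sup>2 + 2 * Re (cinner a b)"
      unfolding complex_eq_iff by simp
    then show ?thesis by simp
  qed
  have sq: "(l2norm_vec z)\<^sup>2 = (\<Sum>i<n. (norm (z $ i))\<^sup>2)" if "z \<in> carrier_vec n" for z :: "'h vec"
    using that by (simp add: l2norm_vec_def sum_nonneg)
  show "Re (cinner_vec x y) = ((l2norm_vec (x + y))\<^sup>2 - (l2norm_vec x)\<^sup>2 - (l2norm_vec y)\<^sup>2) / 2"
    using assms by (simp add: sq cinner_vec_def p sum_subtractf flip: sum_divide_distrib)
  show "Im (cinner_vec x y) = Re (cinner_vec x (map_vec (scaleC \<i>) y))"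
    using assms by (simp add: cinner_vec_def cinner_scaleC_right)
qed

text \<open>The extension of the inverse serves as the adjoint: write \<open>y\<close> as
  \<open>extend T (extend T' y)\<close> and use that \<open>extend T\<close> preserves inner
  products.\<close>

lemma unitary_op_extend:
  assumes T: "uni (dense_vecs n) (dense_vecs n) T"
  shows "unitary_op n (extend T)"
proof -
  obtain T' where T': "uni (dense_vecs n) (dense_vecs n) T'"
    "\<And>f. f \<in> dense_vecs n \<Longrightarrow> T (T' f) = f" "\<And>f. f \<in> dense_vecs n \<Longrightarrow> T' (T f) = f"
    using uni_inverseE[OF T] by blast
  have re: "Re (cinner_vec (extend T x) (extend T y)) = Re (cinner_vec x y)"
    if "x \<in> carrier_vec n" "y \<in> carrier_vec n" for x y
    using that by (simp add: cinner_vec_polarization(1) extend_carrier extend_norm[OF T] flip: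
        extend_add[OF T])
  have iso: "cinner_vec (extend T x) (extend T y) = cinner_vec x y"
    if "x \<in> carrier_vec n" "y \<in> carrier_vec n" for x y
    using that re by (intro complex_eqI)
      (simp_all add: cinner_vec_polarization(2) extend_carrier flip: extend_scale[OF T])
  have "is_adjoint n (extend T) (extend T')"
    unfolding is_adjoint_def
  proof (intro ballI)
    fix x y :: "'h vec" assume xy: "x \<in> carrier_vec n" "y \<in> carrier_vec n"
    show "cinner_vec (extend T x) y = cinner_vec x (extend T' y)"
      using iso[OF xy(1) extend_carrier[of T' y]] extend_inverse[OF T T'(1,2) xy(2)] by simp
  qed
  then show ?thesis
    unfolding unitary_op_def
    using bounded_op_extend[OF T] bounded_op_extend[OF T'(1)] extend_inverse[OF T T'(1,2)]
      extend_inverse[OF T'(1) T T'(3)] by blast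
qed

end

section \<open>Matrices\<close>

definition matop :: "nat \<Rightarrow> complex mat \<Rightarrow> (nat \<Rightarrow>\<^sub>0 complex) \<Rightarrow> nat \<Rightarrow>\<^sub>0 complex" where
  "matop n A f = (\<Sum>i<n. single i (\<Sum>j<n. A $$ (i, j) * lookup f j))"

lemma lookup_matop: "lookup (matop n A f) i = (if i < n then \<Sum>j<n. A $$ (i, j) * lookup f j else 0)"
  unfolding matop_def by (rule lookup_sum_single)

lemma clin_matop: "clin (matop n A)"
  by (rule clinI; rule poly_mapping_eqI)
    (simp_all add: lookup_matop distrib_left sum.distrib cscale_complex_def sum_distrib_left mult_ac)

lemma matop_fin_vecs: "matop n A f \<in> fin_vecs n"
  unfolding fin_vecs_def by (rule dsumI) (simp_all add: lookup_matop)

lemma csub_fin_vecs: "csub (fin_vecs n)"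
  by (simp add: fin_vecs_def csub_dsum csub_UNIV)

lemma fin_vecs_zero: "f \<in> fin_vecs n \<Longrightarrow> i \<ge> n \<Longrightarrow> lookup f i = 0"
  by (simp add: fin_vecs_def dsum_zero)

lemma matop_mult:
  assumes "A \<in> carrier_mat n n" "B \<in> carrier_mat n n"
  shows "matop n (A * B) f = matop n A (matop n B f)"
proof (rule poly_mapping_eqI)
  fix i
  have "(\<Sum>j<n. (A * B) $$ (i, j) * lookup f j) = (\<Sum>k<n. A $$ (i, k) * (\<Sum>j<n. B $$ (k, j) * lookup f j))"
    if "i < n"
  proof -
    have "(\<Sum>j<n. (A * B) $$ (i, j) * lookup f j) = (\<Sum>j<n. \<Sum>k<n. A $$ (i, k) * (B $$ (k, j) *
        lookup f j))"
      using assms that by (intro sum.cong refl)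
        (simp add: scalar_prod_def sum_distrib_right lessThan_atLeast0 mult.assoc)
    also have "\<dots> = (\<Sum>k<n. \<Sum>j<n. A $$ (i, k) * (B $$ (k, j) * lookup f j))"
      by (rule sum.swap)
    finally show ?thesis by (simp add: sum_distrib_left)
  qed
  then show "lookup (matop n (A * B) f) i = lookup (matop n A (matop n B f)) i"
    by (simp add: lookup_matop)
qed

lemma matop_one: "f \<in> fin_vecs n \<Longrightarrow> matop n (1\<^sub>m n) f = f"
proof (rule poly_mapping_eqI)
  fix i assume f: "f \<in> fin_vecs n"
  have "(\<Sum>j<n. 1\<^sub>m n $$ (i, j) * lookup f j) = (\<Sum>j<n. if j = i then lookup f j else 0)" if "i < n"
    using that by (intro sum.cong) auto
  then show "lookup (matop n (1\<^sub>m n) f) i = lookup f i"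
    by (simp add: lookup_matop fin_vecs_zero[OF f])
qed

lemma mat_adjoint_index:
  assumes "A \<in> carrier_mat n n" "i < n" "j < n"
  shows "mat_adjoint A $$ (i, j) = cnj (A $$ (j, i))"
  using assms by (simp add: mat_adjoint_def mat_of_rows_def conjugate_complex_def)

lemma mat_adjoint_carrier: "A \<in> carrier_mat n n \<Longrightarrow> mat_adjoint A \<in> carrier_mat n n"
  by (auto simp: mat_adjoint_def mat_of_rows_def)

lemma inner_fin_vecs:
  assumes "f \<in> fin_vecs n"
  shows "inner f g = (\<Sum>i<n. inner (lookup f i) (lookup g i))"
  by (rule inner_poly_mapping_eq) (use fin_vecs_zero[OF assms] in \<open>auto simp: in_keys_iff
      not_le[symmetric]\<close>)

lemma inner_matop:
  assumes A: "A \<in> carrier_mat n n" and f: "f \<in> fin_vecs n"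
  shows "inner (matop n A f) g = inner f (matop n (mat_adjoint A) g)"
proof -
  have c: "inner (a * b) c = inner b (cnj a * c)" for a b c :: complex
    using inner_cscale_left[of a b c] by (simp add: cscale_complex_def)
  have "inner (matop n A f) g = (\<Sum>i<n. \<Sum>j<n. inner (lookup f j) (cnj (A $$ (i, j)) * lookup g i))"
    by (simp add: inner_fin_vecs[OF matop_fin_vecs] lookup_matop inner_sum_left c)
  also have "\<dots> = (\<Sum>j<n. \<Sum>i<n. inner (lookup f j) (cnj (A $$ (i, j)) * lookup g i))"
    by (rule sum.swap)
  also have "\<dots> = inner f (matop n (mat_adjoint A) g)"
    by (simp add: inner_fin_vecs[OF f] lookup_matop inner_sum_right mat_adjoint_index[OF A])
  finally show ?thesis .
qed

lemma uni_matop: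
  assumes "unitary_mat n U"
  shows "uni (fin_vecs n) (fin_vecs n) (matop n U)"
proof -
  have U: "U \<in> carrier_mat n n" "mat_adjoint U * U = 1\<^sub>m n" "U * mat_adjoint U = 1\<^sub>m n"
    using assms by (auto simp: unitary_mat_def)
  note U' = mat_adjoint_carrier[OF U(1)]
  have inv: "matop n (mat_adjoint U) (matop n U f) = f" "matop n U (matop n (mat_adjoint U) f) = f"
    if "f \<in> fin_vecs n" for f
    by (simp_all add: matop_mult[OF U' U(1), symmetric] matop_mult[OF U(1) U', symmetric] U
        matop_one that)
  show ?thesis
  proof (rule uniI[where T' = "matop n (mat_adjoint U)"])
    fix f assume f: "f \<in> fin_vecs n"
    show "norm (matop n U f) = norm f"
      using inner_matop[OF U(1) f, of "matop n U f"] by (simp add: inv f norm_eq_sqrt_inner)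
  qed (simp_all add: csub_fin_vecs clin_matop matop_fin_vecs inv)
qed

section \<open>Comparison with vectors and with the norm of matrices\<close>

definition vec_fam :: "nat \<Rightarrow> complex vec \<Rightarrow> nat \<Rightarrow>\<^sub>0 complex" where
  "vec_fam n v = (\<Sum>i<n. single i (v $ i))"

lemma lookup_vec_fam: "lookup (vec_fam n v) i = (if i < n then v $ i else 0)"
  unfolding vec_fam_def by (rule lookup_sum_single)

lemma vec_fam_mem: "vec_fam n v \<in> fin_vecs n"
  unfolding fin_vecs_def by (rule dsumI) (simp_all add: lookup_vec_fam)

lemma norm_sq_fin_vecs: "f \<in> fin_vecs n \<Longrightarrow> (norm f)\<^sup>2 = (\<Sum>i<n. (cmod (lookup f i))\<^sup>2)"
  by (rule norm_sq_poly_mapping) (auto simp: fin_vecs_zero)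

lemma norm_vec_fam: "v \<in> carrier_vec n \<Longrightarrow> norm (vec_fam n v) = l2norm_vec v"
  using norm_sq_fin_vecs[OF vec_fam_mem, of n v]
  by (simp add: l2norm_vec_def lookup_vec_fam real_sqrt_unique)

lemma matop_vec_fam:
  assumes "A \<in> carrier_mat n n" "v \<in> carrier_vec n"
  shows "matop n A (vec_fam n v) = vec_fam n (A *\<^sub>v v)"
  using assms
  by (intro poly_mapping_eqI) (simp add: lookup_matop lookup_vec_fam scalar_prod_def lessThan_atLeast0)

text \<open>\<open>mat_norm\<close> is a supremum of reals, informative only over a bounded set; the
  a priori bound \<open>K\<close> supplies the boundedness.\<close>

lemma mat_norm_bound:
  assumes A: "A \<in> carrier_mat n n" and K: "\<And>f. f \<in> fin_vecs n \<Longrightarrow> norm (matop n A f) \<le> K * norm f"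
  shows "f \<in> fin_vecs n \<Longrightarrow> norm (matop n A f) \<le> mat_norm A * norm f" and "mat_norm A \<ge> 0"
proof -
  let ?g = "\<lambda>v. l2norm_vec (A *\<^sub>v v) / l2norm_vec v"
  have g: "?g v = norm (matop n A (vec_fam n v)) / norm (vec_fam n v)" if "v \<in> carrier_vec n" for v
    using A that by (simp add: matop_vec_fam norm_vec_fam)
  have "?g v \<le> max K 0" if "v \<in> carrier_vec n" for v
  proof -
    have "norm (matop n A (vec_fam n v)) \<le> max K 0 * norm (vec_fam n v)"
      by (rule order_trans[OF K[OF vec_fam_mem]]) (simp add: mult_right_mono)
    then show ?thesis
      unfolding g[OF that] by (cases "vec_fam n v = 0") (simp_all add: divide_le_eq)
  qed
  then have bdd: "bdd_above (?g ` carrier_vec n)" by (intro bdd_aboveI2)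
  have mn: "mat_norm A = (SUP v\<in>carrier_vec n. ?g v)"
    using A by (simp add: mat_norm_def op_norm_def)
  have le: "?g v \<le> mat_norm A" if "v \<in> carrier_vec n" for v
    unfolding mn by (rule cSUP_upper[OF that bdd])
  have "0 \<le> ?g (0\<^sub>v n)" by (simp add: l2norm_vec_def sum_nonneg)
  also have "\<dots> \<le> mat_norm A" by (rule le) simp
  finally show "mat_norm A \<ge> 0" .
  assume f: "f \<in> fin_vecs n"
  define v where "v = vec n (lookup f)"
  have v: "v \<in> carrier_vec n" "vec_fam n v = f"
    by (auto simp: v_def lookup_vec_fam fin_vecs_zero[OF f] intro!: poly_mapping_eqI)
  show "norm (matop n A f) \<le> mat_norm A * norm f"
  proof (cases "f = 0")
    case True
    then show ?thesis by (simp add: clin_zero[OF clin_matop])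
  next
    case False
    then show ?thesis using le[OF v(1)] unfolding g[OF v(1)] v(2) by (simp add: divide_le_eq)
  qed
qed

lemma matop_twisted_commutator:
  assumes U: "U \<in> carrier_mat n n" and V: "V \<in> carrier_mat n n"
  shows "matop n (U * V - \<omega> \<cdot>\<^sub>m (V * U)) f = matop n U (matop n V f) - \<omega> \<star> matop n V (matop n U f)"
proof -
  have "matop n (U * V - \<omega> \<cdot>\<^sub>m (V * U)) f = matop n (U * V) f - \<omega> \<star> matop n (V * U) f"
  proof (rule poly_mapping_eqI)
    fix i
    have "(\<Sum>j<n. (U * V - \<omega> \<cdot>\<^sub>m (V * U)) $$ (i, j) * lookup f j)
        = (\<Sum>j<n. (U * V) $$ (i, j) * lookup f j) - \<omega> * (\<Sum>j<n. (V * U) $$ (i, j) * lookup f j)" if "i < n"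
    proof -
      have "(U * V - \<omega> \<cdot>\<^sub>m (V * U)) $$ (i, j) = (U * V) $$ (i, j) - \<omega> * (V * U) $$ (i, j)"
          if "j < n" for j
        using U V \<open>i < n\<close> that by simp
      then show ?thesis
        by (simp add: left_diff_distrib sum_subtractf sum_distrib_left mult.assoc)
    qed
    then show "lookup (matop n (U * V - \<omega> \<cdot>\<^sub>m (V * U)) f) i = lookup (matop n (U * V) f
        - \<omega> \<star> matop n (V * U) f) i"
      by (simp add: lookup_matop cscale_complex_def)
  qed
  then show ?thesis by (simp add: matop_mult U V)
qed

lemma twisted_commutator_bound:
  assumes U: "unitary_mat n U" and V: "unitary_mat n V" and \<omega>: "cmod \<omega> = 1"
  defines "\<delta> \<equiv> mat_norm (U * V - \<omega> \<cdot>\<^sub>m (V * U))"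
  shows "\<delta> \<ge> 0"
    and "f \<in> fin_vecs n \<Longrightarrow> norm (matop n U (matop n V f) - \<omega> \<star> matop n V (matop n U f)) \<le> \<delta> * norm f"
proof -
  have c: "U \<in> carrier_mat n n" "V \<in> carrier_mat n n" using U V by (auto simp: unitary_mat_def)
  then have C: "U * V - \<omega> \<cdot>\<^sub>m (V * U) \<in> carrier_mat n n" by auto
  note uU = uni_matop[OF U] and uV = uni_matop[OF V]
  \<comment> \<open>The trivial bound for a difference of two unitaries makes the supremum behind
    \<open>mat_norm\<close> finite.\<close>
  have K: "norm (matop n (U * V - \<omega> \<cdot>\<^sub>m (V * U)) f) \<le> 2 * norm f" if "f \<in> fin_vecs n" for f
  proof -
    have "norm (matop n U (matop n V f)) = norm f" "norm (\<omega> \<star> matop n V (matop n U f)) = norm f"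
      by (simp_all add: uni_norm[OF uU] uni_norm[OF uV] matop_fin_vecs that \<omega>)
    then show ?thesis
      unfolding matop_twisted_commutator[OF c]
      using norm_triangle_ineq4[of "matop n U (matop n V f)" "\<omega> \<star> matop n V (matop n U f)"] by simp
  qed
  show "\<delta> \<ge> 0" unfolding \<delta>_def by (rule mat_norm_bound(2)[OF C K])
  show "norm (matop n U (matop n V f) - \<omega> \<star> matop n V (matop n U f)) \<le> \<delta> * norm f" if "f \<in> fin_vecs n"
    using mat_norm_bound(1)[OF C K that] unfolding matop_twisted_commutator[OF c] \<delta>_def .
qed

text \<open>\<open>tensor_op A id\<close> is continuous and corresponds to
  \<open>amp (matop n A)\<close> under \<open>embed\<close>, so approximations of \<open>x\<close>
  give approximations of its image.\<close>

lemma emb_lim_tensor: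
  assumes A: "A \<in> carrier_mat n n" and f: "emb_lim e n f x"
  shows "emb_lim e n (\<lambda>r. amp (matop n A) (f r)) (tensor_op A id x)"
proof (rule emb_limI)
  show "amp (matop n A) (f r) \<in> dense_vecs n" for r
    unfolding dense_vecs_def by (rule dsumI) (simp_all add: clin_matop matop_fin_vecs)
  show "tensor_op A id x \<in> carrier_vec n" using A by (auto simp: tensor_op_def)
  fix i assume i: "i < n"
  have "embed e n (amp (matop n A) g) $ i = (\<Sum>j<n. A $$ (i, j) *\<^sub>C embed e n g $ j)" for g
  proof -
    have "embed e n (amp (matop n A) g) $ i = (\<Sum>k\<in>keys g. lookup (lookup (amp (matop n A) g) k) i
        *\<^sub>C e k)"
      by (rule embed_index) (auto simp: clin_matop in_keys_iff i clin_zero[OF clin_matop])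
    also have "\<dots> = (\<Sum>k\<in>keys g. \<Sum>j<n. A $$ (i, j) *\<^sub>C lookup (lookup g k) j *\<^sub>C e k)"
      by (simp add: clin_matop lookup_matop i scaleC_sum_left scaleC_scaleC)
    also have "\<dots> = (\<Sum>j<n. A $$ (i, j) *\<^sub>C embed e n g $ j)"
      by (subst sum.swap) (simp add: embed_def scaleC_sum_right)
    finally show ?thesis .
  qed
  moreover have "(\<lambda>r. \<Sum>j<n. A $$ (i, j) *\<^sub>C embed e n (f r) $ j) \<longlonglongrightarrow> (\<Sum>j<n. A $$ (i, j) *\<^sub>C x $ j)"
    by (intro tendsto_sum tendsto_scaleC emb_lim_index[OF f]) simp
  ultimately show "(\<lambda>r. embed e n (amp (matop n A) (f r)) $ i) \<longlonglongrightarrow> tensor_op A id x $ i"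
    using A i by (simp add: tensor_op_def)
qed

lemma op_norm_extend_le:
  assumes e: "orthonormal_basis e" and A: "A \<in> carrier_mat n n"
      and T: "uni (dense_vecs n) (dense_vecs n) T"
    and c: "\<And>f. f \<in> dense_vecs n \<Longrightarrow> norm (T f - amp (matop n A) f) \<le> c * norm f" and c0: "c \<ge> 0"
  shows "op_norm n (\<lambda>x. extend e n T x - tensor_op A id x) \<le> c"
  unfolding op_norm_def
proof (rule cSUP_least)
  fix x :: "'a vec" assume x: "x \<in> carrier_vec n"
  note l = emb_lim_coeffs[OF e x]
  have "(\<lambda>r. norm (T (coeffs e n x r) - amp (matop n A) (coeffs e n x r))) \<longlonglongrightarrow> l2norm_vec (extend e
      n T x - tensor_op A id x)"
    by (rule emb_lim_norm[OF e emb_lim_diff[OF emb_lim_extend[OF e T l] emb_lim_tensor[OF A l]]])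
  moreover have "(\<lambda>r. c * norm (coeffs e n x r)) \<longlonglongrightarrow> c * l2norm_vec x"
    by (intro tendsto_mult tendsto_const emb_lim_norm[OF e l])
  ultimately have "l2norm_vec (extend e n T x - tensor_op A id x) \<le> c * l2norm_vec x"
    by (rule LIMSEQ_le) (use c[OF coeffs_dense] in blast)
  moreover have "l2norm_vec x \<ge> 0" by (simp add: l2norm_vec_def sum_nonneg)
  \<comment> \<open>If \<open>l2norm_vec x = 0\<close>, the quotient is 0 by convention and
    \<open>c \<ge> 0\<close> gives the bound.\<close>
  ultimately show "l2norm_vec (extend e n T x - tensor_op A id x) / l2norm_vec x \<le> c"
    using c0 by (cases "l2norm_vec x = 0") (simp_all add: divide_le_eq)
qed (auto intro: zero_carrier_vec)

section \<open>Transfer to the Hilbert space and choice of the constants\<close>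

lemma transfer_to_hilbert_space:
  fixes e :: "nat \<Rightarrow> 'h::complex_hilbert_space"
  assumes e: "orthonormal_basis e" and U: "unitary_mat n U" and V: "unitary_mat n V" and c: "c \<ge> 0"
    and tp: "twisted_pair_near \<omega> (dense_vecs n) (amp (matop n U)) (amp (matop n V)) c"
  shows "\<exists>U' V'. unitary_op n U' \<and> unitary_op n V' \<and>
    (\<forall>x\<in>carrier_vec n. U' (V' x) = map_vec (scaleC \<omega>) (V' (U' x))) \<and>
    op_norm n (\<lambda>x. U' x - tensor_op U (id :: 'h \<Rightarrow> 'h) x) \<le> c \<and>
    op_norm n (\<lambda>x. V' x - tensor_op V (id :: 'h \<Rightarrow> 'h) x) \<le> c"
proof -
  have car: "U \<in> carrier_mat n n" "V \<in> carrier_mat n n" using U V by (auto simp: unitary_mat_def)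
  obtain X Y where X: "uni (dense_vecs n) (dense_vecs n) X" and Y: "uni (dense_vecs n) (dense_vecs n) Y"
    and XY: "\<And>f. f \<in> dense_vecs n \<Longrightarrow> X (Y f) = \<omega> \<star> Y (X f)"
    and cX: "\<And>f. f \<in> dense_vecs n \<Longrightarrow> norm (X f - amp (matop n U) f) \<le> c * norm f"
    and cY: "\<And>f. f \<in> dense_vecs n \<Longrightarrow> norm (Y f - amp (matop n V) f) \<le> c * norm f"
    using tp by (auto simp: twisted_pair_near_def)
  have "extend e n X (extend e n Y x) = map_vec (scaleC \<omega>) (extend e n Y (extend e n X x))"
    if x: "x \<in> carrier_vec n" for x
    using emb_lim_extend_extend[OF e X Y x] emb_lim_scale[OF emb_lim_extend_extend[OF e Y X x], of \<omega>]
    unfolding XY[OF coeffs_dense] by (rule emb_lim_unique)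
  then show ?thesis
    using unitary_op_extend[OF e X] unitary_op_extend[OF e Y]
      op_norm_extend_le[OF e car(1) X cX c] op_norm_extend_le[OF e car(2) Y cY c] by blast
qed

text \<open>The estimates involve \<open>N\<close>, the order of the root and the commutator norm,
  but not the dimension. As orders are at most \<open>m\<close>, one threshold serves all roots,
  dimensions and pairs.\<close>

lemma twisted_pair_near_uniform:
  assumes m: "m \<ge> 1" and \<epsilon>: "\<epsilon> > 0"
  shows "\<exists>\<delta>0>0. \<forall>\<omega> n U V. \<omega> ^ m = 1 \<and> unitary_mat n U \<and> unitary_mat n V \<and>
    mat_norm (U * V - \<omega> \<cdot>\<^sub>m (V * U)) < \<delta>0 \<longrightarrow>
    twisted_pair_near \<omega> (dense_vecs n) (amp (matop n U)) (amp (matop n V)) \<epsilon>"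
proof -
  \<comment> \<open>The diagonal model requires \<open>\<kappa> < 1\<close>. Since 48 is twice 24,
    the second bound keeps \<open>24 * sqrt \<kappa>\<close> within \<open>\<epsilon> / 2\<close>,
    which leaves the other half for \<open>d * \<delta>\<close>.\<close>
  define \<kappa>0 where "\<kappa>0 = min (1 / 2) ((\<epsilon> / 48)\<^sup>2)"
  have \<kappa>0: "\<kappa>0 > 0" using \<epsilon> by (simp add: \<kappa>0_def)
  obtain N :: nat where "N > (4 / \<kappa>0)\<^sup>2" using reals_Archimedean2 by blast
  then have N: "sqrt N > 4 / \<kappa>0" using \<kappa>0 by (intro real_less_rsqrt) auto
  have N1: "N \<ge> 1"
  proof (rule ccontr)
    assume "\<not> N \<ge> 1"
    then have "N = 0" by simp
    then show False using N \<kappa>0 by (simp add: divide_less_0_iff)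
  qed
  then have "sqrt N > 0" by simp
  then have N2: "2 / sqrt N < \<kappa>0 / 2"
    using N \<kappa>0 by (simp add: field_simps)
  \<comment> \<open>\<open>N\<close> is fixed by now. The first bound keeps
    \<open>N * \<delta>\<close> within \<open>\<kappa>0 / 2\<close>, the second keeps
    \<open>d * \<delta>\<close> within \<open>\<epsilon> / 2\<close> for every order
    \<open>d \<le> m\<close>.\<close>
  define \<delta>0 where "\<delta>0 = min (\<kappa>0 / (2 * N)) (\<epsilon> / (2 * m))"
  have \<delta>0: "\<delta>0 > 0" using \<kappa>0 \<epsilon> N1 m by (simp add: \<delta>0_def)
  have "twisted_pair_near \<omega> (dense_vecs n) (amp (matop n U)) (amp (matop n V)) \<epsilon>" (is "?near \<omega> n U V \<epsilon>")
    if \<omega>: "\<omega> ^ m = 1" and U: "unitary_mat n U" and V: "unitary_mat n V"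
      and less: "mat_norm (U * V - \<omega> \<cdot>\<^sub>m (V * U)) < \<delta>0" for \<omega> n U V
  proof -
    define \<delta> where "\<delta> = mat_norm (U * V - \<omega> \<cdot>\<^sub>m (V * U))"
    obtain d where d: "prim_root d \<omega>" "d \<le> m" by (rule prim_root_exists[OF \<omega> m])
    have "cmod \<omega> = 1" by (rule root_of_unity_cmod[OF \<omega> m])
    note \<delta> = twisted_commutator_bound[OF U V this, folded \<delta>_def]
    note u = uni_matop[OF U] uni_matop[OF V]
    show ?thesis
    proof (cases "n = 0")
      \<comment> \<open>For \<open>n = 0\<close> there is no nonzero vector to start from, but on
        the zero space the bound 2 implies every other one.\<close>
      case True
      have z: "x = 0" if "x \<in> dense_vecs n" for x
        using that True unfolding dense_vecs_def fin_vecs_def dsum_def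
        by (auto intro!: poly_mapping_eqI)
      have two: "?near \<omega> n U V 2"
        unfolding dense_vecs_def by (rule twisted_pair_near_two[OF u d(1)])
      show ?thesis by (rule twisted_pair_near_mono[OF two]) (drule z, simp)
    next
      case False
      define \<kappa> where "\<kappa> = 2 / sqrt N + N * \<delta>"
      have "N * \<delta> \<le> N * \<delta>0" using less by (simp add: \<delta>_def mult_left_mono)
      also have "\<dots> \<le> \<kappa>0 / 2" using N1 by (simp add: \<delta>0_def field_simps min_def)
      finally have \<kappa>: "\<kappa> < \<kappa>0" using N2 by (simp add: \<kappa>_def)
      then have \<kappa>1: "\<kappa> < 1" by (simp add: \<kappa>0_def)
      have "sqrt \<kappa> \<le> \<epsilon> / 48"
        using \<kappa> \<epsilon> by (intro real_le_lsqrt) (auto simp: \<kappa>0_def \<kappa>_def \<delta>(1))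
      moreover have "d * \<delta> \<le> \<epsilon> / 2"
      proof -
        have "d * \<delta> \<le> m * \<delta>0" using less d(2) \<delta>(1) by (intro mult_mono) (auto simp: \<delta>_def)
        also have "\<dots> \<le> \<epsilon> / 2" using m by (simp add: \<delta>0_def field_simps min_def)
        finally show ?thesis .
      qed
      ultimately have le: "d * \<delta> + 24 * sqrt \<kappa> \<le> \<epsilon>" by simp
      have ne: "\<exists>v\<in>fin_vecs n. v \<noteq> 0"
      proof (intro bexI[of _ "vec_fam n (vec n (\<lambda>_. 1))"] notI)
        assume "vec_fam n (vec n (\<lambda>_. 1)) = 0"
        then have "lookup (vec_fam n (vec n (\<lambda>_. 1))) 0 = 0" by simp
        then show False using False by (simp add: lookup_vec_fam)
      qed (rule vec_fam_mem)
      \<comment> \<open>Families over the \<open>n\<close> coordinates are their own coordinates, so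
        \<open>\<Phi>\<close> is the identity.\<close>
      have id_coord: "uni (fin_vecs n) (dsum {..<n} UNIV) (\<lambda>f. f)"
        using uni_id[OF csub_fin_vecs, of n] by (simp only: fin_vecs_def)
      have cnt: "countable {..<n}" by simp
      have bound: "norm (matop n U (matop n V f) - \<omega> \<star> matop n V (matop n U f)) \<le> \<delta> * norm f"
        if "f \<in> fin_vecs n" for f
        using that by (rule \<delta>(2))
      have "\<exists>(R :: (nat \<Rightarrow>\<^sub>0 nat \<Rightarrow>\<^sub>0 nat \<times> nat \<Rightarrow>\<^sub>0 nat \<Rightarrow>\<^sub>0 nat \<Rightarrow>\<^sub>0 complex) set) X Y.
        uni R R X \<and> uni R R Y \<and> (\<forall>f\<in>R. X (Y f) = \<omega> \<star> Y (X f)) \<and>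
        near (dense_vecs n) (amp (matop n U)) (amp (matop n V)) R X Y (d * \<delta> + 24 * sqrt \<kappa>)"
        unfolding dense_vecs_def
        by (rule near_twisted[OF u d(1) bound \<delta>(1) id_coord cnt ne N1 \<kappa>_def \<kappa>1])
      then obtain R X Y where R: "uni R R X" "uni R R Y" "\<forall>f\<in>R. X (Y f) = \<omega> \<star> Y (X f)"
        and n: "near (dense_vecs n) (amp (matop n U)) (amp (matop n V))
          (R :: (nat \<Rightarrow>\<^sub>0 nat \<Rightarrow>\<^sub>0 nat \<times> nat \<Rightarrow>\<^sub>0 nat \<Rightarrow>\<^sub>0 nat \<Rightarrow>\<^sub>0 complex) set) X Y (d * \<delta> + 24 * sqrt \<kappa>)"
        by blast
      have "?near \<omega> n U V (d * \<delta> + 24 * sqrt \<kappa>)"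
        using R n u unfolding dense_vecs_def
        by (intro twisted_pair_near_pullback[of _ _ _ R X Y]) (auto intro: uni_amp)
      then show ?thesis by (rule twisted_pair_near_mono) (intro mult_right_mono le norm_ge_zero)
    qed
  qed
  then show ?thesis using \<delta>0 by blast
qed

theorem theorem1p7:
  fixes m :: nat
  assumes m: "m \<ge> 1"
    and H: "\<exists>e :: nat \<Rightarrow> 'h::complex_hilbert_space. orthonormal_basis e"
  shows "\<exists>\<epsilon> :: real \<Rightarrow> real. (\<epsilon> \<longlongrightarrow> 0) (at_right 0) \<and>
    (\<forall>\<omega> :: complex. \<omega> ^ m = 1 \<longrightarrow>
      (\<forall>(n::nat) U V. unitary_mat n U \<and> unitary_mat n V \<longrightarrow>
        (\<exists>U' V'. unitary_op n U' \<and> unitary_op n V' \<and>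
          (\<forall>x\<in>carrier_vec n. U' (V' x) = map_vec (scaleC \<omega>) (V' (U' x))) \<and>
          op_norm n (\<lambda>x. U' x - tensor_op U (id :: 'h \<Rightarrow> 'h) x)
            \<le> \<epsilon> (mat_norm (U * V - \<omega> \<cdot>\<^sub>m (V * U))) \<and>
          op_norm n (\<lambda>x. V' x - tensor_op V (id :: 'h \<Rightarrow> 'h) x)
            \<le> \<epsilon> (mat_norm (U * V - \<omega> \<cdot>\<^sub>m (V * U))))))"
proof -
  obtain e :: "nat \<Rightarrow> 'h" where e: "orthonormal_basis e" using H by blast
  define P where "P \<omega> n U V c \<longleftrightarrow> twisted_pair_near \<omega> (dense_vecs n) (amp (matop n U)) (amp (matop n V)) c"
    for \<omega> n U V c
  \<comment> \<open>The errors that work at commutator norm \<open>\<delta>\<close>, uniformly in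
    the root, the dimension and the pair. The function is built from the best of them, an infimum
    over a set that contains 2.\<close>
  define G where "G \<delta> = {c. c \<ge> 0 \<and> (\<forall>\<omega> n U V. \<omega> ^ m = 1 \<and> unitary_mat n U \<and> unitary_mat n V \<and>
    mat_norm (U * V - \<omega> \<cdot>\<^sub>m (V * U)) = \<delta> \<longrightarrow> P \<omega> n U V c)}" for \<delta>
  \<comment> \<open>The summand \<open>\<delta>\<close> is there since the infimum need not be attained.\<close>
  define \<epsilon> where "\<epsilon> \<delta> = (if \<delta> > 0 then Inf (G \<delta>) + \<delta> else 2)" for \<delta>
  have P2: "P \<omega> n U V 2" if w: "\<omega> ^ m = 1" and u: "unitary_mat n U" "unitary_mat n V" for \<omega> n U V
  proof -
    obtain d where d: "prim_root d \<omega>" by (rule prim_root_exists[OF w m])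
    show ?thesis unfolding P_def dense_vecs_def
      by (rule twisted_pair_near_two[OF uni_matop[OF u(1)] uni_matop[OF u(2)] d])
  qed
  then have G2: "2 \<in> G \<delta>" for \<delta> by (auto simp: G_def)
  have bdd: "bdd_below (G \<delta>)" for \<delta> unfolding G_def by (rule bdd_belowI[of _ 0]) simp
  have Inf0: "Inf (G \<delta>) \<ge> 0" for \<delta> by (rule cInf_greatest) (use G2 in blast, simp add: G_def)
  have \<epsilon>0: "\<epsilon> \<delta> \<ge> 0" for \<delta> using Inf0[of \<delta>] by (simp add: \<epsilon>_def)
  have "(\<epsilon> \<longlongrightarrow> 0) (at_right 0)"
  proof (rule tendstoI)
    fix \<eta> :: real assume \<eta>: "\<eta> > 0"
    obtain \<delta>0 where \<delta>0: "\<delta>0 > 0" "\<And>\<omega> n U V. \<omega> ^ m = 1 \<and> unitary_mat n U \<and> unitary_mat n V \<and>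
        mat_norm (U * V - \<omega> \<cdot>\<^sub>m (V * U)) < \<delta>0 \<Longrightarrow> P \<omega> n U V (\<eta> / 2)"
      using twisted_pair_near_uniform[OF m, of "\<eta> / 2"] \<eta> unfolding P_def by auto
    have "dist (\<epsilon> \<delta>) 0 < \<eta>" if "0 < \<delta>" "\<delta> < min \<delta>0 (\<eta> / 2)" for \<delta>
    proof -
      have "\<eta> / 2 \<in> G \<delta>" using \<delta>0(2) that \<eta> by (auto simp: G_def)
      then have "Inf (G \<delta>) \<le> \<eta> / 2" by (intro cInf_lower bdd)
      then show ?thesis using that \<epsilon>0[of \<delta>] by (simp add: \<epsilon>_def dist_norm)
    qed
    then show "\<forall>\<^sub>F \<delta> in at_right 0. dist (\<epsilon> \<delta>) 0 < \<eta>"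
      using \<delta>0(1) \<eta> by (intro eventually_at_rightI[of 0 "min \<delta>0 (\<eta> / 2)"]) auto
  qed
  moreover have "P \<omega> n U V (\<epsilon> (mat_norm (U * V - \<omega> \<cdot>\<^sub>m (V * U))))"
    if "\<omega> ^ m = 1" "unitary_mat n U" "unitary_mat n V" for \<omega> n U V
  proof -
    let ?\<delta> = "mat_norm (U * V - \<omega> \<cdot>\<^sub>m (V * U))"
    show ?thesis
    proof (cases "?\<delta> > 0")
      case True
      then have "Inf (G ?\<delta>) < \<epsilon> ?\<delta>" by (simp add: \<epsilon>_def)
      then obtain c where c: "c \<in> G ?\<delta>" "c < \<epsilon> ?\<delta>"
        using cInf_lessD[of "G ?\<delta>"] G2 by blast
      then have "P \<omega> n U V c" using that unfolding G_def by blast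
      then show ?thesis unfolding P_def by (rule twisted_pair_near_mono) (use c in \<open>simp add: mult_right_mono\<close>)
    next
      \<comment> \<open>The commutator vanishes here. A limit from the right leaves the value at 0
        free, so the bound 2 is enough.\<close>
      case False
      then show ?thesis using P2[OF that] by (simp add: \<epsilon>_def)
    qed
  qed
  ultimately show ?thesis
    unfolding P_def
    by (intro exI[of _ \<epsilon>] conjI allI impI transfer_to_hilbert_space[OF e _ _ \<epsilon>0]) simp_all
qed

end
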